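(* Let $k$ be a constant and let $\mathcal{C}_k$ be the class of graphs with vertex cover number at most $k$. \textsc{Sliding Window Temporal Vertex Cover} on always $\mathcal{C}_k$ temporal graphs can be solved in $O(T\Delta(n+m)\cdot n^{k(\Delta+1)})$ time, where $n$ and $m$ are the numbers of vertices and edges of the underlying graph, $T$ is the lifetime and $\Delta$ is the window length.
   Context: A temporal graph is a pair $(G,\lambda)$ where $G=(V,E)$ is a finite simple undirected graph and $\lambda:E\to 2^{\mathbb{N}}$ assigns to every edge a finite nonempty set of positive integer time labels, given explicitly; edge $e$ is active at each $t\in\lambda(e)$. The lifetime is $T=\max\{t:t\in\lambda(e),e\in E\}$; the snapshot at time $t$ is $G_t=(V,E_t)$ with $E_t=\{e:t\in\lambda(e)\}$. For a class $\mathcal{X}$ of graphs, $(G,\lambda)$ is an always $\mathcal{X}$ temporal graph if $G_t\in\mathcal{X}$ for every $t\in\{1,\dots,T\}$. A vertex appearance is a pair $(v,t)$, $v\in V$, $t\in\{1,\dots,T\}$; it temporally covers edge $e$ if $v$ is an endpoint of $e$ and $t\in\lambda(e)$. For $\Delta\le T$ and $t\in\{1,\dots,T-\Delta+1\}$ let $W_t=\{t,\dots,t+\Delta-1\}$ and $E[W_t]=\bigcup_{i\in W_t}E_i$. A sliding $\Delta$-window temporal vertex cover is a set $\mathcal{S}$ of vertex appearances such that for every $t\in\{1,\dots,T-\Delta+1\}$ and every $e\in E[W_t]$, some $(w,s)\in\mathcal{S}$ with $s\in W_t$ temporally covers $e$. \textsc{Sliding Window Temporal Vertex Cover}: given $(G,\lambda)$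 and $\Delta\le T$, find a sliding $\Delta$-window temporal vertex cover of minimum cardinality. *)

theory Defs
  imports Main
begin

section \<open>Graphs and temporal graphs\<close>

type_synonym 'v graph = "'v set \<times> 'v set set"

definition simple_graph :: "'v graph \<Rightarrow> bool" where
  "simple_graph G \<longleftrightarrow> finite (fst G) \<and> (\<forall>e\<in>snd G. e \<subseteq> fst G \<and> card e = 2)"

definition vertex_cover :: "'v graph \<Rightarrow> 'v set \<Rightarrow> bool" where
  "vertex_cover G C \<longleftrightarrow> C \<subseteq> fst G \<and> (\<forall>e\<in>snd G. e \<inter> C \<noteq> {})"

definition vertex_cover_number :: "'v graph \<Rightarrow> nat" where
  "vertex_cover_number G = (LEAST c. \<exists>C. vertex_cover G C \<and> card C = c)"

definition vc_class :: "nat \<Rightarrow> 'v graph set" where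
  "vc_class k = {G. simple_graph G \<and> vertex_cover_number G \<le> k}"

text \<open>A labelling is a total function on vertex sets; only its values on edges matter.\<close>

type_synonym 'v labelling = "'v set \<Rightarrow> nat set"

definition temporal_graph :: "'v graph \<Rightarrow> 'v labelling \<Rightarrow> bool" where
  "temporal_graph G lam \<longleftrightarrow> simple_graph G \<and>
     (\<forall>e\<in>snd G. finite (lam e) \<and> lam e \<noteq> {} \<and> 0 \<notin> lam e)"

text \<open>
  The maximum is over a nonempty set as soon as there is an edge; an edgeless graph gets
  lifetime 0, so it admits no window length \<open>\<Delta>\<close> with \<open>1 \<le> \<Delta> \<le> T\<close>.
\<close>

definition lifetime :: "'v graph \<Rightarrow> 'v labelling \<Rightarrow> nat" where
  "lifetime G lam = Max (insert 0 (\<Union>e\<in>snd G. lam e))"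

definition edges_at :: "'v graph \<Rightarrow> 'v labelling \<Rightarrow> nat \<Rightarrow> 'v set set" where
  "edges_at G lam t = {e \<in> snd G. t \<in> lam e}"

definition snapshot :: "'v graph \<Rightarrow> 'v labelling \<Rightarrow> nat \<Rightarrow> 'v graph" where
  "snapshot G lam t = (fst G, edges_at G lam t)"

definition always :: "'v graph set \<Rightarrow> 'v graph \<Rightarrow> 'v labelling \<Rightarrow> bool" where
  "always X G lam \<longleftrightarrow> (\<forall>t\<in>{1..lifetime G lam}. snapshot G lam t \<in> X)"

definition vertex_appearances :: "'v graph \<Rightarrow> 'v labelling \<Rightarrow> ('v \<times> nat) set" where
  "vertex_appearances G lam = fst G \<times> {1..lifetime G lam}"

definition temporally_covers :: "'v labelling \<Rightarrow> 'v \<times> nat \<Rightarrow> 'v set \<Rightarrow> bool" where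
  "temporally_covers lam a e \<longleftrightarrow> fst a \<in> e \<and> snd a \<in> lam e"

definition window :: "nat \<Rightarrow> nat \<Rightarrow> nat set" where
  "window \<Delta> t = {t..<t + \<Delta>}"

definition window_edges :: "'v graph \<Rightarrow> 'v labelling \<Rightarrow> nat \<Rightarrow> nat \<Rightarrow> 'v set set" where
  "window_edges G lam \<Delta> t = (\<Union>i\<in>window \<Delta> t. edges_at G lam i)"

definition sw_tvc :: "'v graph \<Rightarrow> 'v labelling \<Rightarrow> nat \<Rightarrow> ('v \<times> nat) set \<Rightarrow> bool" where
  "sw_tvc G lam \<Delta> S \<longleftrightarrow> S \<subseteq> vertex_appearances G lam \<and>
     (\<forall>t\<in>{1..lifetime G lam - \<Delta> + 1}. \<forall>e\<in>window_edges G lam \<Delta> t.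
        \<exists>(w, s)\<in>S. s \<in> window \<Delta> t \<and> temporally_covers lam (w, s) e)"

definition minimum_sw_tvc :: "'v graph \<Rightarrow> 'v labelling \<Rightarrow> nat \<Rightarrow> ('v \<times> nat) set \<Rightarrow> bool" where
  "minimum_sw_tvc G lam \<Delta> S \<longleftrightarrow> sw_tvc G lam \<Delta> S \<and>
     (\<forall>S'. sw_tvc G lam \<Delta> S' \<longrightarrow> card S \<le> card S')"


section \<open>Random access machine\<close>

text \<open>
  A random access machine with uniform cost: a state consists of registers and a memory, both
  holding natural numbers. A program mentions finitely many registers, each by a fixed index;
  memory is addressed indirectly through registers. Arithmetic is restricted to addition and
  truncated subtraction, since unit-cost multiplication would build numbers of exponential
  length in polynomially many steps. Control flow is structured, with comparisons of two
  registers as tests.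
\<close>

type_synonym state = "(nat \<Rightarrow> nat) \<times> (nat \<Rightarrow> nat)"

datatype com =
    Skip
  | LoadConst nat nat
  | Add nat nat nat
  | Sub nat nat nat
  | Load nat nat
  | Store nat nat
  | Seq com com
  | IfLess nat nat com com
  | WhileLess nat nat com

text \<open>
  \<open>exec c s t s'\<close>: started in \<open>s\<close>, the program \<open>c\<close> halts in \<open>s'\<close> after exactly \<open>t\<close> steps.
  Every instruction and every evaluation of a test is one step.
\<close>

inductive exec :: "com \<Rightarrow> state \<Rightarrow> nat \<Rightarrow> state \<Rightarrow> bool" where
  Skip: "exec Skip s 1 s"
| LoadConst: "exec (LoadConst i c) (r, m) 1 (r(i := c), m)"
| Add: "exec (Add i j l) (r, m) 1 (r(i := r j + r l), m)"
| Sub: "exec (Sub i j l) (r, m) 1 (r(i := r j - r l), m)"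
| Load: "exec (Load i j) (r, m) 1 (r(i := m (r j)), m)"
| Store: "exec (Store i j) (r, m) 1 (r, m(r i := r j))"
| Seq: "exec c1 s t1 s' \<Longrightarrow> exec c2 s' t2 s'' \<Longrightarrow> exec (Seq c1 c2) s (t1 + t2) s''"
| IfTrue: "fst s i < fst s j \<Longrightarrow> exec c1 s t s' \<Longrightarrow> exec (IfLess i j c1 c2) s (1 + t) s'"
| IfFalse: "\<not> fst s i < fst s j \<Longrightarrow> exec c2 s t s' \<Longrightarrow> exec (IfLess i j c1 c2) s (1 + t) s'"
| WhileFalse: "\<not> fst s i < fst s j \<Longrightarrow> exec (WhileLess i j c) s 1 s"
| WhileTrue: "fst s i < fst s j \<Longrightarrow> exec c s t1 s' \<Longrightarrow> exec (WhileLess i j c) s' t2 s'' \<Longrightarrow>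
    exec (WhileLess i j c) s (1 + t1 + t2) s''"

inductive_cases exec_SkipE: "exec Skip s t s'"
inductive_cases exec_LoadConstE: "exec (LoadConst i c) s t s'"
inductive_cases exec_AddE: "exec (Add i j l) s t s'"
inductive_cases exec_SubE: "exec (Sub i j l) s t s'"
inductive_cases exec_LoadE: "exec (Load i j) s t s'"
inductive_cases exec_StoreE: "exec (Store i j) s t s'"
inductive_cases exec_SeqE: "exec (Seq c1 c2) s t s'"
inductive_cases exec_IfE: "exec (IfLess i j c1 c2) s t s'"
inductive_cases exec_WhileE: "exec (WhileLess i j c) s t s'"

lemma exec_deterministic:
  assumes "exec c s t s'" and "exec c s u s''"
  shows "t = u \<and> s' = s''"
  using assms
proof (induction arbitrary: u s'' rule: exec.induct)
  case (Skip s)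
  then show ?case by (auto elim: exec_SkipE)
next
  case (LoadConst i c r m)
  then show ?case by (auto elim: exec_LoadConstE)
next
  case (Add i j l r m)
  then show ?case by (auto elim: exec_AddE)
next
  case (Sub i j l r m)
  then show ?case by (auto elim: exec_SubE)
next
  case (Load i j r m)
  then show ?case by (auto elim: exec_LoadE)
next
  case (Store i j r m)
  then show ?case by (auto elim: exec_StoreE)
next
  case (Seq c1 s t1 s1 c2 t2 s2)
  from Seq.prems obtain u1 u2 z
    where u: "u = u1 + u2" and 1: "exec c1 s u1 z" and 2: "exec c2 z u2 s''"
    by (rule exec_SeqE)
  have eq: "t1 = u1 \<and> s1 = z" using 1 by (rule Seq.IH(1))
  with 2 have "exec c2 s1 u2 s''" by simp
  then have "t2 = u2 \<and> s2 = s''" by (rule Seq.IH(2))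
  with u eq show ?case by simp
next
  case (IfTrue s i j c1 t s1 c2)
  from IfTrue.prems IfTrue.hyps(1) obtain u1 where u: "u = 1 + u1" and 1: "exec c1 s u1 s''"
    by (auto elim: exec_IfE)
  have "t = u1 \<and> s1 = s''" using 1 by (rule IfTrue.IH)
  with u show ?case by simp
next
  case (IfFalse s i j c2 t s1 c1)
  from IfFalse.prems IfFalse.hyps(1) obtain u1 where u: "u = 1 + u1" and 1: "exec c2 s u1 s''"
    by (auto elim: exec_IfE)
  have "t = u1 \<and> s1 = s''" using 1 by (rule IfFalse.IH)
  with u show ?case by simp
next
  case (WhileFalse s i j c)
  then show ?case by (auto elim: exec_WhileE)
next
  case (WhileTrue s i j c t1 s1 t2 s2)
  from WhileTrue.prems WhileTrue.hyps(1) obtain u1 u2 z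
    where u: "u = 1 + u1 + u2" and 1: "exec c s u1 z" and 2: "exec (WhileLess i j c) z u2 s''"
    by (auto elim: exec_WhileE)
  have eq: "t1 = u1 \<and> s1 = z" using 1 by (rule WhileTrue.IH(1))
  with 2 have "exec (WhileLess i j c) s1 u2 s''" by simp
  then have "t2 = u2 \<and> s2 = s''" by (rule WhileTrue.IH(2))
  with u eq show ?case by simp
qed

definition initial_state :: "nat list \<Rightarrow> state" where
  "initial_state xs = (\<lambda>_. 0, \<lambda>a. if a < length xs then xs ! a else 0)"

text \<open>
  The output is a list of vertex appearances: its length in cell 0, followed by its entries,
  each in two consecutive cells.
\<close>

definition result_list :: "state \<Rightarrow> (nat \<times> nat) list" where
  "result_list s = map (\<lambda>i. (snd s (2 * i + 1), snd s (2 * i + 2))) [0..<snd s 0]"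


section \<open>Encoding of instances\<close>

text \<open>
  Vertices are numbered \<open>0, \<dots>, n - 1\<close>. The input consists of \<open>n\<close>, \<open>m\<close> and \<open>\<Delta>\<close>, followed by one
  block per edge made of its two endpoints, the number of its labels and the labels. The order
  of the edges, of the endpoints of an edge and of the labels of an edge is arbitrary.
\<close>

definition encodes :: "nat list \<Rightarrow> nat graph \<Rightarrow> nat labelling \<Rightarrow> nat \<Rightarrow> bool" where
  "encodes xs G lam \<Delta> \<longleftrightarrow> fst G = {..<card (fst G)} \<and>
     (\<exists>bs :: (nat \<times> nat \<times> nat list) list.
        distinct (map (\<lambda>(u, v, ls). {u, v}) bs) \<and>
        set (map (\<lambda>(u, v, ls). {u, v}) bs) = snd G \<and>
        (\<forall>(u, v, ls)\<in>set bs. distinct ls \<and> set ls = lam {u, v}) \<and>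
        xs = [card (fst G), length bs, \<Delta>] @ concat (map (\<lambda>(u, v, ls). [u, v, length ls] @ ls) bs))"

end

theory Submission
  imports Defs
begin

text \<open>
  An optimal solution has at most \<open>k\<close> appearances at every time: more of them can be replaced by a
  vertex cover of that snapshot. For the same reason the only set of exactly \<open>k\<close> vertices that is
  needed at a given time is one fixed vertex cover of the snapshot, so the choices per time are this
  cover and the sequences of fewer than \<open>k\<close> vertices. There are at most \<open>n ^ k\<close> of them, which
  matters because this number is raised to the power \<open>\<Delta>\<close>. A dynamic program over time keeps
  the last \<open>\<Delta> - 1\<close> choices as its state and checks one window per transition.
  Choices are weighted by the length of the sequence, not by the size of the set; the optimum is the
  same, and an optimal output cannot contain repetitions.

  The program is written in a small language with expressions, unbounded arrays and for-loops,
  which is compiled to the random access machine with a constant slowdown.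
\<close>

section \<open>A language with arrays\<close>

text \<open>The exchange at one time is purely local: an edge covered by an appearance at time
  \<open>t\<close> is active at \<open>t\<close>, so a cover of that snapshot covers it at the same
  time and no window loses anything. Hence one cover per time can be fixed in advance. Counting
  decides the shape of the choices. Sequences of length at most \<open>k\<close> number 1 + n + ...
  + n^k, more than n^k, and the excess factor would be raised to the window length. Sequences
  shorter than \<open>k\<close> plus one code for the cover number at most n^k once n is at least 2;
  a positive lifetime supplies an active edge, hence both n >= 2 and k >= 1. The machine lacks
  multiplication and division, so sequences are stored as a trie: heads and tails are table entries,
  and the set of edges hit by a sequence is inherited from its parent. Digits of window codes are
  tabulated as well. The lifetime is not part of the input, so memory cannot be laid out before a
  first scan: the boundary \<open>L\<close> between bare memory and arrays is computed at run time
  and must leave room for input and output.\<close>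

datatype aexp = N nat | V nat | Plus aexp aexp | Minus aexp aexp | Arr nat aexp

datatype hcom =
    HSkip
  | Assign nat aexp
  | Upd nat aexp aexp
  | HSeq hcom hcom (infixr ";;" 60)
  | Cond aexp aexp hcom hcom
  | For nat nat hcom

type_synonym hstate = "(nat \<Rightarrow> nat) \<times> (nat \<Rightarrow> nat \<Rightarrow> nat)"

primrec aval :: "aexp \<Rightarrow> hstate \<Rightarrow> nat" where
  "aval (N c) s = c"
| "aval (V x) s = fst s x"
| "aval (Plus a b) s = aval a s + aval b s"
| "aval (Minus a b) s = aval a s - aval b s"
| "aval (Arr b a) s = snd s b (aval a s)"

text \<open>The bare memory ends at \<open>L\<close>, hence the bound for array 0. Other arrays are
  addressed relative to \<open>L\<close>, which compiled code reads from register 0, hence the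
  demand on variable 0.\<close>

definition arr_ok :: "nat \<Rightarrow> nat \<Rightarrow> nat \<Rightarrow> hstate \<Rightarrow> bool" where
  "arr_ok L b i s \<longleftrightarrow> b < 16 \<and> (if b = 0 then i < L else fst s 0 = L)"

primrec aok :: "nat \<Rightarrow> aexp \<Rightarrow> hstate \<Rightarrow> bool" where
  "aok L (N c) s = True"
| "aok L (V x) s = True"
| "aok L (Plus a b) s = (aok L a s \<and> aok L b s)"
| "aok L (Minus a b) s = (aok L a s \<and> aok L b s)"
| "aok L (Arr b a) s = (aok L a s \<and> arr_ok L b (aval a s) s)"

text \<open>Indexed by the number of completed iterations, so that \<open>cost\<close> and
  \<open>cok\<close> can speak of the state in which each single iteration starts.\<close>

primrec for_iter :: "nat \<Rightarrow> (hstate \<Rightarrow> hstate) \<Rightarrow> hstate \<Rightarrow> nat \<Rightarrow> hstate" where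
  "for_iter x f s 0 = ((fst s)(x := 0), snd s)"
| "for_iter x f s (Suc i) =
     (let s' = f (for_iter x f s i) in ((fst s')(x := Suc (fst s' x)), snd s'))"

primrec sem :: "hcom \<Rightarrow> hstate \<Rightarrow> hstate" where
  "sem HSkip s = s"
| "sem (Assign x a) s = ((fst s)(x := aval a s), snd s)"
| "sem (Upd b i a) s = (fst s, (snd s)(b := (snd s b)(aval i s := aval a s)))"
| "sem (c1 ;; c2) s = sem c2 (sem c1 s)"
| "sem (Cond a b c1 c2) s = (if aval a s < aval b s then sem c1 s else sem c2 s)"
| "sem (For x y c) s =
     for_iter x (sem c) s (fst s y)"

text \<open>The size of expressions is not charged here: it is fixed by the program text and
  absorbed by \<open>slowdown\<close>.\<close>

primrec cost :: "hcom \<Rightarrow> hstate \<Rightarrow> nat" where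
  "cost HSkip s = 1"
| "cost (Assign x a) s = 1"
| "cost (Upd b i a) s = 1"
| "cost (c1 ;; c2) s = cost c1 s + cost c2 (sem c1 s)"
| "cost (Cond a b c1 c2) s = 1 + (if aval a s < aval b s then cost c1 s else cost c2 s)"
| "cost (For x y c) s = 1 + (\<Sum>i<fst s y. 1 + cost c (for_iter x (sem c) s i))"

primrec modvars :: "hcom \<Rightarrow> nat set" where
  "modvars HSkip = {}"
| "modvars (Assign x a) = {x}"
| "modvars (Upd b i a) = {}"
| "modvars (c1 ;; c2) = modvars c1 \<union> modvars c2"
| "modvars (Cond a b c1 c2) = modvars c1 \<union> modvars c2"
| "modvars (For x y c) = insert x (modvars c)"

primrec modarrs :: "hcom \<Rightarrow> nat set" where
  "modarrs HSkip = {}"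
| "modarrs (Assign x a) = {}"
| "modarrs (Upd b i a) = {b}"
| "modarrs (c1 ;; c2) = modarrs c1 \<union> modarrs c2"
| "modarrs (Cond a b c1 c2) = modarrs c1 \<union> modarrs c2"
| "modarrs (For x y c) = modarrs c"

text \<open>The condition on loops reconciles two semantics: \<open>sem\<close> fixes the number of
  iterations on entry, whereas the compiled while loop rereads both registers at every test.\<close>

primrec cok :: "nat \<Rightarrow> hcom \<Rightarrow> hstate \<Rightarrow> bool" where
  "cok L HSkip s = True"
| "cok L (Assign x a) s = aok L a s"
| "cok L (Upd b i a) s = (aok L i s \<and> aok L a s \<and> arr_ok L b (aval i s) s)"
| "cok L (c1 ;; c2) s = (cok L c1 s \<and> cok L c2 (sem c1 s))"
| "cok L (Cond a b c1 c2) s =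
     (aok L a s \<and> aok L b s \<and> (if aval a s < aval b s then cok L c1 s else cok L c2 s))"
| "cok L (For x y c) s = (x \<noteq> y \<and> x \<notin> modvars c \<and> y \<notin> modvars c \<and>
     (\<forall>i<fst s y. cok L c (for_iter x (sem c) s i)))"

text \<open>Registers from \<open>D\<close> on are scratch space for compiled expressions, so
  program variables have to stay below \<open>D\<close>.\<close>

primrec avars_below :: "nat \<Rightarrow> aexp \<Rightarrow> bool" where
  "avars_below D (N c) = True"
| "avars_below D (V x) = (x < D)"
| "avars_below D (Plus a b) = (avars_below D a \<and> avars_below D b)"
| "avars_below D (Minus a b) = (avars_below D a \<and> avars_below D b)"
| "avars_below D (Arr b a) = avars_below D a"

primrec vars_below :: "nat \<Rightarrow> hcom \<Rightarrow> bool" where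
  "vars_below D HSkip = True"
| "vars_below D (Assign x a) = (x < D \<and> avars_below D a)"
| "vars_below D (Upd b i a) = (avars_below D i \<and> avars_below D a)"
| "vars_below D (c1 ;; c2) = (vars_below D c1 \<and> vars_below D c2)"
| "vars_below D (Cond a b c1 c2) =
     (avars_below D a \<and> avars_below D b \<and> vars_below D c1 \<and> vars_below D c2)"
| "vars_below D (For x y c) = (x < D \<and> y < D \<and> vars_below D c)"

definition same_except ::
  "nat set \<Rightarrow> nat set \<Rightarrow> (nat \<Rightarrow> nat) \<Rightarrow> (nat \<Rightarrow> nat \<Rightarrow> nat) \<Rightarrow> (nat \<Rightarrow> nat) \<Rightarrow> (nat \<Rightarrow> nat \<Rightarrow> nat) \<Rightarrow> bool"
  where "same_except X Y v A v' A' \<longleftrightarrow> (\<forall>z. z \<notin> X \<longrightarrow> v' z = v z) \<and> (\<forall>b. b \<notin> Y \<longrightarrow> A' b = A b)"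

lemma sem_frame:
  "same_except (modvars c) (modarrs c) (fst s) (snd s) (fst (sem c s)) (snd (sem c s))"
proof (induction c arbitrary: s)
  case (For x y c)
  have "same_except (insert x (modvars c)) (modarrs c) (fst s) (snd s)
      (fst (for_iter x (sem c) s i)) (snd (for_iter x (sem c) s i))" for i
  proof (induction i)
    case (Suc i)
    then show ?case
      using For.IH[of "for_iter x (sem c) s i"]
      by (auto simp: same_except_def Let_def)
  qed (simp add: same_except_def)
  then show ?case by simp
qed (auto simp: same_except_def)


subsection \<open>Compilation\<close>

primrec etime :: "aexp \<Rightarrow> nat" where
  "etime (N c) = 1"
| "etime (V x) = 2"
| "etime (Plus a b) = etime a + etime b + 1"
| "etime (Minus a b) = etime a + etime b + 1"
| "etime (Arr b a) = etime a + (if b = 0 then 0 else 7) + 1"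

text \<open>Four doublings replace a multiplication by 16; then \<open>b\<close> selects the residue
  class and register 0 contributes \<open>L\<close>. These seven instructions are the 7 in
  \<open>etime\<close>.\<close>

definition comp_addr :: "nat \<Rightarrow> nat \<Rightarrow> com" where
  "comp_addr d b = Seq (Add d d d) (Seq (Add d d d) (Seq (Add d d d) (Seq (Add d d d)
     (Seq (LoadConst (Suc d) b) (Seq (Add d d (Suc d)) (Add d d 0))))))"

text \<open>Registers from \<open>d\<close> on serve as the evaluation stack, with the result in
  \<open>d\<close>. The machine has no move, so a variable is copied by adding it to zero.\<close>

primrec comp_exp :: "nat \<Rightarrow> aexp \<Rightarrow> com" where
  "comp_exp d (N c) = LoadConst d c"
| "comp_exp d (V x) = Seq (LoadConst d 0) (Add d x d)"
| "comp_exp d (Plus a b) = Seq (comp_exp d a) (Seq (comp_exp (Suc d) b) (Add d d (Suc d)))"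
| "comp_exp d (Minus a b) = Seq (comp_exp d a) (Seq (comp_exp (Suc d) b) (Sub d d (Suc d)))"
| "comp_exp d (Arr b a) =
     Seq (comp_exp d a) (if b = 0 then Load d d else Seq (comp_addr d b) (Load d d))"

primrec compile :: "nat \<Rightarrow> hcom \<Rightarrow> com" where
  "compile D HSkip = Skip"
| "compile D (Assign x a) = Seq (comp_exp D a) (Seq (LoadConst (Suc D) 0) (Add x D (Suc D)))"
| "compile D (Upd b i a) = Seq (comp_exp D i) (Seq (if b = 0 then Skip else comp_addr D b)
     (Seq (comp_exp (Suc D) a) (Store D (Suc D))))"
| "compile D (c1 ;; c2) = Seq (compile D c1) (compile D c2)"
| "compile D (Cond a b c1 c2) =
     Seq (comp_exp D a) (Seq (comp_exp (Suc D) b) (IfLess D (Suc D) (compile D c1) (compile D c2)))"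
| "compile D (For x y c) = Seq (LoadConst x 0)
     (WhileLess x y (Seq (compile D c) (Seq (LoadConst D 1) (Add x x D))))"

text \<open>For a loop, 3 pays for one test and the two instructions that increase the counter. The
  initial assignment and the final failing test are charged to the leading 1 in
  \<open>cost\<close>.\<close>

primrec slowdown :: "hcom \<Rightarrow> nat" where
  "slowdown HSkip = 1"
| "slowdown (Assign x a) = etime a + 2"
| "slowdown (Upd b i a) = etime i + etime a + 8"
| "slowdown (c1 ;; c2) = slowdown c1 + slowdown c2"
| "slowdown (Cond a b c1 c2) = etime a + etime b + 1 + slowdown c1 + slowdown c2"
| "slowdown (For x y c) = slowdown c + 3"

text \<open>Array 0 is the bare memory below address \<open>L\<close>; the arrays 1 to 15 are interleaved above
  \<open>L\<close>, so that each of them is unbounded. Variable 0 holds \<open>L\<close> as soon as one of them is used.\<close>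

definition represents :: "nat \<Rightarrow> nat \<Rightarrow> hstate \<Rightarrow> state \<Rightarrow> bool" where
  "represents D L s S \<longleftrightarrow> (\<forall>x<D. fst S x = fst s x) \<and> (\<forall>i<L. snd S i = snd s 0 i) \<and>
     (\<forall>b i. 0 < b \<longrightarrow> b < 16 \<longrightarrow> snd S (L + 16 * i + b) = snd s b i)"

section \<open>Correctness and running time of compiled code\<close>

lemma exec_comp_addr:
  assumes "0 < d"
  shows "\<exists>r'. exec (comp_addr d b) (r, m) 7 (r', m) \<and> r' d = r 0 + 16 * r d + b \<and> (\<forall>x<d. r' x = r x)"
proof -
  have eq: "(7::nat) = 1 + (1 + (1 + (1 + (1 + (1 + 1)))))" by simp
  show ?thesis
    unfolding comp_addr_def eq
    by (rule exI, rule conjI, (rule exec.intros)+) (use assms in auto)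
qed

lemma exec_comp_exp:
  assumes "represents D L s (r, m)" "D \<le> d" "0 < D" "aok L a s" "avars_below D a"
  shows "\<exists>r'. exec (comp_exp d a) (r, m) (etime a) (r', m) \<and> r' d = aval a s \<and> (\<forall>x<d. r' x = r x)"
  using assms
proof (induction a arbitrary: d r)
  case (N c)
  show ?case using exec.LoadConst[of d c r m] by (intro exI[of _ "r(d := c)"]) (simp add: fun_upd_def)
next
  case (V x)
  let ?r = "(r(d := 0))(d := (r(d := 0)) x + (r(d := 0)) d)"
  have 1: "exec (comp_exp d (V x)) (r, m) (etime (V x)) (?r, m)"
    unfolding comp_exp.simps etime.simps one_add_one[symmetric] by (rule exec.intros)+
  have "?r d = aval (V x) s" "\<forall>x<d. ?r x = r x" using V by (auto simp: represents_def)
  with 1 show ?case by blast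
next
  case (Plus a b)
  then obtain r1 where 1: "exec (comp_exp d a) (r, m) (etime a) (r1, m)" "r1 d = aval a s"
    "\<forall>x<d. r1 x = r x" by fastforce
  have "represents D L s (r1, m)" using Plus.prems 1 by (auto simp: represents_def)
  then obtain r2 where 2: "exec (comp_exp (Suc d) b) (r1, m) (etime b) (r2, m)"
    "r2 (Suc d) = aval b s" "\<forall>x<Suc d. r2 x = r1 x" using Plus.IH(2)[of r1 "Suc d"] Plus.prems by auto
  have "exec (comp_exp d (Plus a b)) (r, m) (etime a + (etime b + 1)) (r2(d := r2 d + r2 (Suc d)), m)"
    by (simp only: comp_exp.simps) (rule exec.intros 1 2)+
  then show ?case using 1 2 by (intro exI) (auto simp: add.assoc)
next
  case (Minus a b)
  then obtain r1 where 1: "exec (comp_exp d a) (r, m) (etime a) (r1, m)" "r1 d = aval a s"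
    "\<forall>x<d. r1 x = r x" by fastforce
  have "represents D L s (r1, m)" using Minus.prems 1 by (auto simp: represents_def)
  then obtain r2 where 2: "exec (comp_exp (Suc d) b) (r1, m) (etime b) (r2, m)"
    "r2 (Suc d) = aval b s" "\<forall>x<Suc d. r2 x = r1 x" using Minus.IH(2)[of r1 "Suc d"] Minus.prems by auto
  have "exec (comp_exp d (Minus a b)) (r, m) (etime a + (etime b + 1)) (r2(d := r2 d - r2 (Suc d)), m)"
    by (simp only: comp_exp.simps) (rule exec.intros 1 2)+
  then show ?case using 1 2 by (intro exI) (auto simp: add.assoc)
next
  case (Arr b a)
  then obtain r1 where 1: "exec (comp_exp d a) (r, m) (etime a) (r1, m)" "r1 d = aval a s"
    "\<forall>x<d. r1 x = r x" by fastforce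
  have ok: "arr_ok L b (aval a s) s" using Arr.prems by simp
  show ?case
  proof (cases "b = 0")
    case True
    have "exec (comp_exp d (Arr b a)) (r, m) (etime a + 1) (r1(d := m (r1 d)), m)"
      using True by (simp only: comp_exp.simps if_True refl) (rule exec.intros 1)+
    moreover have "(r1(d := m (r1 d))) d = aval (Arr b a) s" "\<forall>x<d. (r1(d := m (r1 d))) x = r x"
      using 1 ok Arr.prems True by (auto simp: represents_def arr_ok_def)
    moreover have "etime (Arr b a) = etime a + 1" using True by simp
    ultimately show ?thesis by metis
  next
    case False
    have "0 < d" using Arr.prems by simp
    then obtain r2 where 2: "exec (comp_addr d b) (r1, m) 7 (r2, m)"
      "r2 d = r1 0 + 16 * r1 d + b" "\<forall>x<d. r2 x = r1 x" using exec_comp_addr by blast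
    have ex: "exec (comp_exp d (Arr b a)) (r, m) (etime a + (7 + 1)) (r2(d := m (r2 d)), m)"
      using False by (simp only: comp_exp.simps if_False) (rule exec.intros 1 2)+
    have "r1 0 = L"
      using 1 ok False Arr.prems by (auto simp: represents_def arr_ok_def)
    moreover have "m (L + 16 * aval a s + b) = snd s b (aval a s)"
      using Arr.prems ok False by (auto simp: represents_def arr_ok_def)
    ultimately have "(r2(d := m (r2 d))) d = aval (Arr b a) s" "\<forall>x<d. (r2(d := m (r2 d))) x = r x"
      using 1 2 by auto
    moreover have "etime (Arr b a) = etime a + (7 + 1)" using False by simp
    ultimately show ?thesis using ex by metis
  qed
qed

lemma interleaved_eq_iff:
  fixes i j b c :: nat
  assumes "b < 16" "c < 16"
  shows "L + 16 * i + b = L + 16 * j + c \<longleftrightarrow> i = j \<and> b = c"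
proof
  assume eq: "L + 16 * i + b = L + 16 * j + c"
  then have "(16 * i + b) div 16 = (16 * j + c) div 16" "(16 * i + b) mod 16 = (16 * j + c) mod 16"
    by simp_all
  then show "i = j \<and> b = c" using assms by simp
qed simp

text \<open>A write disturbs no other cell: array 0 lies below \<open>L\<close>, and above
  \<open>L\<close> the array number and the index can be recovered as remainder and quotient modulo
  16.\<close>

lemma represents_upd:
  assumes "represents D L s (r, m)" "arr_ok L b i s"
    and "a = (if b = 0 then i else L + 16 * i + b)" and "\<forall>x<D. r' x = r x"
  shows "represents D L (fst s, (snd s)(b := (snd s b)(i := w))) (r', m(a := w))"
proof (cases "b = 0")
  case True
  then show ?thesis using assms by (auto simp: represents_def arr_ok_def)
next
  case False
  have "(m(a := w)) (L + 16 * j + c) = (if c = b then (snd s b)(i := w) else snd s c) j"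
    if "0 < c" "c < 16" for c j
    using assms that False interleaved_eq_iff[of c b L j i]
    by (auto simp: represents_def arr_ok_def)
  then show ?thesis using assms False by (auto simp: represents_def arr_ok_def)
qed

theorem exec_compile:
  assumes "represents D L s S" "0 < D" "cok L c s" "vars_below D c"
  shows "\<exists>t S'. exec (compile D c) S t S' \<and> t \<le> slowdown c * cost c s \<and> represents D L (sem c s) S'"
  using assms
proof (induction c arbitrary: s S)
  case HSkip
  show ?case using exec.Skip[of S] HSkip by (intro exI[of _ 1] exI[of _ S]) auto
next
  case (Assign x a)
  obtain r m where S: "S = (r, m)" by (cases S)
  obtain r1 where 1: "exec (comp_exp D a) (r, m) (etime a) (r1, m)" "r1 D = aval a s"
    "\<forall>x<D. r1 x = r x" using exec_comp_exp[of D L s r m D a] Assign S by auto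
  let ?r = "r1(Suc D := 0)"
  have "exec (compile D (Assign x a)) S (etime a + (1 + 1)) (?r(x := ?r D + ?r (Suc D)), m)"
    unfolding S by (simp only: compile.simps) (rule exec.intros 1)+
  then show ?case using 1 Assign.prems S
    by (intro exI[of _ "etime a + (1 + 1)"] exI[of _ "(?r(x := ?r D + ?r (Suc D)), m)"])
      (auto simp: represents_def)
next
  case (Upd b i a)
  obtain r m where S: "S = (r, m)" by (cases S)
  obtain r1 where 1: "exec (comp_exp D i) (r, m) (etime i) (r1, m)" "r1 D = aval i s"
    "\<forall>x<D. r1 x = r x" using exec_comp_exp[of D L s r m D i] Upd S by auto
  have ok: "arr_ok L b (aval i s) s" using Upd by simp
  have "\<exists>r2 t2. exec (if b = 0 then Skip else comp_addr D b) (r1, m) t2 (r2, m) \<and> t2 \<le> 7 \<and>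
     r2 D = (if b = 0 then aval i s else L + 16 * aval i s + b) \<and> (\<forall>x<D. r2 x = r1 x)"
  proof (cases "b = 0")
    case True
    then show ?thesis using 1 exec.Skip[of "(r1, m)"] by (intro exI[of _ r1] exI[of _ 1]) auto
  next
    case False
    have "r1 0 = L" using 1 ok False Upd.prems S by (auto simp: represents_def arr_ok_def)
    then show ?thesis using exec_comp_addr[of D b r1 m] Upd.prems False 1 by auto
  qed
  then obtain r2 t2 where 2: "exec (if b = 0 then Skip else comp_addr D b) (r1, m) t2 (r2, m)"
    "t2 \<le> 7" "r2 D = (if b = 0 then aval i s else L + 16 * aval i s + b)" "\<forall>x<D. r2 x = r1 x"
    by blast
  have "represents D L s (r2, m)" using Upd.prems S 1 2 by (auto simp: represents_def)
  then obtain r3 where 3: "exec (comp_exp (Suc D) a) (r2, m) (etime a) (r3, m)"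
    "r3 (Suc D) = aval a s" "\<forall>x<Suc D. r3 x = r2 x"
    using exec_comp_exp[of D L s r2 m "Suc D" a] Upd.prems by auto
  have "exec (compile D (Upd b i a)) S (etime i + (t2 + (etime a + 1))) (r3, m(r3 D := r3 (Suc D)))"
    unfolding S by (simp only: compile.simps) (rule exec.Seq 1 2 3 exec.Store)+
  moreover have "represents D L (sem (Upd b i a) s) (r3, m(r3 D := r3 (Suc D)))"
  proof -
    have "represents D L (fst s, (snd s)(b := (snd s b)(aval i s := aval a s)))
       (r3, m(r3 D := aval a s))"
      by (rule represents_upd[of D L s r m]) (use Upd.prems S 1 2 3 ok in auto)
    then show ?thesis using 3 by simp
  qed
  ultimately show ?case using 2(2)
    by (intro exI[of _ "etime i + (t2 + (etime a + 1))"] exI[of _ "(r3, m(r3 D := r3 (Suc D)))"])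
      auto
next
  case (HSeq c1 c2)
  obtain t1 S1 where 1: "exec (compile D c1) S t1 S1" "t1 \<le> slowdown c1 * cost c1 s"
    "represents D L (sem c1 s) S1" using HSeq.IH(1)[of s S] HSeq.prems by auto
  obtain t2 S2 where 2: "exec (compile D c2) S1 t2 S2" "t2 \<le> slowdown c2 * cost c2 (sem c1 s)"
    "represents D L (sem c2 (sem c1 s)) S2" using HSeq.IH(2)[of "sem c1 s" S1] HSeq.prems 1 by auto
  have "exec (compile D (c1 ;; c2)) S (t1 + t2) S2" using 1 2 by (auto intro: exec.Seq)
  then show ?case using 1 2 by (intro exI[of _ "t1 + t2"] exI[of _ S2]) (auto simp: algebra_simps)
next
  case (Cond a b c1 c2)
  obtain r m where S: "S = (r, m)" by (cases S)
  obtain r1 where 1: "exec (comp_exp D a) (r, m) (etime a) (r1, m)" "r1 D = aval a s"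
    "\<forall>x<D. r1 x = r x" using exec_comp_exp[of D L s r m D a] Cond S by auto
  have "represents D L s (r1, m)" using Cond.prems S 1 by (auto simp: represents_def)
  then obtain r2 where 2: "exec (comp_exp (Suc D) b) (r1, m) (etime b) (r2, m)"
    "r2 (Suc D) = aval b s" "\<forall>x<Suc D. r2 x = r1 x"
    using exec_comp_exp[of D L s r1 m "Suc D" b] Cond.prems by auto
  have rep: "represents D L s (r2, m)" using Cond.prems S 1 2 by (auto simp: represents_def)
  show ?case
  proof (cases "aval a s < aval b s")
    case True
    obtain t S' where 3: "exec (compile D c1) (r2, m) t S'" "t \<le> slowdown c1 * cost c1 s"
      "represents D L (sem c1 s) S'" using Cond.IH(1)[OF rep] Cond.prems True by auto
    have "exec (compile D (Cond a b c1 c2)) S (etime a + (etime b + (1 + t))) S'"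
      unfolding S compile.simps
      by (rule exec.Seq[OF 1(1) exec.Seq[OF 2(1) exec.IfTrue[OF _ 3(1)]]]) (use 1 2 True in simp)
    moreover have "etime a + (etime b + (1 + t)) \<le> slowdown (Cond a b c1 c2) * cost (Cond a b c1 c2) s"
      using 3 True by (auto simp: algebra_simps)
    moreover have "represents D L (sem (Cond a b c1 c2) s) S'" using 3 True by simp
    ultimately show ?thesis by blast
  next
    case False
    obtain t S' where 3: "exec (compile D c2) (r2, m) t S'" "t \<le> slowdown c2 * cost c2 s"
      "represents D L (sem c2 s) S'" using Cond.IH(2)[OF rep] Cond.prems False by auto
    have "exec (compile D (Cond a b c1 c2)) S (etime a + (etime b + (1 + t))) S'"
      unfolding S compile.simps
      by (rule exec.Seq[OF 1(1) exec.Seq[OF 2(1) exec.IfFalse[OF _ 3(1)]]]) (use 1 2 False in simp)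
    moreover have "etime a + (etime b + (1 + t)) \<le> slowdown (Cond a b c1 c2) * cost (Cond a b c1 c2) s"
      using 3 False by (auto simp: algebra_simps)
    moreover have "represents D L (sem (Cond a b c1 c2) s) S'" using 3 False by simp
    ultimately show ?thesis by blast
  qed
next
  case (For x y c)
  obtain r m where S: "S = (r, m)" by (cases S)
  let ?s = "\<lambda>i. for_iter x (sem c) s i"
  let ?w = "WhileLess x y (Seq (compile D c) (Seq (LoadConst D 1) (Add x x D)))"
  define n where "n = fst s y"
  have xy: "x < D" "y < D" "x \<noteq> y" "x \<notin> modvars c" "y \<notin> modvars c"
    and okc: "\<And>i. i < n \<Longrightarrow> cok L c (?s i)" and vb: "vars_below D c"
    using For.prems by (auto simp: n_def)
  \<comment> \<open>The body changes neither register by \<open>cok\<close>, so the counter equals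
    the number of completed iterations and the bound keeps its initial value.\<close>
  have val: "fst (?s i) x = i \<and> fst (?s i) y = n" for i
  proof (induction i)
    case (Suc i)
    have "same_except (modvars c) (modarrs c) (fst (?s i)) (snd (?s i))
      (fst (sem c (?s i))) (snd (sem c (?s i)))" by (rule sem_frame)
    then show ?case using Suc xy by (auto simp: same_except_def Let_def)
  qed (use xy in \<open>auto simp: n_def\<close>)
  \<comment> \<open>Induction on the number \<open>d\<close> of iterations still to be done; the
    leading 1 is the final failing test.\<close>
  have loop: "\<exists>t S'. exec ?w S1 t S' \<and> represents D L (?s n) S' \<and>
      t \<le> 1 + (slowdown c + 3) * (\<Sum>i = n - d..<n. 1 + cost c (?s i))"
    if "represents D L (?s (n - d)) S1" "d \<le> n" for d S1
    using that
  proof (induction d arbitrary: S1)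
    case 0
    then have "\<not> fst S1 x < fst S1 y" using val[of n] xy by (auto simp: represents_def)
    then have "exec ?w S1 1 S1" by (rule exec.WhileFalse)
    then show ?case using 0 by fastforce
  next
    case (Suc d)
    let ?i = "n - Suc d"
    have i: "?i < n" using Suc.prems by simp
    then have less: "fst S1 x < fst S1 y"
      using Suc.prems val[of ?i] xy by (auto simp: represents_def)
    obtain t1 S2 where 1: "exec (compile D c) S1 t1 S2" "t1 \<le> slowdown c * cost c (?s ?i)"
      "represents D L (sem c (?s ?i)) S2"
      using For.IH[OF Suc.prems(1) For.prems(2) okc[OF i] vb] by blast
    obtain r2 m2 where S2: "S2 = (r2, m2)" by (cases S2)
    let ?S3 = "((r2(D := 1))(x := (r2(D := 1)) x + (r2(D := 1)) D), m2)"
    have 2: "exec (Seq (compile D c) (Seq (LoadConst D 1) (Add x x D))) S1 (t1 + (1 + 1)) ?S3"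
      unfolding S2 by (rule exec.Seq[OF 1(1)[unfolded S2]]) (rule exec.intros)+
    have step: "n - d = Suc ?i" using Suc.prems by simp
    have "represents D L (?s (n - d)) ?S3"
      unfolding step using 1(3) xy S2 by (auto simp: represents_def Let_def)
    then obtain t3 S' where 3: "exec ?w ?S3 t3 S'" "represents D L (?s n) S'"
      "t3 \<le> 1 + (slowdown c + 3) * (\<Sum>i = n - d..<n. 1 + cost c (?s i))"
      using Suc.IH Suc.prems by fastforce
    have ex: "exec ?w S1 (1 + (t1 + (1 + 1)) + t3) S'" by (rule exec.WhileTrue[OF less 2 3(1)])
    have "(\<Sum>i = ?i..<n. 1 + cost c (?s i)) = 1 + cost c (?s ?i) + (\<Sum>i = n - d..<n. 1 + cost c (?s i))"
      using Suc.prems i by (subst sum.atLeast_Suc_lessThan[OF i]) (simp add: Suc_diff_Suc)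
    \<comment> \<open>One iteration costs the test, the body and two instructions for the
      counter.\<close>
    moreover have "t1 + 3 \<le> (slowdown c + 3) * (1 + cost c (?s ?i))"
      using 1(2) by (auto simp: algebra_simps)
    ultimately have "1 + (t1 + (1 + 1)) + t3 \<le>
        1 + (slowdown c + 3) * (\<Sum>i = ?i..<n. 1 + cost c (?s i))"
      using 3(3) by (simp only: distrib_left; linarith)
    then show ?case using ex 3 by blast
  qed
  have "represents D L (?s 0) (r(x := 0), m)"
    using For.prems S xy by (auto simp: represents_def)
  then have "\<exists>t S'. exec ?w (r(x := 0), m) t S' \<and> represents D L (?s n) S' \<and>
      t \<le> 1 + (slowdown c + 3) * (\<Sum>i<n. 1 + cost c (?s i))"
    using loop[of n "(r(x := 0), m)"] by (simp add: lessThan_atLeast0)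
  then obtain t S' where 4: "exec ?w (r(x := 0), m) t S'" "represents D L (?s n) S'"
    "t \<le> 1 + (slowdown c + 3) * (\<Sum>i<n. 1 + cost c (?s i))"
    by blast
  have "exec (compile D (For x y c)) S (1 + t) S'"
    unfolding S by (simp only: compile.simps) (rule exec.Seq exec.LoadConst 4)+
  moreover have "1 + t \<le> slowdown (For x y c) * cost (For x y c) s"
    using 4(3) by (simp add: n_def distrib_left)
  moreover have "represents D L (sem (For x y c) s) S'" using 4(2) by (simp add: n_def)
  ultimately show ?case by blast
qed


subsection \<open>Total correctness with time bounds\<close>

text \<open>The start state is given explicitly instead of by a precondition. Including
  \<open>cok\<close> lets one triple also discharge the side condition of
  \<open>exec_compile\<close>.\<close>

definition tri :: "nat \<Rightarrow> hcom \<Rightarrow> (nat \<Rightarrow> nat) \<Rightarrow> (nat \<Rightarrow> nat \<Rightarrow> nat) \<Rightarrow> nat \<Rightarrow>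
    ((nat \<Rightarrow> nat) \<Rightarrow> (nat \<Rightarrow> nat \<Rightarrow> nat) \<Rightarrow> bool) \<Rightarrow> bool" where
  "tri L c v A t Q \<longleftrightarrow> cok L c (v, A) \<and> cost c (v, A) \<le> t \<and> (case sem c (v, A) of (v', A') \<Rightarrow> Q v' A')"

text \<open>The frame is supplied as an extra premise, here and in the next rules, so that
  postconditions and invariants need to mention only what changes.\<close>

lemma tri_conseq:
  assumes "tri L c v A t Q" "t \<le> t'"
    and "\<And>v' A'. Q v' A' \<Longrightarrow> same_except (modvars c) (modarrs c) v A v' A' \<Longrightarrow> Q' v' A'"
  shows "tri L c v A t' Q'"
  using assms sem_frame[of c "(v, A)"] by (fastforce simp: tri_def)

lemma tri_Seq:
  assumes "tri L c1 v A t1 P"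
    and "\<And>v' A'. P v' A' \<Longrightarrow> same_except (modvars c1) (modarrs c1) v A v' A' \<Longrightarrow> tri L c2 v' A' t2 Q"
  shows "tri L (c1 ;; c2) v A (t1 + t2) Q"
  using assms sem_frame[of c1 "(v, A)"] by (fastforce simp: tri_def)

text \<open>The increment is not part of the body, so the invariant is required after the update of
  \<open>x\<close>. In proofs by \<open>goal_cases\<close>, cases 5, 6 and 7 are entry, body and
  exit of the loop.\<close>

lemma tri_For:
  assumes n: "v y = n" and xy: "x \<noteq> y" "x \<notin> modvars c" "y \<notin> modvars c"
    and init: "I 0 (v(x := 0)) A"
    and step: "\<And>i v' A'. i < n \<Longrightarrow> I i v' A' \<Longrightarrow> v' x = i \<Longrightarrow>
      same_except (insert x (modvars c)) (modarrs c) v A v' A' \<Longrightarrow>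
      tri L c v' A' b (\<lambda>v'' A''. I (Suc i) (v''(x := Suc i)) A'')"
    and fin: "\<And>v' A'. I n v' A' \<Longrightarrow> v' x = n \<Longrightarrow>
      same_except (insert x (modvars c)) (modarrs c) v A v' A' \<Longrightarrow> Q v' A'"
  shows "tri L (For x y c) v A (n * (b + 1) + 1) Q"
proof -
  let ?s = "\<lambda>i. for_iter x (sem c) (v, A) i"
  have frame: "same_except (insert x (modvars c)) (modarrs c) v A (fst (?s i)) (snd (?s i))" for i
  proof (induction i)
    case (Suc i)
    then show ?case using sem_frame[of c "?s i"] by (auto simp: same_except_def Let_def)
  qed (simp add: same_except_def)
  have val: "fst (?s i) x = i" for i
  proof (induction i)
    case (Suc i)
    then show ?case using sem_frame[of c "?s i"] xy by (auto simp: same_except_def Let_def)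
  qed simp
  have inv: "i \<le> n \<Longrightarrow> I i (fst (?s i)) (snd (?s i))" for i
  proof (induction i)
    case (Suc i)
    have "tri L c (fst (?s i)) (snd (?s i)) b (\<lambda>v'' A''. I (Suc i) (v''(x := Suc i)) A'')"
      using step[of i "fst (?s i)" "snd (?s i)"] Suc val frame by simp
    moreover have "fst (sem c (?s i)) x = i"
      using sem_frame[of c "?s i"] xy val[of i] by (auto simp: same_except_def)
    moreover obtain v'' A'' where e: "sem c (?s i) = (v'', A'')" by (cases "sem c (?s i)")
    ultimately have "?s (Suc i) = (v''(x := Suc i), A'')" "I (Suc i) (v''(x := Suc i)) A''"
      by (simp_all add: tri_def Let_def)
    then show ?case by (simp only: fst_conv snd_conv)
  qed (use init in simp)
  have body: "cok L c (?s i) \<and> cost c (?s i) \<le> b" if "i < n" for i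
    using step[of i "fst (?s i)" "snd (?s i)"] inv[of i] that val frame by (simp add: tri_def)
  have "(\<Sum>i<n. 1 + cost c (?s i)) \<le> (\<Sum>i<n. b + 1)" by (rule sum_mono) (use body in auto)
  then have "cost (For x y c) (v, A) \<le> n * (b + 1) + 1" using n by simp
  moreover have "cok L (For x y c) (v, A)" using body xy n by simp
  moreover have "Q (fst (?s n)) (snd (?s n))" using fin inv val frame by blast
  ultimately show ?thesis by (auto simp: tri_def n split: prod.splits)
qed


section \<open>Correctness of the dynamic program\<close>

subsection \<open>Codes of short vertex sequences\<close>

text \<open>Sequences over \<open>{..<n}\<close> are numbered as the nodes of the complete \<open>n\<close>-ary tree in breadth-first
  order: the children of node \<open>p\<close> are \<open>p * n + 1, \<dots>, p * n + n\<close>, and \<open>geo n d\<close> counts the nodes of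
  depth less than \<open>d\<close>.\<close>

lemma pred_div_less: "j \<noteq> 0 \<Longrightarrow> (j - 1) div n < (j :: nat)"
  by (rule le_less_trans[OF div_le_dividend]) simp

text \<open>Decoding climbs from a node to the root: the label of the last edge is the head and the
  sequence of the parent is the tail.\<close>

function nlist :: "nat \<Rightarrow> nat \<Rightarrow> nat list" where
  "nlist n j = (if j = 0 then [] else ((j - 1) mod n) # nlist n ((j - 1) div n))"
  by pat_completeness auto
termination by (relation "measure snd") (auto dest: pred_div_less[simplified])

declare nlist.simps [simp del]

lemma nlist_0 [simp]: "nlist n 0 = []"
  by (simp add: nlist.simps)

lemma nlist_child [simp]: "w < n \<Longrightarrow> nlist n (Suc (p * n + w)) = w # nlist n p"
  by (subst nlist.simps) simp

primrec geo :: "nat \<Rightarrow> nat \<Rightarrow> nat" where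
  "geo n 0 = 0"
| "geo n (Suc d) = Suc (n * geo n d)"

text \<open>The extra 1 is the room for the code of the fixed cover; it is available because the
  geometric sum is at most n^d - 1 when n is at least 2.\<close>

lemma geo_le_power: "2 \<le> n \<Longrightarrow> geo n d + 1 \<le> n ^ d"
proof (induction d)
  case (Suc d)
  have "geo n (Suc d) + 1 \<le> n * geo n d + n" using Suc.prems by simp
  also have "\<dots> = n * (geo n d + 1)" by simp
  also have "\<dots> \<le> n * n ^ d" using Suc by (intro mult_le_mono2) auto
  finally show ?case by simp
qed simp

lemma set_nlist: "0 < n \<Longrightarrow> set (nlist n j) \<subseteq> {..<n}"
proof (induction j rule: less_induct)
  case (less j)
  from pred_div_less show ?case using less by (subst nlist.simps) auto
qed

lemma length_nlist_le: "j < geo n (Suc d) \<Longrightarrow> length (nlist n j) \<le> d"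
proof (induction d arbitrary: j)
  case (Suc d)
  show ?case
  proof (cases "j = 0")
    case False
    then have "j - 1 < n * geo n (Suc d)" using Suc.prems by simp
    then have "(j - 1) div n < geo n (Suc d)"
      by (metis less_mult_imp_div_less mult.commute)
    then show ?thesis using Suc.IH False by (subst nlist.simps) simp
  qed simp
qed simp

lemma nlist_surj:
  assumes "set vs \<subseteq> {..<n}" "length vs \<le> d"
  shows "\<exists>j<geo n (Suc d). nlist n j = vs"
  using assms
proof (induction vs arbitrary: d)
  case Nil
  then show ?case by (intro exI[of _ 0]) simp
next
  case (Cons w vs)
  then obtain d' where d: "d = Suc d'" by (cases d) auto
  with Cons obtain p where p: "p < geo n (Suc d')" "nlist n p = vs" by auto
  have w: "w < n" using Cons.prems by simp
  have "p * n + w < (p + 1) * n" using w by simp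
  also have "\<dots> \<le> geo n (Suc d') * n" using p by (intro mult_le_mono1) simp
  finally have "Suc (p * n + w) < geo n (Suc d)" using d by (simp add: mult.commute)
  then show ?case using p(2) nlist_child[OF w] by blast
qed


subsection \<open>Digits\<close>

lemma mod_power_digit:
  fixes y b :: nat
  assumes "i < d"
  shows "(y mod b ^ d) div b ^ i mod b = y div b ^ i mod b"
proof (cases "b = 0")
  case False
  have d: "b ^ d = b ^ i * b ^ (d - i)" using assms by (simp add: power_add[symmetric])
  have "(y mod b ^ d) div b ^ i = y div b ^ i mod b ^ (d - i)"
    using False by (simp add: d mod_mult2_eq)
  moreover have "b dvd b ^ (d - i)" using assms by simp
  ultimately show ?thesis by (simp add: mod_mod_cancel)
qed (use assms in \<open>auto simp: power_0_left\<close>)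

text \<open>Consecutive codes share all digits but the newest, which is the lowest one. So digit
  \<open>i\<close> at time \<open>t\<close> entered as the lowest digit \<open>i\<close> steps
  earlier.\<close>

lemma shifted_digits:
  fixes y :: "nat \<Rightarrow> nat"
  assumes "\<And>t. 1 \<le> t \<Longrightarrow> t < T \<Longrightarrow> y (Suc t) div b = y t mod b ^ (d - 1)"
  shows "i < d \<Longrightarrow> i < t \<Longrightarrow> t \<le> T \<Longrightarrow> y t div b ^ i mod b = y (t - i) mod b"
proof (induction i arbitrary: t)
  case (Suc i)
  then obtain t' where t: "t = Suc t'" "1 \<le> t'" "t' < T" "i < t'" by (cases t) auto
  have "y t div b ^ Suc i = (y t' mod b ^ (d - 1)) div b ^ i"
    using assms t by (simp add: div_mult2_eq)
  then have "y t div b ^ Suc i mod b = y t' div b ^ i mod b"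
    using Suc.prems by (simp add: mod_power_digit)
  then show ?case using Suc t by simp
qed simp


subsection \<open>The dynamic program\<close>

locale instance_data =
  fixes n m k D T :: nat and eu ev :: "nat \<Rightarrow> nat" and act :: "nat \<Rightarrow> nat \<Rightarrow> bool"
  assumes n: "2 \<le> n" and D: "1 \<le> D" "D \<le> T"
begin

definition hits :: "nat \<Rightarrow> nat \<Rightarrow> bool" where
  "hits j e \<longleftrightarrow> eu e \<in> set (nlist n j) \<or> ev e \<in> set (nlist n j)"

text \<open>\<open>A\<close> counts sequences shorter than \<open>k\<close>, \<open>B\<close> the
  choices per time, \<open>M\<close> the states (the last \<open>D - 1\<close> choices) and
  \<open>NW\<close> the windows (the last \<open>D\<close> choices). \<open>big\<close> acts as
  infinity: it exceeds the cost \<open>T * k\<close> of taking a cover at every time.\<close>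

abbreviation A where "A \<equiv> geo n k"
abbreviation B where "B \<equiv> Suc A"
abbreviation M where "M \<equiv> B ^ (D - 1)"
abbreviation NW where "NW \<equiv> B ^ D"
abbreviation big where "big \<equiv> Suc (T * k)"

lemma NW_eq: "NW = B * M" "NW = M * B"
  using D by (simp_all add: power_eq_if)

definition cover_codes :: "(nat \<Rightarrow> nat) \<Rightarrow> bool" where
  "cover_codes cn \<longleftrightarrow>
     (\<forall>t\<in>{1..T}. cn t < geo n (Suc k) \<and> (\<forall>e<m. act e t \<longrightarrow> hits (cn t) e))"

text \<open>The last choice \<open>A\<close> stands for the chosen vertex cover of the snapshot; no other choice with
  \<open>k\<close> vertices is needed.\<close>

definition node :: "(nat \<Rightarrow> nat) \<Rightarrow> nat \<Rightarrow> nat \<Rightarrow> nat" where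
  "node cn t x = (if x < A then x else cn t)"

text \<open>The window ends at \<open>t\<close>, and digit \<open>i\<close> of \<open>y\<close> is
  the choice made \<open>i\<close> steps before its end.\<close>

definition valid :: "(nat \<Rightarrow> nat) \<Rightarrow> nat \<Rightarrow> nat \<Rightarrow> bool" where
  "valid cn t y \<longleftrightarrow> (\<forall>e<m. (\<exists>i<D. act e (t - i)) \<longrightarrow>
     (\<exists>i<D. act e (t - i) \<and> hits (node cn (t - i) (y div B ^ i mod B)) e))"

text \<open>No window has ended before time \<open>D\<close>. From \<open>D\<close> on all times
  \<open>t - i\<close> are at least 1, so digits standing for earlier times are never
  consulted.\<close>

definition legal :: "(nat \<Rightarrow> nat) \<Rightarrow> nat \<Rightarrow> nat \<Rightarrow> bool" where
  "legal cn t y \<longleftrightarrow> t < D \<or> valid cn t y"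

abbreviation weight :: "(nat \<Rightarrow> nat) \<Rightarrow> nat \<Rightarrow> nat \<Rightarrow> nat" where
  "weight cn t x \<equiv> length (nlist n (node cn t x))"

text \<open>\<open>u\<close> and \<open>w\<close> are consecutive rows and \<open>Y\<close> is the
  number of windows already tried, which makes this the loop invariant: finite entries are attained
  by the window stored in \<open>p\<close>, and no tried window beats them. Storing the whole window
  gives both the last choice and the previous state.\<close>

definition dp_row :: "(nat \<Rightarrow> nat) \<Rightarrow> nat \<Rightarrow> (nat \<Rightarrow> nat) \<Rightarrow> (nat \<Rightarrow> nat) \<Rightarrow> (nat \<Rightarrow> nat) \<Rightarrow> nat \<Rightarrow> bool" where
  "dp_row cn t u w p Y \<longleftrightarrow>
     (\<forall>q<M. w q \<le> big \<and> (w q < big \<longrightarrow> p q < NW \<and> p q mod M = q \<and> legal cn t (p q) \<and>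
        w q = u (p q div B) + weight cn t (p q mod B))) \<and>
     (\<forall>y<Y. legal cn t y \<longrightarrow> w (y mod M) \<le> u (y div B) + weight cn t (y mod B))"

text \<open>Every initial state is free, since its digits stand for times before 1, which are
  neither checked nor charged.\<close>

definition dp_table :: "(nat \<Rightarrow> nat) \<Rightarrow> (nat \<Rightarrow> nat \<Rightarrow> nat) \<Rightarrow> (nat \<Rightarrow> nat \<Rightarrow> nat) \<Rightarrow> nat \<Rightarrow> bool" where
  "dp_table cn val pred t \<longleftrightarrow> (\<forall>q<M. val 0 q = 0) \<and>
     (\<forall>s<t. dp_row cn (Suc s) (val s) (val (Suc s)) (pred (Suc s)) NW)"

definition feasible :: "(nat \<times> nat) set \<Rightarrow> bool" where
  "feasible S \<longleftrightarrow> (\<forall>t\<in>{D..T}. \<forall>e<m. (\<exists>i<D. act e (t - i)) \<longrightarrow>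
     (\<exists>i<D. act e (t - i) \<and> ((eu e, t - i) \<in> S \<or> (ev e, t - i) \<in> S)))"

definition seq_appearances :: "(nat \<Rightarrow> nat) \<Rightarrow> (nat \<Rightarrow> nat) \<Rightarrow> (nat \<times> nat) set" where
  "seq_appearances cn x = {(w, t). t \<in> {1..T} \<and> w \<in> set (nlist n (node cn t (x t)))}"

lemma weight_le: "cover_codes cn \<Longrightarrow> t \<in> {1..T} \<Longrightarrow> weight cn t x \<le> k"
proof -
  assume a: "cover_codes cn" "t \<in> {1..T}"
  have "node cn t x < geo n (Suc k)"
  proof (cases "x < A")
    case True
    have "1 * A \<le> n * A" using n by (intro mult_le_mono1) simp
    then have "x < Suc (n * A)" using True by linarith
    then show ?thesis using True by (simp add: node_def)
  qed (use a in \<open>auto simp: cover_codes_def node_def\<close>)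
  then show ?thesis by (rule length_nlist_le)
qed

text \<open>The link between a solution and its window codes. It serves both the lower bound, which
  starts from a solution, and the output, which starts from codes.\<close>

lemma feasible_seq_iff:
  assumes digits: "\<And>t i. t \<in> {D..T} \<Longrightarrow> i < D \<Longrightarrow> y t div B ^ i mod B = x (t - i)"
  shows "feasible (seq_appearances cn x) \<longleftrightarrow> (\<forall>t\<in>{D..T}. valid cn t (y t))"
proof -
  have "((eu e, t - i) \<in> seq_appearances cn x \<or> (ev e, t - i) \<in> seq_appearances cn x) \<longleftrightarrow>
      hits (node cn (t - i) (y t div B ^ i mod B)) e" if "t \<in> {D..T}" "i < D" for t i e
  proof -
    have "t - i \<in> {1..T}" using that by auto
    then show ?thesis using digits[OF that] by (auto simp: seq_appearances_def hits_def)
  qed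
  then show ?thesis unfolding feasible_def valid_def by (meson)
qed

section \<open>Lower bound: choice sequences as walks through the table\<close>

primrec window_codes :: "(nat \<Rightarrow> nat) \<Rightarrow> nat \<Rightarrow> nat" where
  "window_codes x 0 = 0"
| "window_codes x (Suc t) = (window_codes x t mod M) * B + x (Suc t)"

text \<open>The window codes of \<open>x\<close> form a walk whose steps are all legal, so each step
  was tried when its row was filled; adding up the row inequalities along the walk gives the claim
  for its final state.\<close>

lemma dp_lower_bound:
  assumes tab: "dp_table cn val pred T" and x: "\<And>t. x t < B"
    and feas: "feasible (seq_appearances cn x)"
  shows "\<exists>q<M. val T q \<le> (\<Sum>t<T. weight cn (Suc t) (x (Suc t)))"
proof -
  let ?y = "window_codes x"
  \<comment> \<open>\<open>B\<close> is a successor, and the simplifier would otherwise unfold every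
    product with it.\<close>
  have ydiv: "?y (Suc t) div B = ?y t mod M" for t
    using x[of "Suc t"] by (simp del: mult_Suc mult_Suc_right)
  have ymod: "?y t mod B = x t" if "1 \<le> t" for t
    using x that by (cases t) (simp_all del: mult_Suc mult_Suc_right)
  have ylt: "?y t < NW" for t
  proof (cases t)
    case (Suc s)
    have "?y s mod M < M" by simp
    then have "?y t < (?y s mod M + 1) * B" using x[of t] Suc by simp
    also have "\<dots> \<le> M * B" using \<open>?y s mod M < M\<close> by (intro mult_le_mono1) linarith
    finally show ?thesis by (simp only: NW_eq(2))
  qed simp
  have "?y t div B ^ i mod B = x (t - i)" if "t \<in> {D..T}" "i < D" for t i
    using shifted_digits[of T ?y B D i t] ydiv ymod[of "t - i"] that by auto
  then have "\<forall>t\<in>{D..T}. valid cn t (?y t)" using feasible_seq_iff feas by blast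
  then have legal: "legal cn t (?y t)" if "t \<le> T" for t
    using that by (auto simp: legal_def not_less)
  have "t \<le> T \<Longrightarrow> val t (?y t mod M) \<le> (\<Sum>s<t. weight cn (Suc s) (x (Suc s)))" for t
  proof (induction t)
    case 0
    then show ?case using tab by (simp add: dp_table_def)
  next
    case (Suc t)
    then have "dp_row cn (Suc t) (val t) (val (Suc t)) (pred (Suc t)) NW"
      using tab by (simp add: dp_table_def)
    then have "val (Suc t) (?y (Suc t) mod M) \<le>
        val t (?y (Suc t) div B) + weight cn (Suc t) (?y (Suc t) mod B)"
      using ylt legal Suc.prems unfolding dp_row_def by blast
    also have "\<dots> = val t (?y t mod M) + weight cn (Suc t) (x (Suc t))"
    proof -
      have "?y (Suc t) mod B = x (Suc t)" using ymod[of "Suc t"] by (simp only: le_add1 plus_1_eq_Suc[symmetric])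
      then show ?thesis by (simp only: ydiv)
    qed
    finally show ?case using Suc by simp
  qed
  then have "val T (?y T mod M) \<le> (\<Sum>s<T. weight cn (Suc s) (x (Suc s)))" by simp
  then show ?thesis by (metis mod_less_divisor zero_less_Suc zero_less_power)
qed

text \<open>Replacing \<open>k\<close> or more appearances at one time by the cover of that snapshot keeps a
  solution feasible and does not increase its size.\<close>

lemma choice_sequence_exists:
  assumes cn: "cover_codes cn" and feas: "feasible S" and S: "S \<subseteq> {..<n} \<times> {1..T}"
  shows "\<exists>x. (\<forall>t. x t < B) \<and> feasible (seq_appearances cn x) \<and>
    (\<Sum>t<T. weight cn (Suc t) (x (Suc t))) \<le> card S"
proof -
  define slice where "slice t = {w. (w, t) \<in> S}" for t
  have slice: "slice t \<subseteq> {..<n}" for t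
    using S unfolding slice_def by blast
  have fin: "finite (slice t)" for t using finite_subset[OF slice finite_lessThan] .
  have "\<exists>x<B. (\<forall>e<m. t \<in> {1..T} \<longrightarrow> act e t \<longrightarrow> eu e \<in> slice t \<or> ev e \<in> slice t \<longrightarrow>
       hits (node cn t x) e) \<and> (t \<in> {1..T} \<longrightarrow> weight cn t x \<le> card (slice t))" for t
  proof (cases "card (slice t) < k")
    case True
    \<comment> \<open>Listing a small slice without repetition makes the weight equal to its size
      and, the length being below \<open>k\<close>, its code less than \<open>A\<close>.\<close>
    obtain vs where vs: "set vs = slice t" "distinct vs" using finite_distinct_list[OF fin[of t]] by metis
    then have len: "length vs = card (slice t)" using distinct_card by metis
    obtain d where d: "k = Suc d" using True by (cases k) auto
    obtain j where j: "j < geo n (Suc d)" "nlist n j = vs"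
      using nlist_surj[of vs n d] slice vs len True d by auto
    then have "node cn t j = j" "j < B" unfolding d[symmetric] by (auto simp: node_def)
    then show ?thesis using vs len j by (intro exI[of _ j]) (auto simp: hits_def)
  next
    case False
    have "node cn t A = cn t" by (simp add: node_def)
    then show ?thesis using False cn weight_le[OF cn, of t A]
      by (intro exI[of _ A]) (auto simp: cover_codes_def)
  qed
  then obtain x where x: "\<And>t. x t < B"
    and hit: "\<And>t e. e < m \<Longrightarrow> t \<in> {1..T} \<Longrightarrow> act e t \<Longrightarrow> eu e \<in> slice t \<or> ev e \<in> slice t \<Longrightarrow>
        hits (node cn t (x t)) e"
    and w: "\<And>t. t \<in> {1..T} \<Longrightarrow> weight cn t (x t) \<le> card (slice t)" by metis
  have "feasible (seq_appearances cn x)"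
    unfolding feasible_def
  proof (intro ballI allI impI)
    fix t e assume t: "t \<in> {D..T}" and e: "e < m" and "\<exists>i<D. act e (t - i)"
    then obtain i where i: "i < D" "act e (t - i)" "(eu e, t - i) \<in> S \<or> (ev e, t - i) \<in> S"
      using feas unfolding feasible_def by blast
    have ti: "t - i \<in> {1..T}" using t i by auto
    have "hits (node cn (t - i) (x (t - i))) e" using hit[OF e ti i(2)] i by (auto simp: slice_def)
    then show "\<exists>i<D. act e (t - i) \<and>
        ((eu e, t - i) \<in> seq_appearances cn x \<or> (ev e, t - i) \<in> seq_appearances cn x)"
      using i ti by (auto simp: seq_appearances_def hits_def)
  qed
  moreover have "(\<Sum>t<T. weight cn (Suc t) (x (Suc t))) \<le> card S"
  proof -
    have "(\<Sum>t<T. weight cn (Suc t) (x (Suc t))) \<le> (\<Sum>t<T. card (slice (Suc t)))"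
      by (rule sum_mono) (use w in auto)
    \<comment> \<open>Slices at different times contribute different appearances, so their sizes add
      up to at most the size of \<open>S\<close>.\<close>
    also have "\<dots> = card (SIGMA t:{..<T}. slice (Suc t))" using fin by simp
    also have "\<dots> = card ((\<lambda>(t, w). (w, Suc t)) ` (SIGMA t:{..<T}. slice (Suc t)))"
      by (rule card_image[symmetric]) (auto simp: inj_on_def)
    also have "\<dots> \<le> card S"
      by (rule card_mono) (use S finite_subset[OF S] in \<open>auto simp: slice_def\<close>)
    finally show ?thesis .
  qed
  ultimately show ?thesis using x by blast
qed

section \<open>Backtracking an optimal choice sequence\<close>

text \<open>The state at time \<open>T - i\<close>, reached from the final state \<open>q\<close> by
  following the stored windows.\<close>

primrec trace :: "(nat \<Rightarrow> nat \<Rightarrow> nat) \<Rightarrow> nat \<Rightarrow> nat \<Rightarrow> nat" where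
  "trace pred q 0 = q"
| "trace pred q (Suc i) = pred (T - i) (trace pred q i) div B"

definition trace_code :: "(nat \<Rightarrow> nat \<Rightarrow> nat) \<Rightarrow> nat \<Rightarrow> nat \<Rightarrow> nat" where
  "trace_code pred q t = pred t (trace pred q (T - t))"

text \<open>Times decrease because the stored windows lead backwards from \<open>T\<close>; this is
  also the order in which the program writes the output.\<close>

definition out_list :: "(nat \<Rightarrow> nat) \<Rightarrow> (nat \<Rightarrow> nat \<Rightarrow> nat) \<Rightarrow> nat \<Rightarrow> nat \<Rightarrow> (nat \<times> nat) list" where
  "out_list cn pred q i = concat (map (\<lambda>i. map (\<lambda>w. (w, T - i))
     (nlist n (node cn (T - i) (pred (T - i) (trace pred q i) mod B)))) [0..<i])"

text \<open>Feasibility of the all-covers sequence keeps the optimum strictly below \<open>big\<close>.\<close>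

lemma dp_min_le:
  assumes tab: "dp_table cn val pred T" and cn: "cover_codes cn"
    and best: "\<And>q. q < M \<Longrightarrow> val T bq \<le> val T q"
  shows "val T bq \<le> T * k"
proof -
  have "feasible (seq_appearances cn (\<lambda>t. A))"
    unfolding feasible_def
  proof (intro ballI allI impI)
    fix t e assume t: "t \<in> {D..T}" and e: "e < m" and "\<exists>i<D. act e (t - i)"
    then obtain i where i: "i < D" "act e (t - i)" by blast
    have ti: "t - i \<in> {1..T}" using t i by auto
    then have "hits (node cn (t - i) A) e"
      using cn i e by (auto simp: cover_codes_def node_def)
    then show "\<exists>i<D. act e (t - i) \<and> ((eu e, t - i) \<in> seq_appearances cn (\<lambda>t. A) \<or>
        (ev e, t - i) \<in> seq_appearances cn (\<lambda>t. A))"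
      using i ti by (auto simp: seq_appearances_def hits_def)
  qed
  then obtain q where q: "q < M" "val T q \<le> (\<Sum>t<T. weight cn (Suc t) A)"
    using dp_lower_bound[OF tab, of "\<lambda>t. A"] by auto
  have "(\<Sum>t<T. weight cn (Suc t) A) \<le> (\<Sum>t<T. k)"
    by (rule sum_mono) (use weight_le[OF cn] in auto)
  also have "\<dots> = T * k" by simp
  finally show ?thesis using best[OF q(1)] q(2) by linarith
qed

text \<open>The value of the current state plus the length emitted so far is constant. It also keeps
  all visited entries below \<open>big\<close>, which is what allows \<open>dp_row\<close> to vouch
  for the stored window.\<close>

lemma dp_back:
  assumes tab: "dp_table cn val pred T" and cn: "cover_codes cn"
    and best: "bq < M" "\<And>q. q < M \<Longrightarrow> val T bq \<le> val T q" and i: "i \<le> T"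
  shows "trace pred bq i < M \<and> val (T - i) (trace pred bq i) < big \<and>
    val T bq = val (T - i) (trace pred bq i) + length (out_list cn pred bq i)"
  using i
proof (induction i)
  case 0
  then show ?case using best dp_min_le[OF tab cn best(2)] by (simp add: out_list_def)
next
  case (Suc i)
  define t where "t = T - Suc i"
  have t: "T - i = Suc t" "t < T" using Suc.prems by (auto simp: t_def)
  let ?q = "trace pred bq i" and ?y = "pred (Suc t) (trace pred bq i)"
  have IH: "?q < M" "val (Suc t) ?q < big" "val T bq = val (Suc t) ?q + length (out_list cn pred bq i)"
    using Suc t by auto
  have "dp_row cn (Suc t) (val t) (val (Suc t)) (pred (Suc t)) NW"
    using tab t by (simp add: dp_table_def)
  then have *: "?y < NW" "val (Suc t) ?q = val t (?y div B) + weight cn (Suc t) (?y mod B)"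
    using IH by (auto simp: dp_row_def)
  have "?y div B < M" using *(1) by (intro less_mult_imp_div_less) (simp only: NW_eq(2))
  moreover have "length (out_list cn pred bq (Suc i)) =
      length (out_list cn pred bq i) + weight cn (Suc t) (?y mod B)"
    using t by (simp add: out_list_def)
  ultimately show ?case using IH * t unfolding t_def[symmetric] by simp
qed

text \<open>The output is distinct because a repetition would make its set, which is feasible, smaller than
  its length, which is minimal.\<close>

theorem dp_output:
  assumes tab: "dp_table cn val pred T" and cn: "cover_codes cn"
    and best: "bq < M" "\<And>q. q < M \<Longrightarrow> val T bq \<le> val T q"
  defines "out \<equiv> out_list cn pred bq T"
  shows "distinct out" "feasible (set out)" "set out \<subseteq> {..<n} \<times> {1..T}"
    "\<And>S. feasible S \<Longrightarrow> S \<subseteq> {..<n} \<times> {1..T} \<Longrightarrow> card (set out) \<le> card S"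
    "length out \<le> T * k"
proof -
  let ?y = "trace_code pred bq"
  let ?x = "\<lambda>t. ?y t mod B"
  have *: "?y (Suc t) mod M = trace pred bq (T - Suc t)" "legal cn (Suc t) (?y (Suc t))"
     if "t < T" for t
  proof -
    have "dp_row cn (Suc t) (val t) (val (Suc t)) (pred (Suc t)) NW"
      using tab that by (simp add: dp_table_def)
    moreover have "trace pred bq (T - Suc t) < M" "val (Suc t) (trace pred bq (T - Suc t)) < big"
      using dp_back[OF tab cn best, of "T - Suc t"] that by simp_all
    ultimately show "?y (Suc t) mod M = trace pred bq (T - Suc t)" "legal cn (Suc t) (?y (Suc t))"
      unfolding dp_row_def trace_code_def by blast+
  qed
  \<comment> \<open>The state between two steps is read twice: as the upper digits of the later
    window and as the lower digits of the earlier one.\<close>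
  have shift: "?y (Suc t) div B = ?y t mod M" if "1 \<le> t" "t < T" for t
  proof -
    have "trace pred bq (T - t) = ?y (Suc t) div B"
    proof -
      have "T - t = Suc (T - Suc t)" "T - (T - Suc t) = Suc t" using that by auto
      then show ?thesis by (simp add: trace_code_def)
    qed
    moreover have "?y t mod M = trace pred bq (T - t)" using *(1)[of "t - 1"] that by simp
    ultimately show ?thesis by simp
  qed
  have digits: "?y t div B ^ i mod B = ?x (t - i)" if "t \<in> {D..T}" "i < D" for t i
    using shifted_digits[of T ?y B D i t] shift that by auto
  have "\<forall>t\<in>{D..T}. valid cn t (?y t)"
  proof
    fix t assume t: "t \<in> {D..T}"
    then show "valid cn t (?y t)" using *(2)[of "t - 1"] D by (auto simp: legal_def)
  qed
  then have feas: "feasible (seq_appearances cn ?x)"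
    using feasible_seq_iff[where y = ?y and x = ?x] digits by blast
  have set: "set out = seq_appearances cn ?x"
  proof -
    have "set out = (\<Union>i<T. (\<lambda>w. (w, T - i)) ` set (nlist n (node cn (T - i) (?x (T - i)))))"
      by (auto simp: out_def out_list_def trace_code_def)
    also have "\<dots> = (\<Union>t\<in>{1..T}. (\<lambda>w. (w, t)) ` set (nlist n (node cn t (?x t))))"
    proof -
      have "{1..T} = (\<lambda>i. T - i) ` {..<T}"
      proof (intro equalityI subsetI)
        fix t assume "t \<in> {1..T}"
        then show "t \<in> (\<lambda>i. T - i) ` {..<T}" by (intro image_eqI[of _ _ "T - t"]) auto
      qed auto
      then show ?thesis by (simp add: image_image)
    qed
    finally show ?thesis by (auto simp: seq_appearances_def)
  qed
  have len: "length out = val T bq"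
    using dp_back[OF tab cn best, of T] tab by (simp add: out_def dp_table_def)
  then show "length out \<le> T * k" using dp_min_le[OF tab cn best(2)] by simp
  \<comment> \<open>Any feasible \<open>S\<close> yields a choice sequence of cost at most
    \<open>card S\<close>, and the minimum of the last row is below the cost of every such
    sequence.\<close>
  from len have low: "length out \<le> card S" if "feasible S" "S \<subseteq> {..<n} \<times> {1..T}" for S
    using choice_sequence_exists[OF cn that] dp_lower_bound[OF tab] best(2)
    by (metis le_trans)
  show sub: "set out \<subseteq> {..<n} \<times> {1..T}"
    unfolding set seq_appearances_def using set_nlist[of n] n by fastforce
  show feas': "feasible (set out)" using feas set by simp
  have "length out \<le> card (set out)" using low[OF feas' sub] .
  then show "distinct out" by (simp add: card_distinct card_length le_antisym)
  show "card (set out) \<le> card S" if "feasible S" "S \<subseteq> {..<n} \<times> {1..T}" for S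
    using low[OF that] card_length[of out] by linarith
qed

end


section \<open>The program\<close>

text \<open>The machine cannot multiply, so two-dimensional tables are stored by rows, and the variables
  \<open>xrow\<close>, \<open>xrp\<close>, \<open>xrn\<close>, \<open>xb0\<close>, \<open>xb1\<close> hold the start of a row.\<close>

abbreviation (input) "xn \<equiv> 1 :: nat"
abbreviation (input) "xm \<equiv> 2 :: nat"
abbreviation (input) "xD \<equiv> 3 :: nat"
abbreviation (input) "xT \<equiv> 4 :: nat"
abbreviation (input) "xbig \<equiv> 5 :: nat"
abbreviation (input) "xp \<equiv> 6 :: nat"
abbreviation (input) "xe \<equiv> 7 :: nat"
abbreviation (input) "xj \<equiv> 8 :: nat"
abbreviation (input) "xlen \<equiv> 9 :: nat"
abbreviation (input) "xrow \<equiv> 10 :: nat"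
abbreviation (input) "xk \<equiv> 11 :: nat"
abbreviation (input) "xA \<equiv> 12 :: nat"
abbreviation (input) "xX \<equiv> 13 :: nat"
abbreviation (input) "xi \<equiv> 14 :: nat"
abbreviation (input) "xB \<equiv> 15 :: nat"
abbreviation (input) "xnx \<equiv> 16 :: nat"
abbreviation (input) "xrn \<equiv> 17 :: nat"
abbreviation (input) "xrp \<equiv> 18 :: nat"
abbreviation (input) "xw \<equiv> 19 :: nat"
abbreviation (input) "xq \<equiv> 20 :: nat"
abbreviation (input) "xNA \<equiv> 21 :: nat"
abbreviation (input) "xtl \<equiv> 22 :: nat"
abbreviation (input) "xt \<equiv> 23 :: nat"
abbreviation (input) "xok \<equiv> 24 :: nat"
abbreviation (input) "xM \<equiv> 25 :: nat"
abbreviation (input) "xD1 \<equiv> 26 :: nat"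
abbreviation (input) "xNW \<equiv> 27 :: nat"
abbreviation (input) "xy \<equiv> 28 :: nat"
abbreviation (input) "xz \<equiv> 29 :: nat"
abbreviation (input) "xneed \<equiv> 30 :: nat"
abbreviation (input) "xcv \<equiv> 31 :: nat"
abbreviation (input) "xnd \<equiv> 32 :: nat"
abbreviation (input) "xb0 \<equiv> 33 :: nat"
abbreviation (input) "xb1 \<equiv> 34 :: nat"
abbreviation (input) "xqq \<equiv> 35 :: nat"
abbreviation (input) "xc \<equiv> 36 :: nat"
abbreviation (input) "xbest \<equiv> 37 :: nat"
abbreviation (input) "xbq \<equiv> 38 :: nat"
abbreviation (input) "xwt \<equiv> 39 :: nat"

abbreviation (input) "EU \<equiv> Arr 1"
abbreviation (input) "EV \<equiv> Arr 2"
abbreviation (input) "ACT \<equiv> Arr 3"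
abbreviation (input) "PAR \<equiv> Arr 4"
abbreviation (input) "VERT \<equiv> Arr 5"
abbreviation (input) "DEP \<equiv> Arr 6"
abbreviation (input) "HIT \<equiv> Arr 7"
abbreviation (input) "ROW \<equiv> Arr 8"
abbreviation (input) "CN \<equiv> Arr 9"
abbreviation (input) "DIV \<equiv> Arr 10"
abbreviation (input) "MOD \<equiv> Arr 11"
abbreviation (input) "VAL \<equiv> Arr 12"
abbreviation (input) "PRED \<equiv> Arr 13"

abbreviation (input) incr :: "nat \<Rightarrow> hcom" where
  "incr x \<equiv> Assign x (Plus (V x) (N 1))"

text \<open>Rows stored one after another do not overlap: the first \<open>J\<close> rows lie below
  the start of row \<open>J\<close>, so filling that row preserves them.\<close>

lemma row_index_less: "j < J \<Longrightarrow> e < m \<Longrightarrow> j * m + e < J * (m :: nat)"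
proof -
  assume "j < J" "e < m"
  then have "j * m + e < (j + 1) * m" by simp
  also have "\<dots> \<le> J * m" using \<open>j < J\<close> by (intro mult_le_mono1) simp
  finally show ?thesis .
qed

text \<open>Multiplication by repeated addition. The 2 is rewritten as 1 + 1 to match the body cost
  plus one in \<open>tri_For\<close>.\<close>

lemma tri_add_loop:
  assumes "x \<noteq> y" "x \<noteq> z" "y \<noteq> z" "x \<noteq> a" "z \<noteq> a" "v y = c"
  shows "tri L (For x y (Assign z (Plus (V z) (V a)))) v R (c * 2 + 1)
    (\<lambda>v' R'. v' z = v z + c * v a)"
  unfolding one_add_one[symmetric]
  by (rule tri_For[where I = "\<lambda>i v' R'. v' z = v z + i * v a"])
    (use assms in \<open>auto simp: tri_def same_except_def\<close>)

context instance_data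
begin

definition good :: "nat \<Rightarrow> nat \<Rightarrow> bool" where
  "good t x \<longleftrightarrow> x < geo n (Suc k) \<and> (\<forall>e<m. act e t \<longrightarrow> hits x e)"

text \<open>Rows have length \<open>Suc T\<close>, so a time label serves directly as a column
  index.\<close>

definition graph_tables :: "(nat \<Rightarrow> nat \<Rightarrow> nat) \<Rightarrow> nat \<Rightarrow> bool" where
  "graph_tables R E \<longleftrightarrow> (\<forall>e<E. R 1 e = eu e \<and> R 2 e = ev e \<and>
     (\<forall>t\<le>T. R 3 (e * Suc T + t) = of_bool (act e t)))"

definition trie_tables :: "(nat \<Rightarrow> nat \<Rightarrow> nat) \<Rightarrow> nat \<Rightarrow> bool" where
  "trie_tables R J \<longleftrightarrow> (\<forall>j<J. R 4 j = (j - 1) div n \<and> R 5 j = (j - 1) mod n \<and>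
     R 6 j = length (nlist n j) \<and> R 8 j = j * m \<and> (\<forall>e<m. R 7 (j * m + e) = of_bool (hits j e)))"

definition digit_tables :: "(nat \<Rightarrow> nat \<Rightarrow> nat) \<Rightarrow> nat \<Rightarrow> bool" where
  "digit_tables R Y \<longleftrightarrow> (\<forall>y<Y. R 10 y = y div B \<and> R 11 y = y mod B)"

definition params :: "nat \<Rightarrow> (nat \<Rightarrow> nat) \<Rightarrow> bool" where
  "params L v \<longleftrightarrow> v 0 = L \<and> v xn = n \<and> v xm = m \<and> v xD = D \<and> v xT = T \<and> v xbig = big"


subsection \<open>The trie of vertex sequences\<close>

definition geo_prog :: hcom where
  "geo_prog = Assign xA (N 0) ;; Assign xk (N k) ;;
     For xi xk (Assign xX (N 1) ;; For xj xn (Assign xX (Plus (V xX) (V xA))) ;; Assign xA (V xX))"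

lemma tri_geo_prog:
  assumes "v xn = n"
  shows "tri L geo_prog v R (1 + (1 + (k * (1 + (n * 2 + 1 + 1) + 1) + 1))) (\<lambda>v' R'. v' xA = A)"
  unfolding geo_prog_def
proof (rule tri_Seq[where P = "\<lambda>v' R'. v' xA = 0"], goal_cases)
  case 1
  then show ?case by (simp add: tri_def)
next
  case (2 v1 R1)
  show ?case
  proof (rule tri_Seq[where P = "\<lambda>v' R'. v' xk = k"], goal_cases)
    case 1
    then show ?case by (simp add: tri_def)
  next
    case (2 v2 R2)
    show ?case
    proof (rule tri_For[where I = "\<lambda>i v' R'. v' xA = geo n i"], goal_cases)
      case (6 i v3 R3)
      then have vn: "v3 xn = n" using 2 \<open>same_except _ _ v R v1 R1\<close> assms by (simp add: same_except_def)
      show ?case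
      proof (rule tri_Seq[where P = "\<lambda>v' R'. v' xX = 1"], goal_cases)
        case 1
        then show ?case by (simp add: tri_def)
      next
        case (2 v4 R4)
        then have 4: "v4 xA = geo n i" "v4 xn = n" using 6 vn by (auto simp: same_except_def)
        show ?case
        proof (rule tri_Seq[OF tri_add_loop], goal_cases)
          case (7 v5 R5)
          then show ?case using 2 4 by (simp add: tri_def)
        qed (use 4 in auto)
      qed
    qed (use 2 \<open>v1 xA = 0\<close> in \<open>auto simp: same_except_def\<close>)
  qed
qed

text \<open>Appending \<open>w\<close> to a sequence adds exactly the edges at \<open>w\<close> to
  those already hit, so the row of a child is computed from that of its parent in time linear in
  \<open>m\<close>. As tests can only compare, equality is tested by the sum of both truncated
  differences being below 1.\<close>

definition hit_row :: hcom where
  "hit_row = For xe xm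
     (Cond (Plus (Minus (V xw) (EU (V xe))) (Minus (EU (V xe)) (V xw))) (N 1)
        (Upd 7 (Plus (V xrn) (V xe)) (N 1))
     (Cond (Plus (Minus (V xw) (EV (V xe))) (Minus (EV (V xe)) (V xw))) (N 1)
        (Upd 7 (Plus (V xrn) (V xe)) (N 1))
        (Upd 7 (Plus (V xrn) (V xe)) (HIT (Plus (V xrp) (V xe))))))"

lemma tri_hit_row:
  assumes v: "v 0 = L" "v xm = m" "v xw = w" "v xrn = rn" "v xrp = rp" "w < n" "rp + m \<le> rn"
    and g: "graph_tables R m" and p: "\<And>e. e < m \<Longrightarrow> R 7 (rp + e) = of_bool (hits p e)"
  shows "tri L hit_row v R (m * (3 + 1) + 1)
    (\<lambda>v' R'. (\<forall>e<m. R' 7 (rn + e) = of_bool (hits (Suc (p * n + w)) e)) \<and> (\<forall>a<rn. R' 7 a = R 7 a))"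
  unfolding hit_row_def
proof (rule tri_For[where I = "\<lambda>i v' R'. (\<forall>e<i. R' 7 (rn + e) = of_bool (hits (Suc (p * n + w)) e)) \<and>
      (\<forall>a<rn. R' 7 a = R 7 a)"], goal_cases)
  case (6 i v' R')
  have v': "v' 0 = L" "v' xm = m" "v' xw = w" "v' xrn = rn" "v' xrp = rp" "v' xe = i"
    "R' 1 = R 1" "R' 2 = R 2"
    using 6 v by (auto simp: same_except_def)
  have e: "R 1 i = eu i" "R 2 i = ev i" using g 6 by (auto simp: graph_tables_def)
  have h: "R' 7 (rp + i) = of_bool (hits p i)" using 6 p v by auto
  have hit: "hits (Suc (p * n + w)) i \<longleftrightarrow> eu i = w \<or> ev i = w \<or> hits p i"
    using \<open>w < n\<close> by (auto simp: hits_def)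
  have eq: "w - x + (x - w) = 0 \<longleftrightarrow> x = w" for x :: nat by auto
  show ?case using v' e h hit 6 by (auto simp: tri_def arr_ok_def less_Suc_eq eq)
qed (use v in \<open>auto simp: same_except_def\<close>)

definition trie_node :: hcom where
  "trie_node = (Upd 4 (V xnx) (V xp) ;; Upd 5 (V xnx) (V xw) ;;
       Upd 6 (V xnx) (Plus (DEP (V xp)) (N 1)) ;; Upd 8 (V xnx) (V xrn)) ;;
     hit_row ;; (incr xnx ;; Assign xrn (Plus (V xrn) (V xm)))"

lemma tri_trie_node:
  assumes v: "v 0 = L" "v xm = m" "v xw = w" "v xp = p" "v xnx = Suc (p * n + w)"
      "v xrn = Suc (p * n + w) * m" "v xrp = p * m" "w < n"
    and g: "graph_tables R m" and t: "trie_tables R (Suc (p * n + w))"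
  shows "tri L trie_node v R (4 + (m * (3 + 1) + 1 + 2)) (\<lambda>v' R'. v' xnx = Suc (Suc (p * n + w)) \<and>
     v' xrn = Suc (Suc (p * n + w)) * m \<and> trie_tables R' (Suc (Suc (p * n + w))))"
proof -
  let ?j = "Suc (p * n + w)"
  define R1 where "R1 = R(4 := (R 4)(?j := p), 5 := (R 5)(?j := w), 6 := (R 6)(?j := R 6 p + 1),
    8 := (R 8)(?j := ?j * m))"
  \<comment> \<open>The parent has a smaller number than the child, so its row is complete.\<close>
  have "p * 1 \<le> p * n" using n by (intro mult_le_mono2) simp
  then have pj: "p < ?j" by linarith
  have par: "(?j - 1) div n = p" "(?j - 1) mod n = w" using v by auto
  have g1: "graph_tables R1 m" using g by (simp add: graph_tables_def R1_def)
  have R7: "R1 7 = R 7" by (simp add: R1_def)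
  have dep: "R 6 p = length (nlist n p)" using t pj by (simp add: trie_tables_def)
  show ?thesis
    unfolding trie_node_def
  proof (rule tri_Seq[where P = "\<lambda>v' R'. v' = v \<and> R' = R1"], goal_cases)
    case 1
    show ?case using v pj by (simp add: tri_def arr_ok_def R1_def)
  next
    case (2 v1 R1')
    then have e: "v1 = v" "R1' = R1" by auto
    \<comment> \<open>The row of the parent ends before the row being written begins, so reading and
      writing do not interfere.\<close>
    have "Suc p * m \<le> ?j * m" using pj by (intro mult_le_mono1) simp
    then have hit: "tri L hit_row v R1 (m * (3 + 1) + 1)
        (\<lambda>v' R'. (\<forall>e<m. R' 7 (?j * m + e) = of_bool (hits ?j e)) \<and> (\<forall>a<?j * m. R' 7 a = R1 7 a))"
      using v g1 t pj R7
      by (intro tri_hit_row[where rp = "p * m"]) (auto simp: trie_tables_def)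
    show ?case unfolding e
    proof (rule tri_Seq[OF hit], goal_cases)
      case (1 v2 R2)
      have "trie_tables R2 (Suc ?j)"
        unfolding trie_tables_def
      proof (intro allI impI)
        fix j assume j: "j < Suc ?j"
        have fr: "R2 4 = R1 4" "R2 5 = R1 5" "R2 6 = R1 6" "R2 8 = R1 8"
          using 1 by (simp_all add: same_except_def hit_row_def)
        show "R2 4 j = (j - 1) div n \<and> R2 5 j = (j - 1) mod n \<and> R2 6 j = length (nlist n j) \<and>
          R2 8 j = j * m \<and> (\<forall>e<m. R2 7 (j * m + e) = of_bool (hits j e))"
        proof (cases "j = ?j")
          case True
          then show ?thesis using 1(1) fr par dep v by (simp add: R1_def)
        next
          case False
          then have "j < ?j" using j by simp
          moreover have "R2 7 (j * m + e) = R 7 (j * m + e)" if "e < m" for e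
            using 1(1) R7 row_index_less[OF \<open>j < ?j\<close> that] by simp
          ultimately show ?thesis using t fr by (simp add: trie_tables_def R1_def)
        qed
      qed
      moreover have "v2 xnx = ?j" "v2 xrn = ?j * m" "v2 xm = m"
        using 1 v by (simp_all add: same_except_def hit_row_def)
      ultimately show ?case by (simp add: tri_def)
    qed
  qed
qed

text \<open>In breadth-first order the children of successive parents are numbered consecutively, so
  a running index replaces the product \<open>p * n\<close>. Expanding the \<open>A\<close> nodes of
  depth below \<open>k\<close> yields all nodes of depth at most \<open>k\<close>.\<close>

definition trie_prog :: hcom where
  "trie_prog = geo_prog ;; (Assign xB (Plus (V xA) (N 1)) ;; Assign xnx (N 1) ;;
       Assign xrp (N 0) ;; Assign xrn (V xm)) ;;
     For xp xA (For xw xn trie_node ;; Assign xrp (Plus (V xrp) (V xm))) ;; Assign xNA (V xnx)"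

lemma tri_trie_prog:
  assumes v: "v 0 = L" "v xn = n" "v xm = m" and g: "graph_tables R m"
    and z: "R 4 0 = 0" "R 5 0 = 0" "R 6 0 = 0" "R 8 0 = 0" "\<And>a. R 7 a = 0"
  shows "tri L trie_prog v R
     (1 + (1 + (k * (1 + (n * 2 + 1 + 1) + 1) + 1)) + (4 + (A * (n * (4 + (m * (3 + 1) + 1 + 2) + 1) + 1 + 1 + 1) + 1 + 1)))
     (\<lambda>v' R'. v' xA = A \<and> v' xB = B \<and> v' xNA = geo n (Suc k) \<and> trie_tables R' (geo n (Suc k)))"
  unfolding trie_prog_def
proof (rule tri_Seq[OF tri_geo_prog[of v, OF v(2)]], goal_cases)
  case (1 v1 R1)
  have R1: "R1 = R" using 1(2) by (auto simp: same_except_def geo_prog_def)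
  have v1: "v1 0 = L" "v1 xn = n" "v1 xm = m" "v1 xA = A"
    using 1 v by (simp_all add: same_except_def geo_prog_def)
  show ?case unfolding R1
  proof (rule tri_Seq[where P = "\<lambda>v' R'. R' = R \<and> v' xB = B \<and> v' xnx = 1 \<and> v' xrp = 0 \<and> v' xrn = m"],
      goal_cases)
    case 1
    then show ?case using v1 by (simp add: tri_def)
  next
    case (2 v2 R2)
    then have R2: "R2 = R" by simp
    have v2: "v2 0 = L" "v2 xn = n" "v2 xm = m" "v2 xA = A" "v2 xB = B" "v2 xnx = 1" "v2 xrp = 0"
      "v2 xrn = m" using 2 v1 by (simp_all add: same_except_def)
    let ?I = "\<lambda>p w v' R'. v' xnx = Suc (p * n + w) \<and> v' xrn = Suc (p * n + w) * m \<and> v' xrp = p * m \<and>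
       trie_tables R' (Suc (p * n + w))"
    have loop: "tri L (For xp xA (For xw xn trie_node ;; Assign xrp (Plus (V xrp) (V xm)))) v2 R
        (A * (n * (4 + (m * (3 + 1) + 1 + 2) + 1) + 1 + 1 + 1) + 1) (?I A 0)"
    proof (rule tri_For[where I = "\<lambda>p. ?I p 0"], goal_cases)
      case 5
      then show ?case using v2 z by (simp add: trie_tables_def hits_def)
    next
      case (6 p v3 R3)
      have g3: "graph_tables R3 m" and v3: "v3 0 = L" "v3 xn = n" "v3 xm = m" "v3 xp = p"
        using 6 g v2
        by (simp_all add: same_except_def trie_node_def hit_row_def graph_tables_def)
      have inner: "tri L (For xw xn trie_node) v3 R3 (n * (4 + (m * (3 + 1) + 1 + 2) + 1) + 1) (?I p n)"
      proof (rule tri_For[where I = "?I p"], goal_cases)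
        case 5
        then show ?case using 6 by simp
      next
        case (6 w v4 R4)
        have g4: "graph_tables R4 m" and v4: "v4 0 = L" "v4 xm = m" "v4 xp = p"
          using 6 g3 v3
          by (simp_all add: same_except_def trie_node_def hit_row_def graph_tables_def)
        have "tri L trie_node v4 R4 (4 + (m * (3 + 1) + 1 + 2)) (\<lambda>v' R'. v' xnx = Suc (Suc (p * n + w)) \<and>
            v' xrn = Suc (Suc (p * n + w)) * m \<and> trie_tables R' (Suc (Suc (p * n + w))))"
          by (rule tri_trie_node) (use 6 v4 g4 in auto)
        then show ?case
          by (rule tri_conseq)
            (use 6 in \<open>auto simp: same_except_def trie_node_def hit_row_def\<close>)
      qed (use v3 in \<open>auto simp: trie_node_def hit_row_def\<close>)
      show ?case
        by (rule tri_Seq[OF inner])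
          (use v3 in \<open>auto simp: tri_def same_except_def trie_node_def hit_row_def algebra_simps\<close>)
    qed (use v2 in \<open>auto simp: trie_node_def hit_row_def\<close>)
    show ?case unfolding R2
      by (rule tri_Seq[OF loop])
        (use v2 in \<open>auto simp: tri_def same_except_def trie_node_def hit_row_def mult.commute\<close>)
  qed
qed


subsection \<open>Vertex covers of the snapshots\<close>

definition cover_test :: hcom where
  "cover_test = (Assign xok (N 1) ;; Assign xrow (N 0)) ;;
     For xe xm (Cond (N 0) (ACT (Plus (V xrow) (V xt)))
       (Cond (HIT (Plus (ROW (V xy)) (V xe))) (N 1) (Assign xok (N 0)) HSkip) HSkip ;;
       Assign xrow (Plus (V xrow) (Plus (V xT) (N 1))))"

lemma tri_cover_test:
  assumes v: "v 0 = L" "v xm = m" "v xT = T" "v xt = t" "v xy = x" "t \<le> T" "x < geo n (Suc k)"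
    and g: "graph_tables R m" and p: "trie_tables R (geo n (Suc k))"
  shows "tri L cover_test v R (2 + (m * (4 + 1) + 1)) (\<lambda>v' R'. v' xok = of_bool (good t x))"
  unfolding cover_test_def
proof (rule tri_Seq[where P = "\<lambda>v' R'. v' xok = 1 \<and> v' xrow = 0"], goal_cases)
  case 1
  show ?case by (simp add: tri_def)
next
  case (2 v1 R1)
  then have R1: "R1 = R" by (auto simp: same_except_def)
  show ?case unfolding R1
  proof (rule tri_For[where I = "\<lambda>i v' R'. v' xok = of_bool (\<forall>e<i. act e t \<longrightarrow> hits x e) \<and>
      v' xrow = i * Suc T"], goal_cases)
    case (6 i v' R')
    have R': "R' = R" using 6 by (auto simp: same_except_def)
    have v': "v' 0 = L" "v' xT = T" "v' xt = t" "v' xy = x" using 6 2 v by (simp_all add: same_except_def)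
    have "R 3 (i * Suc T + t) = of_bool (act i t)" "R 8 x = x * m" "R 7 (x * m + i) = of_bool (hits x i)"
      using g p 6(1) v unfolding graph_tables_def trie_tables_def by blast+
    then show ?case using v' 6 R' by (simp add: tri_def arr_ok_def less_Suc_eq all_conj_distrib)
  qed (use 2 v in \<open>auto simp: same_except_def good_def\<close>)
qed

text \<open>Exhaustive search over all codes; a later success overwrites an earlier one. Loop
  counters start at 0 but times at 1, hence the shift from \<open>xtl\<close> to
  \<open>xt\<close>.\<close>

definition cover_prog :: hcom where
  "cover_prog = For xtl xT (Assign xt (Plus (V xtl) (N 1)) ;;
     For xy xNA (cover_test ;; Cond (N 0) (V xok) (Upd 9 (V xt) (V xy)) HSkip))"

lemma tri_cover_prog:
  assumes v: "v 0 = L" "v xm = m" "v xT = T" "v xNA = geo n (Suc k)"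
    and g: "graph_tables R m" and p: "trie_tables R (geo n (Suc k))"
    and ex: "\<And>t. t \<in> {1..T} \<Longrightarrow> \<exists>x. good t x"
  shows "tri L cover_prog v R (T * (1 + (geo n (Suc k) * (2 + (m * (4 + 1) + 1) + 2 + 1) + 1) + 1) + 1)
    (\<lambda>v' R'. cover_codes (R' 9))"
  unfolding cover_prog_def
proof (rule tri_For[where I = "\<lambda>i v' R'. \<forall>t\<in>{1..i}. good t (R' 9 t)"], goal_cases)
  case (6 i v1 R1)
  have v1: "v1 0 = L" "v1 xm = m" "v1 xT = T" "v1 xNA = geo n (Suc k)"
    and g1: "graph_tables R1 m" and p1: "trie_tables R1 (geo n (Suc k))"
    using 6 v g p by (simp_all add: same_except_def cover_test_def graph_tables_def trie_tables_def)
  show ?case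
  proof (rule tri_Seq[where P = "\<lambda>v' R'. v' xt = Suc i \<and> R' = R1"], goal_cases)
    case 1
    show ?case using 6 by (simp add: tri_def)
  next
    case (2 v2 R2)
    then have R2: "R2 = R1" by simp
    have v2: "v2 0 = L" "v2 xm = m" "v2 xT = T" "v2 xNA = geo n (Suc k)" "v2 xt = Suc i"
      using 2 v1 by (simp_all add: same_except_def)
    show ?case unfolding R2
    \<comment> \<open>Entries of earlier times are kept, and the current one is correct as soon as a
      suitable code has been met.\<close>
    proof (rule tri_For[where I = "\<lambda>x v' R'. (\<forall>t\<in>{1..i}. good t (R' 9 t)) \<and>
        ((\<exists>y<x. good (Suc i) y) \<longrightarrow> good (Suc i) (R' 9 (Suc i)))"], goal_cases)
      case 5
      show ?case using 6 by simp
    next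
      case (6 x v3 R3)
      have v3: "v3 0 = L" "v3 xm = m" "v3 xT = T" "v3 xt = Suc i" "v3 xy = x"
        and g3: "graph_tables R3 m" and p3: "trie_tables R3 (geo n (Suc k))"
        using 6 v2 g1 p1 by (simp_all add: same_except_def cover_test_def graph_tables_def trie_tables_def)
      have test: "tri L cover_test v3 R3 (2 + (m * (4 + 1) + 1)) (\<lambda>v' R'. v' xok = of_bool (good (Suc i) x))"
        by (rule tri_cover_test) (use v3 g3 p3 6 \<open>i < T\<close> in auto)
      show ?case
      proof (rule tri_Seq[OF test], goal_cases)
        case (1 v4 R4)
        have "R4 = R3" using 1 by (auto simp: same_except_def cover_test_def)
        moreover have "v4 0 = L" "v4 xt = Suc i" "v4 xy = x"
          using 1 v3 by (simp_all add: same_except_def cover_test_def)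
        ultimately show ?case using 1 6 by (auto simp: tri_def arr_ok_def less_Suc_eq)
      qed
    next
      case (7 v3 R3)
      obtain y where y: "good (Suc i) y" using ex[of "Suc i"] \<open>i < T\<close> by auto
      then have "y < geo n (Suc k)" by (simp add: good_def)
      then have "good (Suc i) (R3 9 (Suc i))" using 7 y by blast
      then show ?case using 7(1) by (auto simp: le_Suc_eq)
    qed (use v2 in \<open>auto simp: cover_test_def\<close>)
  qed
next
  case (7 v' R')
  then show ?case by (simp add: cover_codes_def good_def)
qed (use v in \<open>auto simp: cover_test_def\<close>)

end


context instance_data
begin

subsection \<open>Digits of window codes\<close>

definition pow_prog :: hcom where
  "pow_prog = (Assign xM (N 1) ;; Assign xD1 (Minus (V xD) (N 1))) ;;
     For xi xD1 (Assign xX (N 0) ;; For xj xB (Assign xX (Plus (V xX) (V xM))) ;; Assign xM (V xX)) ;;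
     Assign xNW (N 0) ;; For xj xB (Assign xNW (Plus (V xNW) (V xM)))"

lemma tri_pow_prog:
  assumes v: "v xD = D" "v xB = B"
  shows "tri L pow_prog v R (2 + (((D - 1) * (1 + (B * 2 + 1 + 1) + 1) + 1) + (1 + (B * 2 + 1))))
    (\<lambda>v' R'. v' xM = M \<and> v' xNW = NW)"
  unfolding pow_prog_def
proof (rule tri_Seq[where P = "\<lambda>v' R'. v' xM = 1 \<and> v' xD1 = D - 1"], goal_cases)
  case 1
  show ?case using v by (simp add: tri_def)
next
  case (2 v1 R1)
  then have v1: "v1 xB = B" using v by (simp add: same_except_def)
  have loop: "tri L (For xi xD1 (Assign xX (N 0) ;; For xj xB (Assign xX (Plus (V xX) (V xM))) ;;
      Assign xM (V xX))) v1 R1 ((D - 1) * (1 + (B * 2 + 1 + 1) + 1) + 1) (\<lambda>v' R'. v' xM = M)"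
  proof (rule tri_For[where I = "\<lambda>i v' R'. v' xM = B ^ i"], goal_cases)
    case (6 i v2 R2)
    then have v2: "v2 xB = B" using v1 by (simp add: same_except_def)
    show ?case
    proof (rule tri_Seq[where P = "\<lambda>v' R'. v' xX = 0"], goal_cases)
      case 1
      then show ?case by (simp add: tri_def)
    next
      case (2 v4 R4)
      then have 4: "v4 xM = B ^ i" "v4 xB = B" using 6 v2 by (auto simp: same_except_def)
      show ?case
      proof (rule tri_Seq[OF tri_add_loop], goal_cases)
        case (7 v5 R5)
        then show ?case using 2 4 by (simp add: tri_def)
      qed (use 4 in auto)
    qed
  qed (use 2 v1 in auto)
  show ?case
  proof (rule tri_Seq[OF loop], goal_cases)
    case (1 v2 R2)
    then have v2: "v2 xB = B" using v1 by (simp add: same_except_def)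
    show ?case
    proof (rule tri_Seq[where P = "\<lambda>v' R'. v' xNW = 0"], goal_cases)
      case 1
      then show ?case by (simp add: tri_def)
    next
      case (2 v4 R4)
      then have 4: "v4 xM = M" "v4 xB = B" using 1 v2 by (auto simp: same_except_def)
      have "tri L (For xj xB (Assign xNW (Plus (V xNW) (V xM)))) v4 R4 (B * 2 + 1)
          (\<lambda>v' R'. v' xNW = v4 xNW + B * v4 xM)"
        by (rule tri_add_loop) (use 4 in auto)
      then show ?case
        by (rule tri_conseq) (use 2 4 in \<open>auto simp: NW_eq(1) same_except_def simp del: mult_Suc\<close>)
    qed
  qed
qed

text \<open>Quotient and remainder are carried along as counters while \<open>y\<close> runs
  upwards, which replaces division.\<close>

definition digit_prog :: hcom where
  "digit_prog = (Assign xX (N 0) ;; Assign xq (N 0)) ;;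
     For xy xNW (Upd 10 (V xy) (V xq) ;; Upd 11 (V xy) (V xX) ;; incr xX ;;
       Cond (V xX) (V xB) HSkip (Assign xX (N 0) ;; incr xq))"

lemma tri_digit_prog:
  assumes v: "v 0 = L" "v xB = B" "v xNW = NW"
  shows "tri L digit_prog v R (2 + (NW * (6 + 1) + 1)) (\<lambda>v' R'. digit_tables R' NW)"
  unfolding digit_prog_def
proof (rule tri_Seq[where P = "\<lambda>v' R'. v' xX = 0 \<and> v' xq = 0"], goal_cases)
  case 1
  show ?case by (simp add: tri_def)
next
  case (2 v1 R1)
  show ?case
  proof (rule tri_For[where I = "\<lambda>i v' R'. v' xX = i mod B \<and> v' xq = i div B \<and> digit_tables R' i"],
      goal_cases)
    case (6 y v' R')
    have v': "v' 0 = L" "v' xB = B" "v' xy = y" using 6 2 v by (simp_all add: same_except_def)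
    \<comment> \<open>The program tests by an inequality, whereas \<open>mod_Suc\<close> and
      \<open>div_Suc\<close> distinguish by an equality.\<close>
    have "Suc (y mod B) < B \<longleftrightarrow> Suc (y mod B) \<noteq> B"
      using mod_less_divisor[of B y] by linarith
    then show ?case using 6 v' mod_Suc[of y B] div_Suc[of y B]
      by (auto simp: tri_def arr_ok_def digit_tables_def less_Suc_eq)
  qed (use 2 v in \<open>auto simp: same_except_def digit_tables_def\<close>)
qed


subsection \<open>Checking a window\<close>

definition node_prog :: "nat \<Rightarrow> aexp \<Rightarrow> hcom" where
  "node_prog z t = Cond (MOD (V z)) (V xA) (Assign xnd (MOD (V z))) (Assign xnd (CN t))"

definition tables :: "(nat \<Rightarrow> nat \<Rightarrow> nat) \<Rightarrow> bool" where
  "tables R \<longleftrightarrow> graph_tables R m \<and> trie_tables R (geo n (Suc k)) \<and> cover_codes (R 9) \<and>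
     digit_tables R NW"

text \<open>All precomputed tables live in arrays 1 to 11, so they survive the dynamic program
  (arrays 12 and 13) and the output (array 0).\<close>

lemma tables_cong:
  assumes "tables R" and "\<And>b. 1 \<le> b \<Longrightarrow> b \<le> 11 \<Longrightarrow> R' b = R b"
  shows "tables R'"
  using assms(1) assms(2)[of 1] assms(2)[of 2] assms(2)[of 3] assms(2)[of 4] assms(2)[of 5]
    assms(2)[of 6] assms(2)[of 7] assms(2)[of 8] assms(2)[of 9] assms(2)[of 10] assms(2)[of 11]
  by (simp add: tables_def graph_tables_def trie_tables_def cover_codes_def digit_tables_def)

lemma node_less: "cover_codes cn \<Longrightarrow> t \<in> {1..T} \<Longrightarrow> node cn t x < geo n (Suc k)"
proof (cases "x < A")
  case True
  have "1 * A \<le> n * A" using n by (intro mult_le_mono1) simp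
  then have "x < Suc (n * A)" using True by linarith
  then show ?thesis using True by (simp add: node_def)
qed (auto simp: cover_codes_def node_def)

text \<open>Digits are peeled off from the newest to the oldest: in iteration \<open>i\<close> the
  variable \<open>xz\<close> holds \<open>y div B ^ i\<close>.\<close>

definition window_step :: hcom where
  "window_step = Cond (N 0) (ACT (Plus (V xrow) (Minus (V xt) (V xi))))
       (Assign xneed (N 1) ;; node_prog xz (Minus (V xt) (V xi)) ;;
        Cond (N 0) (HIT (Plus (ROW (V xnd)) (V xe))) (Assign xcv (N 1)) HSkip) HSkip ;;
     Assign xz (DIV (V xz))"

text \<open>\<open>xneed\<close> records that the edge is active in the window and
  \<open>xcv\<close> that it is covered there; on such flags the comparison
  \<open>xcv < xneed\<close> is the failure of the implication.\<close>

definition window_edge :: hcom where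
  "window_edge = (Assign xz (V xy) ;; Assign xneed (N 0) ;; Assign xcv (N 0)) ;;
     For xi xD window_step ;;
     (Cond (V xcv) (V xneed) (Assign xok (N 0)) HSkip ;;
      Assign xrow (Plus (V xrow) (Plus (V xT) (N 1))))"

definition window_test :: hcom where
  "window_test = (Assign xok (N 1) ;; Assign xrow (N 0)) ;; For xe xm window_edge"

lemma tri_window_edge:
  assumes v: "v 0 = L" "v xD = D" "v xT = T" "v xA = A" "v xt = t" "v xy = y" "v xe = e"
      "v xrow = e * Suc T" "v xok = of_bool okb"
    and t: "t \<in> {D..T}" and y: "y < NW" and e: "e < m" and tab: "tables R"
  shows "tri L window_edge v R (3 + (D * (7 + 1) + 1 + 3)) (\<lambda>v' R'. v' xrow = Suc e * Suc T \<and>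
    v' xok = of_bool (okb \<and> ((\<exists>i<D. act e (t - i)) \<longrightarrow>
     (\<exists>i<D. act e (t - i) \<and> hits (node (R 9) (t - i) (y div B ^ i mod B)) e))))"
  unfolding window_edge_def
proof (rule tri_Seq[where P = "\<lambda>v' R'. v' xz = y \<and> v' xneed = 0 \<and> v' xcv = 0"], goal_cases)
  case 1
  show ?case using v by (simp add: tri_def)
next
  case (2 v1 R1)
  then have R1: "R1 = R" by (auto simp: same_except_def)
  have v1: "v1 0 = L" "v1 xD = D" "v1 xT = T" "v1 xA = A" "v1 xt = t" "v1 xe = e"
    "v1 xrow = e * Suc T" "v1 xok = of_bool okb"
    using 2 v by (simp_all add: same_except_def)
  let ?h = "\<lambda>i. hits (node (R 9) (t - i) (y div B ^ i mod B)) e"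
  have loop: "tri L (For xi xD window_step) v1 R (D * (7 + 1) + 1) (\<lambda>v' R'.
      v' xneed = of_bool (\<exists>i<D. act e (t - i)) \<and> v' xcv = of_bool (\<exists>i<D. act e (t - i) \<and> ?h i))"
  proof (rule tri_For[where I = "\<lambda>i v' R'. v' xz = y div B ^ i \<and>
      v' xneed = of_bool (\<exists>j<i. act e (t - j)) \<and> v' xcv = of_bool (\<exists>j<i. act e (t - j) \<and> ?h j)"],
      goal_cases)
    case (6 i v2 R2)
    have R2: "R2 = R" using 6 by (auto simp: same_except_def window_step_def node_prog_def)
    have v2: "v2 0 = L" "v2 xA = A" "v2 xt = t" "v2 xe = e" "v2 xrow = e * Suc T" "v2 xi = i"
      using 6 v1 by (simp_all add: same_except_def window_step_def node_prog_def)
    let ?z = "y div B ^ i"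
    let ?nd = "node (R 9) (t - i) (?z mod B)"
    have z: "?z < NW" using y div_le_dividend le_less_trans by blast
    \<comment> \<open>Since \<open>i < D\<close> and \<open>D \<le> t\<close>, the truncated
      subtraction is exact and gives a time of the instance.\<close>
    have ti: "t - i \<in> {1..T}" "t - i \<le> T" using t 6(1) by auto
    have nd: "?nd < geo n (Suc k)" using node_less ti tab unfolding tables_def by blast
    have a: "R 3 (e * Suc T + (t - i)) = of_bool (act e (t - i))"
      using tab e ti(2) unfolding tables_def graph_tables_def by blast
    have d: "R 10 ?z = ?z div B" "R 11 ?z = ?z mod B"
      using tab z unfolding tables_def digit_tables_def by blast+
    have h: "R 8 ?nd = ?nd * m" "R 7 (?nd * m + e) = of_bool (?h i)"
      using tab nd e unfolding tables_def trie_tables_def by blast+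
    have zS: "?z div B = y div B ^ Suc i" by (simp only: power_Suc2 div_mult2_eq)
    show ?case
    proof (cases "act e (t - i)")
      case False
      then have "tri L window_step v2 R 7 (\<lambda>v' R'. v' xz = ?z div B \<and> v' xneed = v2 xneed \<and> v' xcv = v2 xcv)"
        using v2 6(2) a d by (simp add: window_step_def tri_def arr_ok_def)
      then show ?thesis unfolding R2
        by (rule tri_conseq) (use 6 zS False in \<open>auto simp: less_Suc_eq\<close>)
    next
      case True
      then have "tri L window_step v2 R 7 (\<lambda>v' R'. v' xz = ?z div B \<and> v' xneed = 1 \<and>
          v' xcv = (if ?h i then 1 else v2 xcv))"
      proof (cases "?z mod B < A")
        case True
        then have "?nd = ?z mod B" by (simp add: node_def)
        then show ?thesis using v2 6(2) a d h True \<open>act e (t - i)\<close>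
          by (simp add: window_step_def node_prog_def tri_def arr_ok_def)
      next
        case False
        then have "?nd = R 9 (t - i)" by (simp add: node_def)
        then show ?thesis using v2 6(2) a d h False \<open>act e (t - i)\<close>
          by (simp add: window_step_def node_prog_def tri_def arr_ok_def)
      qed
      then show ?thesis unfolding R2
        by (rule tri_conseq) (use 6 zS True in \<open>auto simp: less_Suc_eq\<close>)
    qed
  qed (use 2 v1 in \<open>auto simp: window_step_def node_prog_def\<close>)
  show ?case unfolding R1
  proof (rule tri_Seq[OF loop], goal_cases)
    case (1 v2 R2)
    then have v2: "v2 xrow = e * Suc T" "v2 xok = of_bool okb" "v2 xT = T"
      using v1 by (simp_all add: same_except_def window_step_def node_prog_def)
    show ?case using 1(1) v2 by (auto simp: tri_def)
  qed
qed

lemma tri_window_test: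
  assumes v: "v 0 = L" "v xm = m" "v xD = D" "v xT = T" "v xA = A" "v xt = t" "v xy = y"
    and t: "t \<in> {D..T}" and y: "y < NW" and tab: "tables R"
  shows "tri L window_test v R (2 + (m * (3 + (D * (7 + 1) + 1 + 3) + 1) + 1))
    (\<lambda>v' R'. v' xok = of_bool (valid (R 9) t y))"
  unfolding window_test_def
proof (rule tri_Seq[where P = "\<lambda>v' R'. v' xok = 1 \<and> v' xrow = 0"], goal_cases)
  case 1
  show ?case by (simp add: tri_def)
next
  case (2 v1 R1)
  then have R1: "R1 = R" by (auto simp: same_except_def)
  let ?P = "\<lambda>e. (\<exists>i<D. act e (t - i)) \<longrightarrow>
     (\<exists>i<D. act e (t - i) \<and> hits (node (R 9) (t - i) (y div B ^ i mod B)) e)"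
  show ?case unfolding R1
  proof (rule tri_For[where I = "\<lambda>e v' R'. v' xrow = e * Suc T \<and> v' xok = of_bool (\<forall>e'<e. ?P e')"],
      goal_cases)
    case (6 e v2 R2)
    have R2: "R2 = R"
      using 6 by (auto simp: same_except_def window_edge_def window_step_def node_prog_def)
    have v2: "v2 0 = L" "v2 xD = D" "v2 xT = T" "v2 xA = A" "v2 xt = t" "v2 xy = y"
      using 6 2 v by (simp_all add: same_except_def window_edge_def window_step_def node_prog_def)
    have "tri L window_edge v2 R (3 + (D * (7 + 1) + 1 + 3)) (\<lambda>v' R'. v' xrow = Suc e * Suc T \<and>
        v' xok = of_bool ((\<forall>e'<e. ?P e') \<and> ?P e))"
      by (rule tri_window_edge) (use v2 6 t y tab in auto)
    then show ?case unfolding R2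
      by (rule tri_conseq) (auto simp: less_Suc_eq all_conj_distrib)
  next
    case (7 v' R')
    then show ?case by (simp add: valid_def)
  qed (use 2 v in \<open>auto simp: same_except_def window_edge_def window_step_def node_prog_def\<close>)
qed


subsection \<open>Filling the table\<close>

lemma div_B_less: "y < NW \<Longrightarrow> y div B < M"
  by (intro less_mult_imp_div_less) (simp only: NW_eq(2))

text \<open>Only entries below \<open>M\<close> matter, so a row may be moved to or from a segment
  of a shared array.\<close>

lemma dp_row_cong:
  assumes "\<And>q. q < M \<Longrightarrow> u q = u' q" "\<And>q. q < M \<Longrightarrow> w q = w' q" "\<And>q. q < M \<Longrightarrow> p q = p' q"
    and "Y \<le> NW" "dp_row cn t u w p Y"
  shows "dp_row cn t u' w' p' Y"
proof -
  have M: "y mod M < M" for y by simp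
  show ?thesis
    unfolding dp_row_def
  proof (intro conjI allI impI)
    fix y assume y: "y < Y" "legal cn t y"
    then have "w (y mod M) \<le> u (y div B) + weight cn t (y mod B)"
      using assms(5) unfolding dp_row_def by blast
    then show "w' (y mod M) \<le> u' (y div B) + weight cn t (y mod B)"
      using assms(1)[OF div_B_less] assms(2)[OF M] y \<open>Y \<le> NW\<close> by simp
  next
    fix q assume q: "q < M"
    show "w' q \<le> big" using assms(2,5) q unfolding dp_row_def by metis
    assume "w' q < big"
    then have *: "p q < NW \<and> p q mod M = q \<and> legal cn t (p q) \<and>
        w q = u (p q div B) + weight cn t (p q mod B)"
      using assms(2,5) q unfolding dp_row_def by metis
    then show "p' q < NW" "p' q mod M = q" "legal cn t (p' q)"
      "w' q = u' (p' q div B) + weight cn t (p' q mod B)"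
      using assms(1)[OF div_B_less] assms(2,3)[OF q] by metis+
  qed
qed

text \<open>One relaxation. As entries never exceed \<open>big\<close>, a candidate strictly below
  the old entry is automatically finite.\<close>

lemma dp_row_step:
  assumes "dp_row cn t u w p y" "y < NW"
  defines "c \<equiv> u (y div B) + weight cn t (y mod B)"
  shows "legal cn t y \<Longrightarrow> c < w (y mod M) \<Longrightarrow> dp_row cn t u (w(y mod M := c)) (p(y mod M := y)) (Suc y)"
    and "\<not> (legal cn t y \<and> c < w (y mod M)) \<Longrightarrow> dp_row cn t u w p (Suc y)"
proof -
  have M: "y mod M < M" by simp
  have "w (y mod M) \<le> big" using assms(1) M unfolding dp_row_def by blast
  moreover assume "legal cn t y" "c < w (y mod M)"
  ultimately show "dp_row cn t u (w(y mod M := c)) (p(y mod M := y)) (Suc y)"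
    using assms(1,2) unfolding dp_row_def
    by (auto simp: less_Suc_eq c_def intro: le_trans[OF less_imp_le])
next
  assume "\<not> (legal cn t y \<and> c < w (y mod M))"
  then show "dp_row cn t u w p (Suc y)"
    using assms(1) unfolding dp_row_def c_def by (auto simp: less_Suc_eq not_less)
qed

text \<open>\<open>xqq\<close> follows \<open>y mod M\<close> by wrapping around at
  \<open>M\<close>; the previous and the current row start at \<open>xb0\<close> and
  \<open>xb1\<close>.\<close>

definition dp_step :: hcom where
  "dp_step = Cond (V xt) (V xD) (Assign xok (N 1)) window_test ;;
     node_prog xy (V xt) ;;
     Assign xwt (Plus (VAL (Plus (V xb0) (DIV (V xy)))) (DEP (V xnd))) ;;
     (Cond (N 0) (V xok) (Cond (V xwt) (VAL (Plus (V xb1) (V xqq)))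
         (Upd 12 (Plus (V xb1) (V xqq)) (V xwt) ;; Upd 13 (Plus (V xb1) (V xqq)) (V xy)) HSkip) HSkip ;;
     incr xqq ;; Cond (V xqq) (V xM) HSkip (Assign xqq (N 0)))"

lemma tri_dp_step:
  assumes v: "v 0 = L" "v xm = m" "v xD = D" "v xT = T" "v xA = A" "v xt = t" "v xy = y" "v xM = M"
      "v xqq = y mod M" "v xb0 = b0" "v xb1 = b0 + M"
    and t: "t \<in> {1..T}" and y: "y < NW" and tab: "tables R"
    and row: "dp_row (R 9) t (\<lambda>q. R 12 (b0 + q)) (\<lambda>q. R 12 (b0 + M + q)) (\<lambda>q. R 13 (b0 + M + q)) y"
  shows "tri L dp_step v R (1 + (2 + (m * (3 + (D * (7 + 1) + 1 + 3) + 1) + 1)) + (2 + (1 + 7)))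
    (\<lambda>v' R'. v' xqq = Suc y mod M \<and> (\<forall>a<b0 + M. R' 12 a = R 12 a \<and> R' 13 a = R 13 a) \<and>
      dp_row (R 9) t (\<lambda>q. R' 12 (b0 + q)) (\<lambda>q. R' 12 (b0 + M + q)) (\<lambda>q. R' 13 (b0 + M + q)) (Suc y))"
  unfolding dp_step_def
proof (rule tri_Seq[where P = "\<lambda>v' R'. v' xok = of_bool (legal (R 9) t y)"], goal_cases)
  case 1
  show ?case
  proof (cases "t < D")
    case True
    then show ?thesis using v by (simp add: tri_def legal_def)
  next
    case False
    then have "tri L window_test v R (2 + (m * (3 + (D * (7 + 1) + 1 + 3) + 1) + 1))
        (\<lambda>v' R'. v' xok = of_bool (valid (R 9) t y))"
      by (intro tri_window_test) (use v t y tab in auto)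
    then show ?thesis using v False by (simp add: tri_def legal_def)
  qed
next
  case (2 v1 R1)
  then have R1: "R1 = R"
    by (auto simp: same_except_def window_test_def window_edge_def window_step_def node_prog_def)
  have v1: "v1 0 = L" "v1 xA = A" "v1 xt = t" "v1 xy = y" "v1 xM = M" "v1 xqq = y mod M"
      "v1 xb0 = b0" "v1 xb1 = b0 + M"
    using 2 v by (simp_all add: same_except_def window_test_def window_edge_def window_step_def node_prog_def)
  have ok: "v1 xok = of_bool (legal (R 9) t y)" using 2 by simp
  let ?nd = "node (R 9) t (y mod B)"
  have d: "R 10 y = y div B" "R 11 y = y mod B"
    using tab y unfolding tables_def digit_tables_def by blast+
  have nd: "?nd < geo n (Suc k)" using node_less t tab unfolding tables_def by blast
  have dep: "R 6 ?nd = weight (R 9) t (y mod B)" using tab nd unfolding tables_def trie_tables_def by blast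
  show ?case unfolding R1
  proof (rule tri_Seq[where P = "\<lambda>v' R'. v' xnd = ?nd \<and> R' = R"], goal_cases)
    case 1
    show ?case using v1 d by (simp add: node_prog_def tri_def arr_ok_def node_def)
  next
    case (2 v2 R2)
    then have R2: "R2 = R" by simp
    have v2: "v2 0 = L" "v2 xA = A" "v2 xt = t" "v2 xy = y" "v2 xM = M" "v2 xqq = y mod M"
      "v2 xb0 = b0" "v2 xb1 = b0 + M" "v2 xok = of_bool (legal (R 9) t y)" "v2 xnd = ?nd"
      using 2 v1 ok by (simp_all add: same_except_def node_prog_def)
    let ?c = "R 12 (b0 + y div B) + weight (R 9) t (y mod B)"
    show ?case unfolding R2
    proof (rule tri_Seq[where P = "\<lambda>v' R'. v' xwt = ?c \<and> R' = R"], goal_cases)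
      case 1
      show ?case using v2 d dep by (simp add: tri_def arr_ok_def)
    next
      case (2 v3 R3)
      then have R3: "R3 = R" by simp
      have v3: "v3 0 = L" "v3 xM = M" "v3 xqq = y mod M" "v3 xy = y" "v3 xb1 = b0 + M"
          "v3 xok = of_bool (legal (R 9) t y)" "v3 xwt = ?c"
        using 2 v2 by (simp_all add: same_except_def)
      have dM: "y div B < M" using div_B_less y .
      have "y mod M < M" by simp
      then have "Suc (y mod M) < M \<longleftrightarrow> Suc (y mod M) \<noteq> M" by linarith
      then have qq: "Suc y mod M = (if Suc (y mod M) < M then Suc (y mod M) else 0)"
        by (simp add: mod_Suc)
      show ?case
      proof (cases "legal (R 9) t y \<and> ?c < R 12 (b0 + M + y mod M)")
        case True
        let ?R' = "R(12 := (R 12)(b0 + M + y mod M := ?c), 13 := (R 13)(b0 + M + y mod M := y))"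
        have "dp_row (R 9) t (\<lambda>q. R 12 (b0 + q)) ((\<lambda>q. R 12 (b0 + M + q))(y mod M := ?c))
            ((\<lambda>q. R 13 (b0 + M + q))(y mod M := y)) (Suc y)"
          using dp_row_step(1)[OF row y] True by simp
        then have "dp_row (R 9) t (\<lambda>q. ?R' 12 (b0 + q)) (\<lambda>q. ?R' 12 (b0 + M + q))
            (\<lambda>q. ?R' 13 (b0 + M + q)) (Suc y)"
          by (rule dp_row_cong[rotated 4]) (use y in auto)
        then show ?thesis using True v3 R3 qq by (simp add: tri_def arr_ok_def)
      next
        case False
        have "dp_row (R 9) t (\<lambda>q. R 12 (b0 + q)) (\<lambda>q. R 12 (b0 + M + q))
            (\<lambda>q. R 13 (b0 + M + q)) (Suc y)"
          using dp_row_step(2)[OF row y] False by simp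
        then show ?thesis using False v3 R3 qq by (auto simp: tri_def arr_ok_def)
      qed
    qed
  qed
qed

definition dp_layer :: hcom where
  "dp_layer = Assign xt (Plus (V xtl) (N 1)) ;;
     For xq xM (Upd 12 (Plus (V xb1) (V xq)) (V xbig)) ;;
     Assign xqq (N 0) ;; For xy xNW dp_step ;;
     (Assign xb0 (V xb1) ;; Assign xb1 (Plus (V xb1) (V xM)))"

definition dp_prog :: hcom where
  "dp_prog = (Assign xb0 (N 0) ;; Assign xb1 (V xM)) ;; For xtl xT dp_layer"

lemmas dp_frame = same_except_def dp_layer_def dp_step_def window_test_def window_edge_def
  window_step_def node_prog_def

lemma tri_dp_layer:
  assumes v: "v 0 = L" "v xm = m" "v xD = D" "v xT = T" "v xA = A" "v xM = M" "v xNW = NW"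
      "v xbig = big" "v xtl = s" "v xb0 = b0" "v xb1 = b0 + M"
    and s: "s < T" and tab: "tables R"
  shows "tri L dp_layer v R (1 + ((M * (1 + 1) + 1) + (1 + ((NW * ((1 + (2 + (m * (3 + (D * (7 + 1) + 1 + 3) + 1) + 1)) +
      (2 + (1 + 7))) + 1) + 1) + 2))))
    (\<lambda>v' R'. v' xb0 = b0 + M \<and> v' xb1 = b0 + M + M \<and>
      (\<forall>a<b0 + M. R' 12 a = R 12 a \<and> R' 13 a = R 13 a) \<and>
      dp_row (R 9) (Suc s) (\<lambda>q. R' 12 (b0 + q)) (\<lambda>q. R' 12 (b0 + M + q)) (\<lambda>q. R' 13 (b0 + M + q)) NW)"
  unfolding dp_layer_def
proof (rule tri_Seq[where P = "\<lambda>v' R'. v' xt = Suc s \<and> R' = R"], goal_cases)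
  case 1
  show ?case using v by (simp add: tri_def)
next
  case (2 v1 R1)
  then have R1: "R1 = R" by simp
  have v1: "v1 0 = L" "v1 xm = m" "v1 xD = D" "v1 xT = T" "v1 xA = A" "v1 xM = M" "v1 xNW = NW"
    "v1 xbig = big" "v1 xt = Suc s" "v1 xb0 = b0" "v1 xb1 = b0 + M"
    using 2 v by (simp_all add: same_except_def)
  have init: "tri L (For xq xM (Upd 12 (Plus (V xb1) (V xq)) (V xbig))) v1 R (M * (1 + 1) + 1)
     (\<lambda>v' R'. (\<forall>a<b0 + M. R' 12 a = R 12 a) \<and> (\<forall>q<M. R' 12 (b0 + M + q) = big))"
    by (rule tri_For[where I = "\<lambda>i v' R'. (\<forall>a<b0 + M. R' 12 a = R 12 a) \<and>
        (\<forall>q<i. R' 12 (b0 + M + q) = big)"])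
      (use v1 in \<open>auto simp: tri_def arr_ok_def same_except_def less_Suc_eq\<close>)
  show ?case unfolding R1
  proof (rule tri_Seq[OF init], goal_cases)
    case (1 v2 R2)
    have v2: "v2 0 = L" "v2 xm = m" "v2 xD = D" "v2 xT = T" "v2 xA = A" "v2 xM = M" "v2 xNW = NW"
      "v2 xt = Suc s" "v2 xb0 = b0" "v2 xb1 = b0 + M"
      and R2: "b \<noteq> 12 \<Longrightarrow> R2 b = R b" for b
      using 1 v1 by (simp_all add: same_except_def)
    show ?case
    proof (rule tri_Seq[where P = "\<lambda>v' R'. v' xqq = 0 \<and> R' = R2"], goal_cases)
      case 1
      show ?case by (simp add: tri_def)
    next
      case (2 v3 R3)
      then have R3: "R3 = R2" by simp
      have v3: "v3 0 = L" "v3 xm = m" "v3 xD = D" "v3 xT = T" "v3 xA = A" "v3 xM = M" "v3 xNW = NW"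
        "v3 xt = Suc s" "v3 xb0 = b0" "v3 xb1 = b0 + M" "v3 xqq = 0"
        using 2 v2 by (simp_all add: same_except_def)
      let ?row = "\<lambda>R'. dp_row (R 9) (Suc s) (\<lambda>q. R' 12 (b0 + q)) (\<lambda>q. R' 12 (b0 + M + q))
          (\<lambda>q. R' 13 (b0 + M + q))"
      let ?I = "\<lambda>y R'. ?row R' y \<and> (\<forall>a<b0 + M. R' 12 a = R 12 a \<and> R' 13 a = R 13 a)"
      have loop: "tri L (For xy xNW dp_step) v3 R2 (NW * ((1 + (2 + (m * (3 + (D * (7 + 1) + 1 + 3) + 1) + 1)) +
          (2 + (1 + 7))) + 1) + 1) (\<lambda>v' R'. ?I NW R')"
      proof (rule tri_For[where I = "\<lambda>y v' R'. v' xqq = y mod M \<and> ?I y R'"], goal_cases)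
        case 5
        show ?case using v3 1 R2 by (simp add: dp_row_def)
      next
        case (6 y v4 R4)
        have v4: "v4 0 = L" "v4 xm = m" "v4 xD = D" "v4 xT = T" "v4 xA = A" "v4 xM = M" "v4 xNW = NW"
          "v4 xt = Suc s" "v4 xb0 = b0" "v4 xb1 = b0 + M" "v4 xqq = y mod M" "v4 xy = y"
          using 6 v3 by (simp_all add: dp_frame)
        have R4: "R4 b = R b" if "b \<le> 11" for b using 6(4) R2[of b] that by (auto simp: dp_frame)
        have tab4: "tables R4" using tab R4 by (blast intro: tables_cong)
        have "tri L dp_step v4 R4 (1 + (2 + (m * (3 + (D * (7 + 1) + 1 + 3) + 1) + 1)) + (2 + (1 + 7)))
            (\<lambda>v' R'. v' xqq = Suc y mod M \<and> (\<forall>a<b0 + M. R' 12 a = R4 12 a \<and> R' 13 a = R4 13 a) \<and>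
            dp_row (R4 9) (Suc s) (\<lambda>q. R' 12 (b0 + q)) (\<lambda>q. R' 12 (b0 + M + q)) (\<lambda>q. R' 13 (b0 + M + q)) (Suc y))"
          by (rule tri_dp_step) (use v4 s tab4 6 R4[of 9] in auto)
        then show ?case by (rule tri_conseq) (use 6 R4[of 9] in auto)
      qed (use v3 in \<open>auto simp: dp_frame\<close>)
      show ?case unfolding R3
      proof (rule tri_Seq[OF loop], goal_cases)
        case (1 v4 R4)
        have "v4 xb0 = b0" "v4 xb1 = b0 + M" "v4 xM = M" using 1 v3 by (simp_all add: dp_frame)
        then show ?case using 1(1) by (simp add: tri_def)
      qed
    qed
  qed
qed

abbreviation val_table :: "(nat \<Rightarrow> nat \<Rightarrow> nat) \<Rightarrow> nat \<Rightarrow> nat \<Rightarrow> nat" where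
  "val_table R t q \<equiv> R 12 (t * M + q)"

abbreviation pred_table :: "(nat \<Rightarrow> nat \<Rightarrow> nat) \<Rightarrow> nat \<Rightarrow> nat \<Rightarrow> nat" where
  "pred_table R t q \<equiv> R 13 (t * M + q)"

lemma tri_dp_prog:
  assumes v: "v 0 = L" "v xm = m" "v xD = D" "v xT = T" "v xA = A" "v xM = M" "v xNW = NW" "v xbig = big"
    and tab: "tables R" and z: "\<And>a. R 12 a = 0"
  shows "tri L dp_prog v R (2 + (T * ((1 + ((M * (1 + 1) + 1) + (1 + ((NW * ((1 + (2 + (m * (3 + (D * (7 + 1) + 1 + 3) + 1) + 1)) +
      (2 + (1 + 7))) + 1) + 1) + 2)))) + 1) + 1))
    (\<lambda>v' R'. v' xb0 = T * M \<and> dp_table (R 9) (val_table R') (pred_table R') T)"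
  unfolding dp_prog_def
proof (rule tri_Seq[where P = "\<lambda>v' R'. v' xb0 = 0 \<and> v' xb1 = M"], goal_cases)
  case 1
  show ?case using v by (simp add: tri_def)
next
  case (2 v1 R1)
  then have R1: "R1 = R" by (auto simp: same_except_def)
  have v1: "v1 0 = L" "v1 xm = m" "v1 xD = D" "v1 xT = T" "v1 xA = A" "v1 xM = M" "v1 xNW = NW"
    "v1 xbig = big" "v1 xb0 = 0" "v1 xb1 = M"
    using 2 v by (simp_all add: same_except_def)
  show ?case unfolding R1
  proof (rule tri_For[where I = "\<lambda>t v' R'. v' xb0 = t * M \<and> v' xb1 = t * M + M \<and>
      dp_table (R 9) (val_table R') (pred_table R') t"], goal_cases)
    case 5
    show ?case using v1 z by (simp add: dp_table_def)
  next
    case (6 t v2 R2)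
    have v2: "v2 0 = L" "v2 xm = m" "v2 xD = D" "v2 xT = T" "v2 xA = A" "v2 xM = M" "v2 xNW = NW"
      "v2 xbig = big" "v2 xb0 = t * M" "v2 xb1 = t * M + M"
      using 6 v1 by (simp_all add: dp_frame)
    have R2: "R2 b = R b" if "b \<le> 11" for b using 6(4) that by (auto simp: dp_frame)
    have tab2: "tables R2" using tab R2 by (blast intro: tables_cong)
    have R9: "R2 9 = R 9" using R2[of 9] by simp
    have "tri L dp_layer v2 R2 (1 + ((M * (1 + 1) + 1) + (1 + ((NW * ((1 + (2 + (m * (3 + (D * (7 + 1) + 1 + 3) + 1) + 1)) +
      (2 + (1 + 7))) + 1) + 1) + 2))))
      (\<lambda>v' R'. v' xb0 = t * M + M \<and> v' xb1 = t * M + M + M \<and>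
      (\<forall>a<t * M + M. R' 12 a = R2 12 a \<and> R' 13 a = R2 13 a) \<and>
      dp_row (R2 9) (Suc t) (\<lambda>q. R' 12 (t * M + q)) (\<lambda>q. R' 12 (t * M + M + q)) (\<lambda>q. R' 13 (t * M + M + q)) NW)"
      by (rule tri_dp_layer) (use v2 6 tab2 in auto)
    then show ?case
    proof (rule tri_conseq, goal_cases)
      case (2 v3 R3)
      have tM: "t * M + M = Suc t * M" by simp
      \<comment> \<open>The layer writes only from position \<open>Suc t * M\<close> on, so rows up
        to \<open>t\<close> keep their entries.\<close>
      have below: "R3 12 (s * M + q) = R2 12 (s * M + q) \<and> R3 13 (s * M + q) = R2 13 (s * M + q)"
        if "q < M" "s \<le> t" for s q
        using 2(1) row_index_less[of s "Suc t" q M] that unfolding tM by auto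
      have "dp_table (R 9) (val_table R3) (pred_table R3) (Suc t)"
        unfolding dp_table_def
      proof (intro conjI allI impI)
        fix q assume "q < M"
        then have "val_table R3 0 q = val_table R2 0 q" using below[of q 0] by simp
        also have "\<dots> = 0" using 6(2) \<open>q < M\<close> unfolding dp_table_def by blast
        finally show "val_table R3 0 q = 0" .
      next
        fix s assume s: "s < Suc t"
        show "dp_row (R 9) (Suc s) (val_table R3 s) (val_table R3 (Suc s)) (pred_table R3 (Suc s)) NW"
        proof (cases "s = t")
          case True
          then show ?thesis using 2(1) R9 unfolding tM by simp
        next
          case False
          then have "dp_row (R 9) (Suc s) (val_table R2 s) (val_table R2 (Suc s)) (pred_table R2 (Suc s)) NW"
            using 6(2) s unfolding dp_table_def by simp
          then show ?thesis
            by (rule dp_row_cong[rotated 4]) (use below[of _ s] below[of _ "Suc s"] False s in auto)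
        qed
      qed
      then show ?case using 2(1) by (simp add: algebra_simps)
    qed simp
  qed (use v1 in \<open>auto simp: dp_frame\<close>)
qed


subsection \<open>Reading off an optimal solution\<close>

definition best_prog :: hcom where
  "best_prog = (Assign xbq (N 0) ;; Assign xbest (VAL (V xb0))) ;;
     For xq xM (Cond (VAL (Plus (V xb0) (V xq))) (V xbest)
       (Assign xbest (VAL (Plus (V xb0) (V xq))) ;; Assign xbq (V xq)) HSkip)"

lemma tri_best_prog:
  assumes v: "v 0 = L" "v xM = M" "v xb0 = T * M"
  shows "tri L best_prog v R (2 + (M * (3 + 1) + 1))
    (\<lambda>v' R'. v' xbq < M \<and> (\<forall>q<M. val_table R T (v' xbq) \<le> val_table R T q))"
  unfolding best_prog_def
proof (rule tri_Seq[where P = "\<lambda>v' R'. v' xbq = 0 \<and> v' xbest = val_table R T 0"], goal_cases)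
  case 1
  show ?case using v by (simp add: tri_def arr_ok_def)
next
  case (2 v1 R1)
  then have R1: "R1 = R" by (auto simp: same_except_def)
  show ?case unfolding R1
  proof (rule tri_For[where I = "\<lambda>i v' R'. v' xbq < M \<and> v' xbest = val_table R T (v' xbq) \<and>
      (\<forall>q<i. v' xbest \<le> val_table R T q)"], goal_cases)
    case (6 i v' R')
    then have "R' = R" "v' 0 = L" "v' xb0 = T * M"
      using v 2 by (auto simp: same_except_def)
    then show ?case using 6 by (auto simp: tri_def arr_ok_def less_Suc_eq)
  qed (use 2 v in \<open>auto simp: same_except_def\<close>)
qed

text \<open>Output overwrites the input, which has been copied to arrays by then. Moving to the
  parent in the trie strips the head off the sequence.\<close>

definition emit_step :: hcom where
  "emit_step = Upd 0 (V xp) (VERT (V xnd)) ;; Upd 0 (Plus (V xp) (N 1)) (V xt) ;;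
     Assign xp (Plus (V xp) (N 2)) ;; incr xc ;; Assign xnd (PAR (V xnd))"

definition trace_step :: hcom where
  "trace_step = (Assign xy (PRED (Plus (V xb0) (V xq))) ;; node_prog xy (V xt) ;;
      Assign xlen (DEP (V xnd))) ;;
     For xj xlen emit_step ;;
     (Assign xq (DIV (V xy)) ;; Assign xb0 (Minus (V xb0) (V xM)) ;; Assign xt (Minus (V xt) (N 1)))"

definition trace_prog :: hcom where
  "trace_prog = (Assign xc (N 0) ;; Assign xp (N 1) ;; Assign xq (V xbq) ;; Assign xt (V xT)) ;;
     For xi xT trace_step ;; Upd 0 (N 0) (V xc)"

text \<open>The layout of \<open>result_list\<close> with the count as a separate argument, because
  cell 0 is written only at the very end.\<close>

definition emitted :: "(nat \<Rightarrow> nat) \<Rightarrow> nat \<Rightarrow> (nat \<times> nat) list" where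
  "emitted raw c = map (\<lambda>i. (raw (2 * i + 1), raw (2 * i + 2))) [0..<c]"

lemma emitted_cong: "(\<And>a. a \<noteq> 0 \<Longrightarrow> a < 2 * c + 1 \<Longrightarrow> raw a = raw' a) \<Longrightarrow> emitted raw c = emitted raw' c"
  by (simp add: emitted_def)

lemma tri_emit_step:
  assumes v: "v 0 = L" "v xc = c" "v xp = 2 * c + 1" "v xnd = j" "v xt = t"
    and L: "2 * c + 2 < L" and j: "j < geo n (Suc k)" "nlist n j = w # ws" and tab: "tables R"
  shows "tri L emit_step v R 5 (\<lambda>v' R'. v' xc = Suc c \<and> v' xp = 2 * Suc c + 1 \<and>
     v' xnd < geo n (Suc k) \<and> nlist n (v' xnd) = ws \<and> emitted (R' 0) (Suc c) = emitted (R 0) c @ [(w, t)])"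
proof -
  have "R 4 j = (j - 1) div n" "R 5 j = (j - 1) mod n"
    using tab j unfolding tables_def trie_tables_def by blast+
  moreover have "j \<noteq> 0" "w = (j - 1) mod n" "ws = nlist n ((j - 1) div n)"
    using j(2) by (simp_all add: nlist.simps[of n j] split: if_splits)
  moreover have "(j - 1) div n < geo n (Suc k)"
    using j(1) pred_div_less[OF \<open>j \<noteq> 0\<close>] less_trans by blast
  moreover have "emitted ((R 0)(2 * c + 1 := w, 2 * c + 2 := t)) (Suc c) = emitted (R 0) c @ [(w, t)]"
    by (simp add: emitted_def)
  ultimately show ?thesis using v L by (simp add: emit_step_def tri_def arr_ok_def)
qed

end


context instance_data
begin

lemma tri_trace_step:
  assumes v: "v 0 = L" "v xA = A" "v xM = M" "v xt = T - i" "v xq = trace pr bq i"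
      "v xb0 = (T - i) * M" "v xc = length (out_list cn pr bq i)" "v xp = 2 * length (out_list cn pr bq i) + 1"
    and em: "emitted (R 0) (length (out_list cn pr bq i)) = out_list cn pr bq i"
    and i: "i < T" and tab: "tables R" and cn: "cn = R 9" and pr: "pr = pred_table R"
    and y: "pr (T - i) (trace pr bq i) < NW"
    and L: "2 * length (out_list cn pr bq (Suc i)) < L"
  shows "tri L trace_step v R (1 + (2 + 1) + ((k * (5 + 1) + 1) + 3))
    (\<lambda>v' R'. v' xt = T - Suc i \<and> v' xq = trace pr bq (Suc i) \<and> v' xb0 = (T - Suc i) * M \<and>
      v' xc = length (out_list cn pr bq (Suc i)) \<and> v' xp = 2 * length (out_list cn pr bq (Suc i)) + 1 \<and>
      emitted (R' 0) (length (out_list cn pr bq (Suc i))) = out_list cn pr bq (Suc i))"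
proof -
  let ?q = "trace pr bq i" and ?c = "length (out_list cn pr bq i)"
  let ?y = "pr (T - i) ?q"
  let ?nd = "node (R 9) (T - i) (?y mod B)"
  let ?vs = "nlist n ?nd"
  have ti: "T - i \<in> {1..T}" using i by auto
  have d: "R 10 ?y = ?y div B" "R 11 ?y = ?y mod B"
    using tab y unfolding tables_def digit_tables_def by blast+
  have nd: "?nd < geo n (Suc k)" using node_less ti tab unfolding tables_def by blast
  have dep: "R 6 ?nd = length ?vs" using tab nd unfolding tables_def trie_tables_def by blast
  have k: "length ?vs \<le> k" using nd by (rule length_nlist_le)
  have py: "R 13 ((T - i) * M + ?q) = ?y" by (simp add: pr)
  have out: "out_list cn pr bq (Suc i) = out_list cn pr bq i @ map (\<lambda>w. (w, T - i)) ?vs"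
    by (simp add: out_list_def cn)
  show ?thesis
    unfolding trace_step_def
  proof (rule tri_Seq[where P = "\<lambda>v' R'. v' xy = ?y \<and> v' xnd = ?nd \<and> v' xlen = length ?vs \<and> R' = R"],
      goal_cases)
    case 1
    show ?case
      by (cases "?y mod B < A")
        (use v py d dep in \<open>simp_all add: tri_def arr_ok_def node_prog_def node_def\<close>)
  next
    case (2 v1 R1)
    then have R1: "R1 = R" by simp
    have v1: "v1 0 = L" "v1 xM = M" "v1 xt = T - i" "v1 xb0 = (T - i) * M" "v1 xc = ?c" "v1 xp = 2 * ?c + 1"
      using 2 v by (simp_all add: same_except_def node_prog_def)
    have loop: "tri L (For xj xlen emit_step) v1 R (length ?vs * (5 + 1) + 1)
      (\<lambda>v' R'. v' xc = ?c + length ?vs \<and> v' xp = 2 * (?c + length ?vs) + 1 \<and>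
         emitted (R' 0) (?c + length ?vs) = out_list cn pr bq (Suc i))"
    proof (rule tri_For[where I = "\<lambda>j v' R'. v' xc = ?c + j \<and> v' xp = 2 * (?c + j) + 1 \<and>
        v' xnd < geo n (Suc k) \<and> nlist n (v' xnd) = drop j ?vs \<and>
        emitted (R' 0) (?c + j) = out_list cn pr bq i @ map (\<lambda>w. (w, T - i)) (take j ?vs)"], goal_cases)
      case 5
      then show ?case using 2 v1 nd em by simp
    next
      case (6 j v2 R2)
      have v2: "v2 0 = L" "v2 xt = T - i"
        using 6 v1 by (simp_all add: same_except_def emit_step_def)
      have "R2 b = R b" if "1 \<le> b" for b using 6(4) that by (simp add: same_except_def emit_step_def)
      then have tab2: "tables R2" using tab by (blast intro: tables_cong)
      have "tri L emit_step v2 R2 5 (\<lambda>v' R'. v' xc = Suc (?c + j) \<and> v' xp = 2 * Suc (?c + j) + 1 \<and>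
        v' xnd < geo n (Suc k) \<and> nlist n (v' xnd) = drop (Suc j) ?vs \<and>
        emitted (R' 0) (Suc (?c + j)) = emitted (R2 0) (?c + j) @ [(?vs ! j, T - i)])"
      proof (rule tri_emit_step[where j = "v2 xnd"])
        show "2 * (?c + j) + 2 < L" using L 6(1) unfolding out by simp
        show "nlist n (v2 xnd) = ?vs ! j # drop (Suc j) ?vs" using 6(1,2) by (simp add: Cons_nth_drop_Suc)
      qed (use 6 v2 tab2 in auto)
      then show ?case
        by (rule tri_conseq) (use 6(1,2) in \<open>auto simp: take_Suc_conv_app_nth\<close>)
    qed (use 2 out in \<open>auto simp: emit_step_def\<close>)
    \<comment> \<open>The length of the chosen sequence is replaced by its bound \<open>k\<close>,
      so that every step gets the same cost.\<close>
    then have loop: "tri L (For xj xlen emit_step) v1 R (k * (5 + 1) + 1)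
      (\<lambda>v' R'. v' xc = ?c + length ?vs \<and> v' xp = 2 * (?c + length ?vs) + 1 \<and>
         emitted (R' 0) (?c + length ?vs) = out_list cn pr bq (Suc i))"
      by (rule tri_conseq) (use k in auto)
    show ?case unfolding R1
    proof (rule tri_Seq[OF loop], goal_cases)
      case (1 v2 R2)
      have v2: "v2 0 = L" "v2 xM = M" "v2 xt = T - i" "v2 xb0 = (T - i) * M" "v2 xy = ?y" "R2 10 = R 10"
        using 1 2 v1 by (simp_all add: same_except_def emit_step_def)
      have "tri L (Assign xq (DIV (V xy)) ;; Assign xb0 (Minus (V xb0) (V xM)) ;; Assign xt (Minus (V xt) (N 1)))
          v2 R2 3 (\<lambda>v' R'. v' xq = ?y div B \<and> v' xb0 = (T - i) * M - M \<and> v' xt = T - i - 1 \<and>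
            v' xc = v2 xc \<and> v' xp = v2 xp \<and> R' = R2)"
        using v2 d(1) by (simp add: tri_def arr_ok_def)
      moreover have "(T - i) * M - M = (T - Suc i) * M" by (simp add: diff_mult_distrib)
      moreover have "?c + length ?vs = length (out_list cn pr bq (Suc i))" unfolding out by simp
      moreover have "?y div B = trace pr bq (Suc i)" by simp
      moreover have "T - i - 1 = T - Suc i" by simp
      ultimately show ?case using 1(1) by (elim tri_conseq) (simp_all only:)
    qed
  qed
qed

lemma tri_trace_prog:
  assumes v: "v 0 = L" "v xA = A" "v xM = M" "v xT = T" "v xb0 = T * M" "v xbq = bq"
    and tab: "tables R" and L: "2 * big \<le> L"
    and dp: "dp_table (R 9) (val_table R) (pred_table R) T"
    and best: "bq < M" "\<And>q. q < M \<Longrightarrow> val_table R T bq \<le> val_table R T q"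
  defines "out \<equiv> out_list (R 9) (pred_table R) bq T"
  shows "tri L trace_prog v R (4 + ((T * (1 + (2 + 1) + ((k * (5 + 1) + 1) + 3) + 1) + 1) + 1))
    (\<lambda>v' R'. R' 0 0 = length out \<and> emitted (R' 0) (length out) = out)"
proof -
  define cn where "cn = R 9"
  define pr where "pr = pred_table R"
  have cn_ok: "cover_codes cn" using tab by (simp add: tables_def cn_def)
  have tr: "trace pr bq i < M \<and> val_table R (T - i) (trace pr bq i) < big \<and>
      val_table R T bq = val_table R (T - i) (trace pr bq i) + length (out_list cn pr bq i)"
    if "i \<le> T" for i
    by (rule dp_back[OF dp[folded cn_def pr_def] cn_ok]) (use best that in auto)
  have len: "length (out_list cn pr bq i) \<le> T * k" if "i \<le> T" for i
    using tr[OF that] dp_min_le[OF dp[folded cn_def pr_def] cn_ok best(2)] by simp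
  have y: "pr (T - i) (trace pr bq i) < NW" if "i < T" for i
  proof -
    have t: "T - i = Suc (T - Suc i)" using that by simp
    have "dp_row cn (T - i) (val_table R (T - Suc i)) (val_table R (T - i)) (pr (T - i)) NW"
      using dp that unfolding dp_table_def cn_def pr_def t by simp
    then show ?thesis using tr[of i] that unfolding dp_row_def by auto
  qed
  show ?thesis
    unfolding trace_prog_def
  proof (rule tri_Seq[where P = "\<lambda>v' R'. v' xc = 0 \<and> v' xp = 1 \<and> v' xq = bq \<and> v' xt = T"], goal_cases)
    case 1
    show ?case using v by (simp add: tri_def)
  next
    case (2 v1 R1)
    then have R1: "R1 = R" by (auto simp: same_except_def)
    have v1: "v1 0 = L" "v1 xA = A" "v1 xM = M" "v1 xT = T" "v1 xb0 = T * M"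
      using 2 v by (simp_all add: same_except_def)
    have loop: "tri L (For xi xT trace_step) v1 R (T * (1 + (2 + 1) + ((k * (5 + 1) + 1) + 3) + 1) + 1)
      (\<lambda>v' R'. v' xc = length out \<and> emitted (R' 0) (length out) = out)"
    proof (rule tri_For[where I = "\<lambda>i v' R'. v' xt = T - i \<and> v' xq = trace pr bq i \<and>
        v' xb0 = (T - i) * M \<and> v' xc = length (out_list cn pr bq i) \<and>
        v' xp = 2 * length (out_list cn pr bq i) + 1 \<and>
        emitted (R' 0) (length (out_list cn pr bq i)) = out_list cn pr bq i"], goal_cases)
      case 5
      then show ?case using 2 v1 by (simp add: out_list_def emitted_def)
    next
      case (6 i v2 R2)
      have v2: "v2 0 = L" "v2 xA = A" "v2 xM = M"
        using 6 v1 by (simp_all add: same_except_def trace_step_def emit_step_def node_prog_def)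
      have R2: "R2 b = R b" if "1 \<le> b" for b
        using 6(4) that by (simp add: same_except_def trace_step_def emit_step_def node_prog_def)
      have tab2: "tables R2" using tab R2 by (blast intro: tables_cong)
      have "tri L trace_step v2 R2 (1 + (2 + 1) + ((k * (5 + 1) + 1) + 3))
        (\<lambda>v' R'. v' xt = T - Suc i \<and> v' xq = trace pr bq (Suc i) \<and> v' xb0 = (T - Suc i) * M \<and>
        v' xc = length (out_list cn pr bq (Suc i)) \<and> v' xp = 2 * length (out_list cn pr bq (Suc i)) + 1 \<and>
        emitted (R' 0) (length (out_list cn pr bq (Suc i))) = out_list cn pr bq (Suc i))"
      proof (rule tri_trace_step)
        show "2 * length (out_list cn pr bq (Suc i)) < L" using len[of "Suc i"] 6(1) L by simp
        show "cn = R2 9" "pr = pred_table R2" by (simp_all add: R2 cn_def pr_def)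
      qed (use 6 v2 y tab2 in auto)
      then show ?case by (rule tri_conseq) auto
    next
      case (7 v2 R2)
      then show ?case by (simp add: out_def cn_def pr_def)
    qed (use v1 in \<open>auto simp: trace_step_def emit_step_def node_prog_def\<close>)
    show ?case unfolding R1
    proof (rule tri_Seq[OF loop], goal_cases)
      case (1 v2 R2)
      \<comment> \<open>The pairs start in cell 1, so storing the count in cell 0 leaves them
        unchanged.\<close>
      have "emitted ((R2 0)(0 := length out)) (length out) = emitted (R2 0) (length out)"
        by (rule emitted_cong) simp
      then show ?case using 1(1) L by (simp add: tri_def arr_ok_def)
    qed
  qed
qed

end


subsection \<open>Reading the input\<close>

text \<open>Three header cells come first; each block has two endpoints, the number of labels and
  the labels.\<close>

primrec block_start :: "(nat \<Rightarrow> nat) \<Rightarrow> nat \<Rightarrow> nat" where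
  "block_start len 0 = 3"
| "block_start len (Suc e) = block_start len e + 3 + len e"

lemma block_start_mono: "e \<le> e' \<Longrightarrow> block_start len e \<le> block_start len e'"
  by (induction rule: dec_induct) simp_all

text \<open>What the memory image of an encoding provides, with the blocks turned into functions of
  the edge number. The class of the snapshots enters through \<open>cover_exists\<close>.\<close>

locale encoded_instance = instance_data +
  fixes len :: "nat \<Rightarrow> nat" and lab :: "nat \<Rightarrow> nat \<Rightarrow> nat" and raw :: "nat \<Rightarrow> nat"
  assumes lab_le: "e < m \<Longrightarrow> j < len e \<Longrightarrow> lab e j \<le> T"
    and lab_max: "\<exists>e<m. \<exists>j<len e. lab e j = T"
    and act_iff: "e < m \<Longrightarrow> act e t \<longleftrightarrow> (\<exists>j<len e. lab e j = t)"
    and len_le: "e < m \<Longrightarrow> len e \<le> T"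
    and raw_head: "raw 0 = n" "raw 1 = m" "raw 2 = D"
    and raw_edge: "e < m \<Longrightarrow> raw (block_start len e) = eu e"
      "e < m \<Longrightarrow> raw (Suc (block_start len e)) = ev e"
      "e < m \<Longrightarrow> raw (block_start len e + 2) = len e"
      "e < m \<Longrightarrow> j < len e \<Longrightarrow> raw (block_start len e + 3 + j) = lab e j"
    and cover_exists: "t \<in> {1..T} \<Longrightarrow> \<exists>x. good t x"
begin

text \<open>The bare memory has to contain the input and also the output, whose at most
  \<open>1 + 2 * (T * k)\<close> cells are fewer than \<open>2 * big\<close>.\<close>

abbreviation limit where "limit \<equiv> block_start len m + 2 * big"

lemma block_less: "e < m \<Longrightarrow> i < 3 + len e \<Longrightarrow> block_start len e + i < limit"
  using block_start_mono[of "Suc e" m len] by simp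

definition scan_edge :: hcom where
  "scan_edge = (Assign xlen (Arr 0 (Plus (V xp) (N 2))) ;; Assign xp (Plus (V xp) (N 3))) ;;
     For xj xlen (Cond (V xT) (Arr 0 (V xp)) (Assign xT (Arr 0 (V xp))) HSkip ;; incr xp)"

lemma tri_scan_edge:
  assumes v: "v xp = block_start len e" "v xT = t" and e: "e < m" and t: "t \<le> T"
  shows "tri limit scan_edge v (R(0 := raw)) (2 + (T * (3 + 1) + 1))
    (\<lambda>v' R'. v' xp = block_start len (Suc e) \<and> t \<le> v' xT \<and> v' xT \<le> T \<and> (\<forall>j<len e. lab e j \<le> v' xT))"
  unfolding scan_edge_def
proof (rule tri_Seq[where P = "\<lambda>v' R'. v' xlen = len e \<and> v' xp = block_start len e + 3"], goal_cases)
  case 1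
  show ?case using v e raw_edge(3)[of e] block_less[of e 2] by (simp add: tri_def arr_ok_def)
next
  case (2 v1 R1)
  then have R1: "R1 = R(0 := raw)" by (auto simp: same_except_def)
  have "tri limit (For xj xlen (Cond (V xT) (Arr 0 (V xp)) (Assign xT (Arr 0 (V xp))) HSkip ;; incr xp)) v1 R1
     (len e * (3 + 1) + 1)
     (\<lambda>v' R'. v' xp = block_start len (Suc e) \<and> t \<le> v' xT \<and> v' xT \<le> T \<and> (\<forall>j<len e. lab e j \<le> v' xT))"
  proof (rule tri_For[where I = "\<lambda>i v' R'. v' xp = block_start len e + 3 + i \<and> t \<le> v' xT \<and> v' xT \<le> T \<and>
      (\<forall>j<i. lab e j \<le> v' xT)"], goal_cases)
    case (6 i v2 R2)
    have "R2 0 = raw" using 6(4) R1 by (simp add: same_except_def)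
    moreover have "raw (block_start len e + 3 + i) = lab e i" "lab e i \<le> T" using 6 e raw_edge(4) lab_le by auto
    moreover have "block_start len e + 3 + i < limit" using block_less[OF e, of "3 + i"] 6(1) by simp
    ultimately show ?case using 6(2) by (auto simp: tri_def arr_ok_def less_Suc_eq)
  qed (use 2 v t in \<open>auto simp: same_except_def\<close>)
  then show ?case by (rule tri_conseq) (use len_le[OF e] in auto)
qed

text \<open>The largest label is needed before \<open>L\<close> and the row length of the activity
  table are known. This pass therefore uses array 0 only, and its last assignment sets variable
  0.\<close>

definition scan_prog :: hcom where
  "scan_prog = (Assign xn (Arr 0 (N 0)) ;; Assign xm (Arr 0 (N 1)) ;; Assign xD (Arr 0 (N 2)) ;;
       Assign xp (N 3) ;; Assign xT (N 0)) ;;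
     For xe xm scan_edge ;; (Assign xbig (N 1) ;; Assign xX (N k)) ;;
     For xj xT (Assign xbig (Plus (V xbig) (V xX))) ;;
     Assign 0 (Plus (V xp) (Plus (V xbig) (V xbig)))"

lemma tri_scan_prog:
  "tri limit scan_prog v (R(0 := raw))
     (5 + ((m * (2 + (T * (3 + 1) + 1) + 1) + 1) + (2 + ((T * 2 + 1) + 1)))) (\<lambda>v' R'. params limit v')"
  unfolding scan_prog_def
proof (rule tri_Seq[where P = "\<lambda>v' R'. v' xn = n \<and> v' xm = m \<and> v' xD = D \<and> v' xp = 3 \<and> v' xT = 0"],
    goal_cases)
  case 1
  have "3 \<le> block_start len m" using block_start_mono[of 0 m len] by simp
  then show ?case using raw_head by (simp add: tri_def arr_ok_def)
next
  case (2 v1 R1)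
  then have R1: "R1 = R(0 := raw)" by (auto simp: same_except_def)
  have loop: "tri limit (For xe xm scan_edge) v1 (R(0 := raw)) (m * (2 + (T * (3 + 1) + 1) + 1) + 1)
      (\<lambda>v' R'. v' xp = block_start len m \<and> v' xT = T)"
  proof (rule tri_For[where I = "\<lambda>e v' R'. v' xp = block_start len e \<and> v' xT \<le> T \<and>
      (\<forall>e'<e. \<forall>j<len e'. lab e' j \<le> v' xT)"], goal_cases)
    case (6 e v2 R2)
    have R2: "R2 = R(0 := raw)" using 6(4) by (auto simp: same_except_def scan_edge_def)
    have "tri limit scan_edge v2 R2 (2 + (T * (3 + 1) + 1)) (\<lambda>v' R'. v' xp = block_start len (Suc e) \<and>
       v2 xT \<le> v' xT \<and> v' xT \<le> T \<and> (\<forall>j<len e. lab e j \<le> v' xT))"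
      unfolding R2 by (rule tri_scan_edge) (use 6 in auto)
    then show ?case by (rule tri_conseq) (use 6(2) in \<open>auto simp: less_Suc_eq intro: le_trans\<close>)
  next
    case (7 v2 R2)
    then show ?case using lab_max by (metis le_antisym)
  qed (use 2 in \<open>auto simp: scan_edge_def\<close>)
  show ?case unfolding R1
  proof (rule tri_Seq[OF loop], goal_cases)
    case (1 v2 R2)
    have v2: "v2 xn = n" "v2 xm = m" "v2 xD = D"
      using 1 2 by (simp_all add: same_except_def scan_edge_def)
    show ?case
    proof (rule tri_Seq[where P = "\<lambda>v' R'. v' xbig = 1 \<and> v' xX = k"], goal_cases)
      case 1
      show ?case by (simp add: tri_def)
    next
      case (2 v3 R3)
      have v3: "v3 xn = n" "v3 xm = m" "v3 xD = D" "v3 xT = T" "v3 xp = block_start len m"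
        using 1 2 v2 by (simp_all add: same_except_def)
      have loop2: "tri limit (For xj xT (Assign xbig (Plus (V xbig) (V xX)))) v3 R3 (T * 2 + 1)
          (\<lambda>v' R'. v' xbig = v3 xbig + T * v3 xX)"
        by (rule tri_add_loop) (use v3 in auto)
      show ?case
        by (rule tri_Seq[OF loop2]) (use v3 2 in \<open>auto simp: tri_def params_def same_except_def\<close>)
    qed
  qed
qed

definition parse_edge :: hcom where
  "parse_edge = (Upd 1 (V xe) (Arr 0 (V xp)) ;; Upd 2 (V xe) (Arr 0 (Plus (V xp) (N 1))) ;;
       Assign xlen (Arr 0 (Plus (V xp) (N 2))) ;; Assign xp (Plus (V xp) (N 3))) ;;
     For xj xlen (Upd 3 (Plus (V xrow) (Arr 0 (V xp))) (N 1) ;; incr xp) ;;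
     Assign xrow (Plus (V xrow) (Plus (V xT) (N 1)))"

definition parse_prog :: hcom where
  "parse_prog = (Assign xp (N 3) ;; Assign xrow (N 0)) ;; For xe xm parse_edge"

text \<open>Parsing only writes ones, so inactive times are recorded correctly only because the rest
  of array 3 is still zero; this is carried along.\<close>

lemma tri_parse_edge:
  assumes v: "v 0 = limit" "v xT = T" "v xp = block_start len e" "v xe = e" "v xrow = e * Suc T"
    and e: "e < m" and raw: "R 0 = raw" and g: "graph_tables R e" and z: "\<And>a. e * Suc T \<le> a \<Longrightarrow> R 3 a = 0"
  shows "tri limit parse_edge v R (4 + ((T * (2 + 1) + 1) + 1))
    (\<lambda>v' R'. v' xp = block_start len (Suc e) \<and> v' xrow = Suc e * Suc T \<and> graph_tables R' (Suc e) \<and>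
       (\<forall>a\<ge>Suc e * Suc T. R' 3 a = 0))"
proof -
  let ?R = "R(1 := (R 1)(e := eu e), 2 := (R 2)(e := ev e))"
  have raws: "raw (block_start len e) = eu e" "raw (Suc (block_start len e)) = ev e"
    "raw (block_start len e + 2) = len e" using e raw_edge by auto
  have lims: "block_start len e < limit" "Suc (block_start len e) < limit" "block_start len e + 2 < limit"
    using block_less[OF e, of 0] block_less[OF e, of 1] block_less[OF e, of 2] by auto
  show ?thesis
    unfolding parse_edge_def
  proof (rule tri_Seq[where P = "\<lambda>v' R'. v' xlen = len e \<and> v' xp = block_start len e + 3 \<and> R' = ?R"],
      goal_cases)
    case 1
    show ?case using v raw raws lims by (simp add: tri_def arr_ok_def)
  next
    case (2 v1 R1)
    then have R1: "R1 = ?R" by simp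
    have v1: "v1 0 = limit" "v1 xT = T" "v1 xe = e" "v1 xrow = e * Suc T"
      using 2 v by (simp_all add: same_except_def)
    let ?I = "\<lambda>j (v' :: nat \<Rightarrow> nat) R'. v' xp = block_start len e + 3 + j \<and>
        (\<forall>t\<le>T. R' 3 (e * Suc T + t) = of_bool (\<exists>j'<j. lab e j' = t)) \<and>
        (\<forall>a<e * Suc T. R' 3 a = R 3 a) \<and> (\<forall>a\<ge>Suc e * Suc T. R' 3 a = (0 :: nat))"
    have "tri limit (For xj xlen (Upd 3 (Plus (V xrow) (Arr 0 (V xp))) (N 1) ;; incr xp)) v1 ?R
        (len e * (2 + 1) + 1) (?I (len e))"
    proof (rule tri_For[where I = ?I], goal_cases)
      case 5
      then show ?case using 2 z by simp
    next
      case (6 j v2 R2)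
      have v2: "v2 0 = limit" "v2 xrow = e * Suc T" "v2 xp = block_start len e + 3 + j" "R2 0 = raw"
        using 6 v1 raw by (simp_all add: same_except_def)
      have l: "raw (block_start len e + 3 + j) = lab e j" "lab e j \<le> T" using 6 e raw_edge(4) lab_le by auto
      have "block_start len e + 3 + j < limit" using block_less[OF e, of "3 + j"] 6(1) by simp
      then have "tri limit (Upd 3 (Plus (V xrow) (Arr 0 (V xp))) (N 1) ;; incr xp) v2 R2 2
          (\<lambda>v' R'. v' xp = block_start len e + 3 + Suc j \<and> R' 3 = (R2 3)(e * Suc T + lab e j := 1))"
        using v2 l by (simp add: tri_def arr_ok_def)
      then show ?case
        by (rule tri_conseq) (use 6(2) l(2) in \<open>auto simp: less_Suc_eq\<close>)
    qed (use 2 in auto)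
    then have loop: "tri limit (For xj xlen (Upd 3 (Plus (V xrow) (Arr 0 (V xp))) (N 1) ;; incr xp)) v1 ?R
        (T * (2 + 1) + 1) (?I (len e))"
      by (rule tri_conseq) (use len_le[OF e] in auto)
    show ?case unfolding R1
    proof (rule tri_Seq[OF loop], goal_cases)
      case (1 v2 R2)
      have v2: "v2 xrow = e * Suc T" "v2 xT = T" "R2 1 = (R 1)(e := eu e)" "R2 2 = (R 2)(e := ev e)"
        using 1 v1 by (simp_all add: same_except_def)
      have "graph_tables R2 (Suc e)"
        unfolding graph_tables_def
      proof (intro allI impI conjI)
        fix e' assume e': "e' < Suc e"
        show "R2 1 e' = eu e'" "R2 2 e' = ev e'"
          using e' g v2 by (auto simp: graph_tables_def less_Suc_eq)
        fix t assume t: "t \<le> T"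
        show "R2 3 (e' * Suc T + t) = of_bool (act e' t)"
        proof (cases "e' = e")
          case True
          then show ?thesis using 1(1) t act_iff[OF e] by simp
        next
          case False
          then have "e' < e" using e' by simp
          then have "e' * Suc T + t < e * Suc T" using t by (intro row_index_less) auto
          then have "R2 3 (e' * Suc T + t) = R 3 (e' * Suc T + t)" using 1(1) by blast
          also have "\<dots> = of_bool (act e' t)" using g \<open>e' < e\<close> t unfolding graph_tables_def by blast
          finally show ?thesis .
        qed
      qed
      then show ?case using 1(1) v2 by (simp add: tri_def)
    qed
  qed
qed

lemma tri_parse_prog:
  assumes v: "params limit v" and raw: "R 0 = raw" and z: "\<And>a. R 3 a = 0"
  shows "tri limit parse_prog v R (2 + (m * (4 + ((T * (2 + 1) + 1) + 1) + 1) + 1))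
    (\<lambda>v' R'. graph_tables R' m)"
  unfolding parse_prog_def
proof (rule tri_Seq[where P = "\<lambda>v' R'. v' xp = 3 \<and> v' xrow = 0"], goal_cases)
  case 1
  show ?case by (simp add: tri_def)
next
  case (2 v1 R1)
  then have R1: "R1 = R" by (auto simp: same_except_def)
  have v1: "v1 0 = limit" "v1 xT = T" "v1 xm = m"
    using 2 v by (simp_all add: same_except_def params_def)
  show ?case unfolding R1
  proof (rule tri_For[where I = "\<lambda>e v' R'. v' xp = block_start len e \<and> v' xrow = e * Suc T \<and>
      graph_tables R' e \<and> (\<forall>a\<ge>e * Suc T. R' 3 a = 0)"], goal_cases)
    case (6 e v2 R2)
    have "v2 0 = limit" "v2 xT = T" "R2 0 = raw"
      using 6 v1 raw by (simp_all add: same_except_def parse_edge_def)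
    then have "tri limit parse_edge v2 R2 (4 + ((T * (2 + 1) + 1) + 1))
      (\<lambda>v' R'. v' xp = block_start len (Suc e) \<and> v' xrow = Suc e * Suc T \<and> graph_tables R' (Suc e) \<and>
       (\<forall>a\<ge>Suc e * Suc T. R' 3 a = 0))"
      by (intro tri_parse_edge) (use 6 in auto)
    then show ?case by (rule tri_conseq) auto
  qed (use 2 v1 z in \<open>auto simp: parse_edge_def graph_tables_def\<close>)
qed

end


subsection \<open>The whole program\<close>

definition run_time :: "nat \<Rightarrow> nat \<Rightarrow> nat \<Rightarrow> nat \<Rightarrow> nat \<Rightarrow> nat \<Rightarrow> nat \<Rightarrow> nat \<Rightarrow> nat \<Rightarrow> nat \<Rightarrow> nat" where
  "run_time n m k D T a g b p w =
    (5 + ((m * (2 + (T * (3 + 1) + 1) + 1) + 1) + (2 + ((T * 2 + 1) + 1)))) +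
    ((2 + (m * (4 + ((T * (2 + 1) + 1) + 1) + 1) + 1)) +
    ((1 + (1 + (k * (1 + (n * 2 + 1 + 1) + 1) + 1)) +
        (4 + (a * (n * (4 + (m * (3 + 1) + 1 + 2) + 1) + 1 + 1 + 1) + 1 + 1))) +
    ((T * (1 + (g * (2 + (m * (4 + 1) + 1) + 2 + 1) + 1) + 1) + 1) +
    ((2 + (((D - 1) * (1 + (b * 2 + 1 + 1) + 1) + 1) + (1 + (b * 2 + 1)))) +
    ((2 + (w * (6 + 1) + 1)) +
    ((2 + (T * ((1 + ((p * (1 + 1) + 1) + (1 + ((w * ((1 + (2 + (m * (3 + (D * (7 + 1) + 1 + 3) + 1) + 1)) +
      (2 + (1 + 7))) + 1) + 1) + 2)))) + 1) + 1)) +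
    ((2 + (p * (3 + 1) + 1)) +
    (4 + ((T * (1 + (2 + 1) + ((k * (5 + 1) + 1) + 3) + 1) + 1) + 1)))))))))"

text \<open>Each monomial has at most one factor from each of \<open>T\<close>, \<open>D\<close>,
  \<open>n + m\<close> and \<open>P\<close>, apart from a possible \<open>k\<close>. The dominating
  one is \<open>T * D * m * w\<close>, the test of all windows at all times.\<close>

lemma run_time_le:
  assumes "1 \<le> T" "1 \<le> D" "1 \<le> n" "1 \<le> m" "1 \<le> P"
    and "n * a \<le> P" "g \<le> P" "b \<le> P" "p \<le> P" "w \<le> P"
  shows "run_time n m k D T a g b p w \<le> (200 + 20 * k) * (T * D * (n + m) * P)"
proof -
  define U where "U = T * D * (n + m) * P"
  \<comment> \<open>A name for the difference keeps truncated subtraction out of the expansion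
    below.\<close>
  define E where "E = D - 1"
  have E: "E \<le> D" by (simp add: E_def)
  have mono: "x * y * z * q \<le> U" if "x \<le> T" "y \<le> D" "z \<le> n + m" "q \<le> P" for x y z q
    unfolding U_def using that by (intro mult_le_mono)
  have "1 * a \<le> n * a" using assms by (intro mult_le_mono1) simp
  then have aP: "a \<le> P" using assms by linarith
  have facts: "1 \<le> U" "m \<le> U" "T * m \<le> U" "T \<le> U" "n \<le> U" "a \<le> U" "n * a \<le> U" "m * (n * a) \<le> U"
      "T * g \<le> U" "T * m * g \<le> U" "E \<le> U" "E * b \<le> U" "b \<le> U" "w \<le> U" "T * p \<le> U" "T * w \<le> U"
      "T * m * w \<le> U" "T * D * m * w \<le> U" "p \<le> U"
    using mono[of 1 1 1 1] mono[of 1 1 m 1] mono[of T 1 m 1] mono[of T 1 1 1] mono[of 1 1 n 1]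
      mono[of 1 1 1 a] mono[of 1 1 1 "n * a"] mono[of 1 1 m "n * a"] mono[of T 1 1 g] mono[of T 1 m g]
      mono[of 1 E 1 1] mono[of 1 E 1 b] mono[of 1 1 1 b] mono[of 1 1 1 w] mono[of T 1 1 p]
      mono[of T 1 1 w] mono[of T 1 m w] mono[of T D m w] mono[of 1 1 1 p] assms E aP
    by simp_all
  have kfacts: "k \<le> k * U" "k * n \<le> k * U" "k * T \<le> k * U"
    using mult_le_mono2[OF facts(1), of k] mult_le_mono2[OF facts(5), of k] mult_le_mono2[OF facts(4), of k]
    by simp_all
  have "run_time n m k D T a g b p w = 43 + 11 * m + 7 * (T * m) + 21 * T + 3 * a + 8 * (n * a) +
      4 * (m * (n * a)) + 6 * (T * g) + 5 * (T * m * g) + 4 * E + 2 * (E * b) + 2 * b + 7 * w +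
      2 * (T * p) + 15 * (T * w) + 8 * (T * m * w) + 8 * (T * D * m * w) + 4 * p +
      4 * k + 2 * (k * n) + 6 * (k * T)"
    unfolding run_time_def E_def[symmetric] by (simp add: algebra_simps)
  \<comment> \<open>The coefficients add up to 160 without \<open>k\<close> and to 12 with
    \<open>k\<close>; 200 and 20 are round bounds.\<close>
  also have "\<dots> \<le> 200 * U + 20 * (k * U)"
    using facts kfacts by linarith
  finally have "run_time n m k D T a g b p w \<le> 200 * U + 20 * (k * U)" .
  then show ?thesis by (simp add: U_def algebra_simps)
qed

context encoded_instance
begin

text \<open>\<open>k\<close> is the only locale parameter in the program text, so outside the locale
  it is \<open>encoded_instance.main_prog k\<close>, one program for all instances.\<close>

definition main_prog :: hcom where
  "main_prog = scan_prog ;; parse_prog ;; trie_prog ;; cover_prog ;; pow_prog ;; digit_prog ;;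
     dp_prog ;; best_prog ;; trace_prog"

lemmas prog_defs = scan_prog_def scan_edge_def parse_prog_def parse_edge_def trie_prog_def geo_prog_def
  trie_node_def hit_row_def cover_prog_def cover_test_def pow_prog_def digit_prog_def dp_prog_def
  dp_layer_def dp_step_def window_test_def window_edge_def window_step_def node_prog_def best_prog_def
  trace_prog_def trace_step_def emit_step_def

lemma vars_below_main_prog: "vars_below 40 main_prog"
  by (simp add: main_prog_def prog_defs)

definition solved :: "(nat \<Rightarrow> nat) \<Rightarrow> bool" where
  "solved mem \<longleftrightarrow> (\<exists>out. mem 0 = length out \<and> emitted mem (length out) = out \<and> distinct out \<and>
     length out \<le> T * k \<and> feasible (set out) \<and> set out \<subseteq> {..<n} \<times> {1..T} \<and>
     (\<forall>S. feasible S \<longrightarrow> S \<subseteq> {..<n} \<times> {1..T} \<longrightarrow> card (set out) \<le> card S))"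

lemma tri_main_prog:
  assumes R: "R = (\<lambda>b. if b = 0 then raw else (\<lambda>_. 0))"
  shows "tri limit main_prog v R (run_time n m k D T A (geo n (Suc k)) B M NW) (\<lambda>v' R'. solved (R' 0))"
  unfolding main_prog_def run_time_def
proof (rule tri_Seq[where P = "\<lambda>v' R'. params limit v'"], goal_cases)
  case 1
  have "R = R(0 := raw)" using R by auto
  then show ?case using tri_scan_prog[of v R] by simp
next
  case (2 v1 R1)
  then have v1: "params limit v1" and R1: "R1 = R"
    by (auto simp: same_except_def prog_defs)
  show ?case unfolding R1
  proof (rule tri_Seq[where P = "\<lambda>v' R'. graph_tables R' m"], goal_cases)
    case 1
    show ?case by (rule tri_parse_prog) (use v1 R in auto)
  next
    case (2 v2 R2)
    have v2: "params limit v2" using 2(2) v1 by (simp add: same_except_def prog_defs params_def)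
    have R2: "R2 b = R b" if "b \<notin> {1, 2, 3}" for b
      using 2(2) that by (simp add: same_except_def prog_defs)
    show ?case
    proof (rule tri_Seq[where P = "\<lambda>v' R'. v' xA = A \<and> v' xB = B \<and> v' xNA = geo n (Suc k) \<and>
        trie_tables R' (geo n (Suc k))"], goal_cases)
      case 1
      show ?case by (rule tri_trie_prog) (use 2(1) v2 R2 R in \<open>auto simp: params_def\<close>)
    next
      case (2 v3 R3)
      have v3: "params limit v3" using 2(2) v2 by (simp add: same_except_def prog_defs params_def)
      have R3: "R3 b = R2 b" if "b \<notin> {4, 5, 6, 7, 8}" for b
        using 2(2) that by (simp add: same_except_def prog_defs)
      have g3: "graph_tables R3 m"
        using \<open>graph_tables R2 m\<close> by (simp add: graph_tables_def R3)
      show ?case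
      proof (rule tri_Seq[where P = "\<lambda>v' R'. cover_codes (R' 9)"], goal_cases)
        case 1
        show ?case by (rule tri_cover_prog) (use 2(1) v3 g3 cover_exists in \<open>auto simp: params_def\<close>)
      next
        case (2 v4 R4)
        have v4: "params limit v4" "v4 xA = A" "v4 xB = B"
          using 2(2) v3 \<open>v3 xA = A \<and> _\<close> by (simp_all add: same_except_def prog_defs params_def)
        have R4: "R4 b = R3 b" if "b \<noteq> 9" for b
          using 2(2) that by (simp add: same_except_def prog_defs)
        have g4: "graph_tables R4 m" "trie_tables R4 (geo n (Suc k))"
          using g3 \<open>v3 xA = A \<and> _\<close> by (simp_all add: graph_tables_def trie_tables_def R4)
        show ?case
        proof (rule tri_Seq[where P = "\<lambda>v' R'. v' xM = M \<and> v' xNW = NW"], goal_cases)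
          case 1
          show ?case by (rule tri_pow_prog) (use v4 in \<open>auto simp: params_def\<close>)
        next
          case (2 v5 R5)
          have v5: "params limit v5" "v5 xA = A" "v5 xB = B"
            using 2(2) v4 by (simp_all add: same_except_def prog_defs params_def)
          have R5: "R5 = R4" using 2(2) by (auto simp: same_except_def prog_defs)
          show ?case unfolding R5
          proof (rule tri_Seq[where P = "\<lambda>v' R'. digit_tables R' NW"], goal_cases)
            case 1
            show ?case by (rule tri_digit_prog) (use 2(1) v5 in \<open>auto simp: params_def\<close>)
          next
            case (2 v6 R6)
            have v6: "params limit v6" "v6 xA = A" "v6 xM = M" "v6 xNW = NW"
              using 2(2) v5 \<open>v5 xM = M \<and> _\<close> by (simp_all add: same_except_def prog_defs params_def)
            have R6: "R6 b = R4 b" if "b \<notin> {10, 11}" for b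
              using 2(2) that by (simp add: same_except_def prog_defs)
            have tab: "tables R6"
              using g4 \<open>cover_codes (R4 9)\<close> 2(1)
              by (simp add: tables_def graph_tables_def trie_tables_def R6)
            show ?case
            proof (rule tri_Seq[where P = "\<lambda>v' R'. v' xb0 = T * M \<and>
                dp_table (R6 9) (val_table R') (pred_table R') T"], goal_cases)
              case 1
              have "R6 12 = (\<lambda>_. 0)" using R by (simp add: R6 R4 R3 R2)
              then show ?case
                by (intro tri_dp_prog) (use v6 tab in \<open>auto simp: params_def\<close>)
            next
              case (2 v7 R7)
              have v7: "params limit v7" "v7 xA = A" "v7 xM = M"
                using 2(2) v6 by (simp_all add: same_except_def prog_defs params_def)
              have R7: "R7 b = R6 b" if "b \<notin> {12, 13}" for b
                using 2(2) that by (simp add: same_except_def prog_defs)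
              have tab7: "tables R7" using tab R7 by (auto intro: tables_cong)
              have dp: "dp_table (R7 9) (val_table R7) (pred_table R7) T" using 2(1) R7[of 9] by simp
              show ?case
              proof (rule tri_Seq[where P = "\<lambda>v' R'. v' xbq < M \<and>
                  (\<forall>q<M. val_table R7 T (v' xbq) \<le> val_table R7 T q)"], goal_cases)
                case 1
                show ?case by (rule tri_best_prog) (use 2(1) v7 in \<open>auto simp: params_def\<close>)
              next
                case (2 v8 R8)
                have v8: "params limit v8" "v8 xA = A" "v8 xM = M" "v8 xb0 = T * M"
                  using 2(2) v7 \<open>v7 xb0 = T * M \<and> _\<close>
                  by (simp_all add: same_except_def prog_defs params_def)
                have R8: "R8 = R7" using 2(2) by (auto simp: same_except_def prog_defs)
                let ?out = "out_list (R7 9) (pred_table R7) (v8 xbq) T"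
                have cn: "cover_codes (R7 9)" using tab7 by (simp add: tables_def)
                have best: "v8 xbq < M" "\<And>q. q < M \<Longrightarrow> val_table R7 T (v8 xbq) \<le> val_table R7 T q"
                  using 2(1) by auto
                have "tri limit trace_prog v8 R7
                    (4 + ((T * (1 + (2 + 1) + ((k * (5 + 1) + 1) + 3) + 1) + 1) + 1))
                    (\<lambda>v' R'. R' 0 0 = length ?out \<and> emitted (R' 0) (length ?out) = ?out)"
                  by (rule tri_trace_prog) (use v8 tab7 dp best in \<open>auto simp: params_def\<close>)
                then show ?case unfolding R8
                proof (rule tri_conseq, goal_cases)
                  case (2 v9 R9)
                  show ?case
                    unfolding solved_def
                    using 2(1) dp_output[OF dp cn best] by blast
                qed simp
              qed
            qed
          qed
        qed
      qed
    qed
  qed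
qed

end


section \<open>Time bound and output on the machine\<close>

context encoded_instance
begin

text \<open>The windows need only \<open>B ^ D\<close>, at most n^(k * D). The remaining factor n^k
  makes room for the trie, of order n^(k + 1): this fits since \<open>k\<close> and \<open>D\<close>
  are at least 1.\<close>

lemma run_time_bound:
  assumes "1 \<le> k" "1 \<le> m"
  shows "run_time n m k D T A (geo n (Suc k)) B M NW \<le> (200 + 20 * k) * (T * D * (n + m) * n ^ (k * (D + 1)))"
proof (rule run_time_le)
  have n1: "1 \<le> n" using n by simp
  have B: "B \<le> n ^ k" using geo_le_power[OF n, of k] by simp
  have pow: "n ^ i \<le> n ^ (k * (D + 1))" if "i \<le> k * (D + 1)" for i
    by (rule power_increasing) (use that n1 in auto)
  have BP: "B ^ i \<le> n ^ (k * (D + 1))" if "i \<le> D + 1" for i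
  proof -
    have "B ^ i \<le> (n ^ k) ^ i" using B by (rule power_mono) simp
    also have "\<dots> = n ^ (k * i)" by (simp add: power_mult)
    also have "\<dots> \<le> n ^ (k * (D + 1))" by (rule pow) (use that in \<open>intro mult_le_mono2\<close>)
    finally show ?thesis .
  qed
  show "B \<le> n ^ (k * (D + 1))" using BP[of 1] by simp
  show "M \<le> n ^ (k * (D + 1))" by (rule BP) simp
  show "NW \<le> n ^ (k * (D + 1))" by (rule BP) simp
  \<comment> \<open>This bounds both \<open>n * A\<close> and the number \<open>Suc (n * A)\<close>
    of trie nodes.\<close>
  have "n * B \<le> n * n ^ k" using B by (intro mult_le_mono2)
  also have "\<dots> = n ^ (k + 1)" by simp
  also have "\<dots> \<le> n ^ (k * (D + 1))"
  proof (rule pow)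
    have "k * 1 \<le> k * D" using D by (intro mult_le_mono2)
    then show "k + 1 \<le> k * (D + 1)" using assms by (simp add: distrib_left)
  qed
  finally have nB: "n * B \<le> n ^ (k * (D + 1))" .
  then show "n * A \<le> n ^ (k * (D + 1))" by simp
  show "geo n (Suc k) \<le> n ^ (k * (D + 1))" using nB n by simp
qed (use n D assms in auto)

lemma exec_main_prog:
  assumes k: "1 \<le> k" and m: "1 \<le> m" and xs: "length xs = block_start len m"
    and raw: "raw = (\<lambda>a. if a < length xs then xs ! a else 0)"
  shows "\<exists>t s. exec (compile 40 main_prog) (initial_state xs) t s \<and>
     t \<le> slowdown main_prog * (200 + 20 * k) * (T * D * (n + m) * n ^ (k * (D + 1))) \<and>
     distinct (result_list s) \<and> feasible (set (result_list s)) \<and>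
     set (result_list s) \<subseteq> {..<n} \<times> {1..T} \<and>
     (\<forall>S. feasible S \<longrightarrow> S \<subseteq> {..<n} \<times> {1..T} \<longrightarrow> card (set (result_list s)) \<le> card S)"
proof -
  define R :: "nat \<Rightarrow> nat \<Rightarrow> nat" where "R = (\<lambda>b. if b = 0 then raw else (\<lambda>_. 0))"
  define s0 :: hstate where "s0 = (\<lambda>_. 0, R)"
  have tri: "tri limit main_prog (\<lambda>_. 0) R (run_time n m k D T A (geo n (Suc k)) B M NW)
      (\<lambda>v' R'. solved (R' 0))"
    by (rule tri_main_prog[OF R_def])
  \<comment> \<open>Memory beyond the input is zero, so all arrays start empty.\<close>
  have "represents 40 limit s0 (initial_state xs)"
    using xs by (auto simp: represents_def s0_def R_def initial_state_def raw)
  moreover have "cok limit main_prog s0" using tri by (simp add: tri_def s0_def)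
  ultimately obtain t S where S: "exec (compile 40 main_prog) (initial_state xs) t S"
    "t \<le> slowdown main_prog * cost main_prog s0" "represents 40 limit (sem main_prog s0) S"
    using exec_compile[of 40 limit s0 "initial_state xs" main_prog] vars_below_main_prog by auto
  have "t \<le> slowdown main_prog * ((200 + 20 * k) * (T * D * (n + m) * n ^ (k * (D + 1))))"
    using S(2) tri run_time_bound[OF k m] unfolding tri_def s0_def
    by (meson le_trans mult_le_mono2)
  then have t: "t \<le> slowdown main_prog * (200 + 20 * k) * (T * D * (n + m) * n ^ (k * (D + 1)))"
    by (simp only: mult.assoc)
  have "solved (snd (sem main_prog s0) 0)" using tri by (auto simp: tri_def s0_def split: prod.splits)
  then obtain out where out: "snd (sem main_prog s0) 0 0 = length out"
      "emitted (snd (sem main_prog s0) 0) (length out) = out"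
    and props: "distinct out" "length out \<le> T * k" "feasible (set out)" "set out \<subseteq> {..<n} \<times> {1..T}"
      "\<forall>S. feasible S \<longrightarrow> S \<subseteq> {..<n} \<times> {1..T} \<longrightarrow> card (set out) \<le> card S"
    unfolding solved_def by blast
  have mem: "snd S i = snd (sem main_prog s0) 0 i" if "i < limit" for i
    using S(3) that by (simp add: represents_def)
  \<comment> \<open>The bound on the length keeps all output cells below \<open>limit\<close>, where
    machine memory agrees with array 0.\<close>
  have "result_list S = emitted (snd (sem main_prog s0) 0) (length out)"
    unfolding result_list_def emitted_def using mem out(1) props(2) by auto
  then have "result_list S = out" using out(2) by simp
  then show ?thesis using S(1) t props by blast
qed

end


subsection \<open>Temporal graphs\<close>

lemma nth_concat_map_block:
  assumes "e < length bs" "i < length (f (bs ! e))"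
  shows "concat (map f bs) ! (length (concat (map f (take e bs))) + i) = f (bs ! e) ! i"
proof -
  have "concat (map f bs) = concat (map f (take e bs)) @ f (bs ! e) @ concat (map f (drop (Suc e) bs))"
    by (subst id_take_nth_drop[OF assms(1)]) simp
  then show ?thesis using assms(2) by (simp add: nth_append)
qed

text \<open>Edges are nonempty, so the set of all vertices is a cover; hence the
  \<open>LEAST\<close> in the cover number is attained.\<close>

lemma vertex_cover_of_class:
  assumes "G \<in> vc_class k"
  shows "\<exists>C. vertex_cover G C \<and> finite C \<and> card C \<le> k"
proof -
  have sg: "simple_graph G" and vc: "vertex_cover_number G \<le> k" using assms by (auto simp: vc_class_def)
  have "e \<inter> fst G \<noteq> {}" if "e \<in> snd G" for e
  proof -
    have "e \<subseteq> fst G" "card e = 2" using sg that by (auto simp: simple_graph_def)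
    moreover from this have "e \<noteq> {}" by force
    ultimately show ?thesis by auto
  qed
  then have "vertex_cover G (fst G)" by (auto simp: vertex_cover_def)
  then have "\<exists>c C. vertex_cover G C \<and> card C = c" by blast
  then have "\<exists>C. vertex_cover G C \<and> card C = vertex_cover_number G"
    unfolding vertex_cover_number_def by (rule LeastI_ex)
  then obtain C where C: "vertex_cover G C" "card C = vertex_cover_number G" by blast
  then have "finite C" using sg finite_subset by (auto simp: vertex_cover_def simple_graph_def)
  then show ?thesis using C vc by auto
qed

lemma lifetime_props:
  assumes tg: "temporal_graph G lam"
  shows "e \<in> snd G \<Longrightarrow> t \<in> lam e \<Longrightarrow> 1 \<le> t \<and> t \<le> lifetime G lam"
    and "1 \<le> lifetime G lam \<Longrightarrow> \<exists>e\<in>snd G. lifetime G lam \<in> lam e"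
proof -
  have "finite (fst G)" "snd G \<subseteq> Pow (fst G)"
    using tg by (auto simp: temporal_graph_def simple_graph_def)
  then have "finite (snd G)" using finite_subset by blast
  then have fin: "finite (insert 0 (\<Union>e\<in>snd G. lam e))" using tg by (auto simp: temporal_graph_def)
  show "1 \<le> t \<and> t \<le> lifetime G lam" if "e \<in> snd G" "t \<in> lam e"
  proof
    show "t \<le> lifetime G lam" unfolding lifetime_def using fin that by (intro Max_ge) auto
    show "1 \<le> t" using that tg by (cases t) (auto simp: temporal_graph_def)
  qed
  show "\<exists>e\<in>snd G. lifetime G lam \<in> lam e" if "1 \<le> lifetime G lam"
    using Max_in[OF fin] that unfolding lifetime_def[symmetric] by auto
qed

text \<open>Windows are indexed by their last time in the dynamic program.\<close>

lemma ex_window_iff: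
  assumes "1 \<le> D" "t' = t + D - 1"
  shows "(\<exists>s\<in>window D t. P s) \<longleftrightarrow> (\<exists>i<D. P (t' - i))"
proof
  assume "\<exists>s\<in>window D t. P s"
  then obtain s where "t \<le> s" "s < t + D" "P s" by (auto simp: window_def)
  then show "\<exists>i<D. P (t' - i)" using assms by (intro exI[of _ "t' - s"]) auto
next
  assume "\<exists>i<D. P (t' - i)"
  then obtain i where "i < D" "P (t' - i)" by blast
  then show "\<exists>s\<in>window D t. P s" using assms by (intro bexI[of _ "t' - i"]) (auto simp: window_def)
qed

lemma all_windows_iff:
  fixes D T :: nat
  assumes "1 \<le> D" "D \<le> T"
  shows "(\<forall>t\<in>{1..T - D + 1}. P t) \<longleftrightarrow> (\<forall>t'\<in>{D..T}. P (t' - D + 1))"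
proof
  assume *: "\<forall>t'\<in>{D..T}. P (t' - D + 1)"
  show "\<forall>t\<in>{1..T - D + 1}. P t"
  proof
    fix t assume "t \<in> {1..T - D + 1}"
    then have "t + D - 1 \<in> {D..T}" "t + D - 1 - D + 1 = t" using assms by auto
    then show "P t" using * by metis
  qed
qed (use assms in auto)

lemma sw_tvc_iff_feasible:
  assumes par: "2 \<le> n" "1 \<le> D" "D \<le> lifetime G lam" and V: "fst G = {..<n}"
    and edges: "snd G = (\<lambda>e. {eu e, ev e}) ` {..<m}"
  shows "sw_tvc G lam D S \<longleftrightarrow> S \<subseteq> {..<n} \<times> {1..lifetime G lam} \<and>
    instance_data.feasible m D (lifetime G lam) eu ev (\<lambda>e t. t \<in> lam {eu e, ev e}) S"
proof -
  let ?T = "lifetime G lam"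
  \<comment> \<open>The 0 in the place of \<open>k\<close> is a placeholder: \<open>feasible\<close>
    is exported with the parameters \<open>m\<close>, \<open>D\<close>, \<open>T\<close>,
    \<open>eu\<close>, \<open>ev\<close> and \<open>act\<close>.\<close>
  interpret instance_data n m 0 D ?T eu ev "\<lambda>e t. t \<in> lam {eu e, ev e}"
    using par by unfold_locales
  have "(\<forall>e\<in>window_edges G lam D (t' - D + 1). \<exists>(w, s)\<in>S. s \<in> window D (t' - D + 1) \<and>
        temporally_covers lam (w, s) e) \<longleftrightarrow>
      (\<forall>e<m. (\<exists>i<D. t' - i \<in> lam {eu e, ev e}) \<longrightarrow>
         (\<exists>i<D. t' - i \<in> lam {eu e, ev e} \<and> ((eu e, t' - i) \<in> S \<or> (ev e, t' - i) \<in> S)))"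
    (is "?l \<longleftrightarrow> ?r") if "t' \<in> {D..?T}" for t'
  proof -
    let ?t = "t' - D + 1"
    have t': "t' = ?t + D - 1" using that par by auto
    have "?l \<longleftrightarrow> (\<forall>e<m. (\<exists>s\<in>window D ?t. s \<in> lam {eu e, ev e}) \<longrightarrow>
       (\<exists>s\<in>window D ?t. s \<in> lam {eu e, ev e} \<and> ((eu e, s) \<in> S \<or> (ev e, s) \<in> S)))"
      unfolding window_edges_def edges_at_def edges temporally_covers_def
      by (auto; fastforce)
    also have "\<dots> \<longleftrightarrow> ?r" by (simp only: ex_window_iff[OF par(2) t'])
    finally show ?thesis .
  qed
  then show ?thesis
    unfolding sw_tvc_def vertex_appearances_def V all_windows_iff[OF par(2,3)] feasible_def by blast
qed

theorem theorem8:
  fixes k :: nat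
  shows "\<exists>(P :: com) (c :: nat). \<forall>(G :: nat graph) (lam :: nat labelling) (\<Delta> :: nat) (xs :: nat list).
    temporal_graph G lam \<longrightarrow> always (vc_class k) G lam \<longrightarrow>
    1 \<le> \<Delta> \<longrightarrow> \<Delta> \<le> lifetime G lam \<longrightarrow> encodes xs G lam \<Delta> \<longrightarrow>
    (\<exists>t s. exec P (initial_state xs) t s \<and>
       t \<le> c * (lifetime G lam * \<Delta> * (card (fst G) + card (snd G)) * card (fst G) ^ (k * (\<Delta> + 1))) \<and>
       distinct (result_list s) \<and> minimum_sw_tvc G lam \<Delta> (set (result_list s)))"
proof -
  \<comment> \<open>The slowdown is determined by the program text, so this constant depends on
    \<open>k\<close> alone.\<close>
  define c where "c = slowdown (encoded_instance.main_prog k) * (200 + 20 * k)"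
  show ?thesis
  proof (rule exI[of _ "compile 40 (encoded_instance.main_prog k)"], rule exI[of _ c],
      intro allI impI)
    fix G :: "nat graph" and lam :: "nat labelling" and \<Delta> :: nat and xs :: "nat list"
    assume tg: "temporal_graph G lam" and alw: "always (vc_class k) G lam"
      and \<Delta>: "1 \<le> \<Delta>" "\<Delta> \<le> lifetime G lam" and enc: "encodes xs G lam \<Delta>"
    define n where "n = card (fst G)"
    define T where "T = lifetime G lam"
    obtain bs :: "(nat \<times> nat \<times> nat list) list" where V: "fst G = {..<n}"
      and dist: "distinct (map (\<lambda>(u, v, ls). {u, v}) bs)"
      and E: "set (map (\<lambda>(u, v, ls). {u, v}) bs) = snd G"
      and ls: "\<forall>(u, v, ls)\<in>set bs. distinct ls \<and> set ls = lam {u, v}"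
      and xs: "xs = [n, length bs, \<Delta>] @ concat (map (\<lambda>(u, v, ls). [u, v, length ls] @ ls) bs)"
      using enc unfolding encodes_def n_def by blast
    define m where "m = length bs"
    define eu ev len lab where "eu e = fst (bs ! e)" and "ev e = fst (snd (bs ! e))"
      and "len e = length (snd (snd (bs ! e)))" and "lab e j = snd (snd (bs ! e)) ! j" for e j
    define act where "act = (\<lambda>e t. t \<in> lam {eu e, ev e})"
    define raw where "raw = (\<lambda>a. if a < length xs then xs ! a else 0)"
    have m: "card (snd G) = m" using distinct_card[OF dist] E by (simp add: m_def)
    have edges: "snd G = (\<lambda>e. {eu e, ev e}) ` {..<m}"
    proof -
      have "snd G = (\<lambda>b. {fst b, fst (snd b)}) ` set bs" using E by (auto simp: case_prod_beta)
      also have "set bs = (!) bs ` {..<m}" by (auto simp: set_conv_nth m_def)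
      finally show ?thesis by (simp add: image_image eu_def ev_def)
    qed
    have labels: "distinct (snd (snd (bs ! e)))" "set (snd (snd (bs ! e))) = lam {eu e, ev e}"
      if "e < m" for e
    proof -
      have "bs ! e \<in> set bs" using that by (simp add: m_def)
      then show "distinct (snd (snd (bs ! e)))" "set (snd (snd (bs ! e))) = lam {eu e, ev e}"
        using bspec[OF ls, of "bs ! e"] by (simp_all add: eu_def ev_def case_prod_beta)
    qed
    have act_iff: "act e t \<longleftrightarrow> (\<exists>j<len e. lab e j = t)" if "e < m" for e t
    proof -
      have "act e t \<longleftrightarrow> t \<in> set (snd (snd (bs ! e)))" unfolding labels(2)[OF that] by (simp add: act_def)
      then show ?thesis by (simp only: in_set_conv_nth len_def lab_def)
    qed
    have act_range: "1 \<le> t \<and> t \<le> T" if "e < m" "act e t" for e t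
    proof -
      have "{eu e, ev e} \<in> snd G" using edges that by blast
      then show ?thesis using lifetime_props(1)[OF tg] that unfolding act_def T_def by blast
    qed
    have "1 \<le> lifetime G lam" using \<Delta> by simp
    then obtain a0 where a0: "a0 \<in> snd G" "T \<in> lam a0"
      using lifetime_props(2)[OF tg] unfolding T_def by blast
    then obtain e0 where e0: "e0 < m" "act e0 T" unfolding edges act_def by blast
    \<comment> \<open>An edge active at the last time has two distinct endpoints.\<close>
    have n: "2 \<le> n"
    proof -
      have "{eu e0, ev e0} \<in> snd G" using edges e0 by auto
      then have "{eu e0, ev e0} \<subseteq> fst G" "card {eu e0, ev e0} = 2"
        using tg unfolding temporal_graph_def simple_graph_def by blast+
      then have "2 \<le> card (fst G)" using V by (metis card_mono finite_lessThan)
      then show ?thesis by (simp add: n_def)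
    qed
    interpret instance_data n m k \<Delta> T eu ev act
      using n \<Delta> by unfold_locales (simp_all add: T_def)
    let ?f = "\<lambda>(u, v, ls). [u, v, length ls] @ (ls :: nat list)"
    have f: "?f (bs ! e) = [eu e, ev e, len e] @ snd (snd (bs ! e))" for e
      by (simp add: eu_def ev_def len_def case_prod_beta)
    have start: "block_start len e = 3 + length (concat (map ?f (take e bs)))" if "e \<le> m" for e
      using that
    proof (induction e)
      case (Suc e)
      then show ?case using f[of e] by (simp add: take_Suc_conv_app_nth m_def len_def)
    qed simp
    have lxs: "length xs = block_start len m" using start[of m] by (simp add: xs m_def)
    have block: "raw (block_start len e + i) = ([eu e, ev e, len e] @ snd (snd (bs ! e))) ! i"
      if "e < m" "i < 3 + len e" for e i
    proof -
      have "block_start len (Suc e) \<le> block_start len m" using that by (intro block_start_mono) simp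
      then have "block_start len e + i < length xs" using that lxs by simp
      moreover have "xs ! (block_start len e + i) = ?f (bs ! e) ! i"
        using nth_concat_map_block[of e bs i ?f] that start[of e] f[of e]
        by (simp add: xs m_def len_def nth_append)
      ultimately show ?thesis using f by (simp add: raw_def)
    qed
    have good_ex: "\<exists>x. good t x" if t: "t \<in> {1..T}" for t
    proof -
      have "snapshot G lam t \<in> vc_class k" using alw t by (simp add: always_def T_def)
      then obtain C where C: "vertex_cover (snapshot G lam t) C" "finite C" "card C \<le> k"
        using vertex_cover_of_class by blast
      \<comment> \<open>Listed without repetition, the cover has length at most \<open>k\<close> and
        therefore a code.\<close>
      obtain vs where vs: "set vs = C" "distinct vs" using finite_distinct_list[OF C(2)] by metis
      have "C \<subseteq> {..<n}" using C(1) V by (simp add: vertex_cover_def snapshot_def)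
      moreover have "length vs \<le> k" using vs C(3) distinct_card by metis
      ultimately obtain x where x: "x < geo n (Suc k)" "nlist n x = vs"
        using nlist_surj[of vs n k] vs by auto
      have "hits x e" if "e < m" "act e t" for e
      proof -
        have "{eu e, ev e} \<in> edges_at G lam t" using that edges by (auto simp: edges_at_def act_def)
        then have "{eu e, ev e} \<inter> C \<noteq> {}" using C(1) by (auto simp: vertex_cover_def snapshot_def)
        then show ?thesis using x vs by (auto simp: hits_def)
      qed
      then show ?thesis using x by (auto simp: good_def)
    qed
    interpret encoded_instance n m k \<Delta> T eu ev act len lab raw
    proof unfold_locales
      fix e j
      show "e < m \<Longrightarrow> j < len e \<Longrightarrow> lab e j \<le> T" using act_iff act_range by blast
      show "e < m \<Longrightarrow> len e \<le> T"
      proof -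
        assume e: "e < m"
        \<comment> \<open>Labels in a block are distinct and lie between 1 and \<open>T\<close>,
          which bounds the length of the block.\<close>
        have "len e = card (set (snd (snd (bs ! e))))" using labels(1)[OF e] by (simp add: len_def distinct_card)
        also have "\<dots> \<le> card {1..T}"
          using labels(2)[OF e] act_range[OF e] by (intro card_mono) (auto simp: act_def)
        finally show ?thesis by simp
      qed
      show "e < m \<Longrightarrow> raw (block_start len e) = eu e" using block[of e 0] by simp
      show "e < m \<Longrightarrow> raw (Suc (block_start len e)) = ev e" using block[of e 1] by simp
      show "e < m \<Longrightarrow> raw (block_start len e + 2) = len e" using block[of e 2] by simp
      show "e < m \<Longrightarrow> j < len e \<Longrightarrow> raw (block_start len e + 3 + j) = lab e j"
        using block[of e "3 + j"] by (simp add: lab_def add.assoc)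
    next
      show "\<exists>e<m. \<exists>j<len e. lab e j = T" using e0 act_iff by blast
      show "raw 0 = n" "raw 1 = m" "raw 2 = \<Delta>" by (simp_all add: raw_def xs m_def)
    qed (use act_iff good_ex in auto)
    \<comment> \<open>The snapshot at time \<open>T\<close> has an edge, so the sequence covering it
      cannot be empty.\<close>
    have k: "1 \<le> k"
    proof -
      have "T \<in> {1..T}" using \<Delta> by (simp add: T_def)
      then obtain x where x: "good T x" using good_ex by blast
      then have "hits x e0" using e0 by (simp add: good_def)
      then have "length (nlist n x) \<noteq> 0" by (auto simp: hits_def)
      moreover have "length (nlist n x) \<le> k" using x by (intro length_nlist_le) (simp add: good_def)
      ultimately show ?thesis by linarith
    qed
    have "1 \<le> m" using e0 by simp
    from exec_main_prog[OF k this lxs raw_def]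
    obtain t s where ts: "exec (compile 40 main_prog) (initial_state xs) t s"
      "t \<le> slowdown main_prog * (200 + 20 * k) * (T * \<Delta> * (n + m) * n ^ (k * (\<Delta> + 1)))"
      "distinct (result_list s)" "feasible (set (result_list s))"
      "set (result_list s) \<subseteq> {..<n} \<times> {1..T}"
      "\<And>S. feasible S \<Longrightarrow> S \<subseteq> {..<n} \<times> {1..T} \<Longrightarrow> card (set (result_list s)) \<le> card S"
      by blast
    have sw: "sw_tvc G lam \<Delta> S \<longleftrightarrow> S \<subseteq> {..<n} \<times> {1..T} \<and> feasible S" for S
      unfolding T_def act_def by (rule sw_tvc_iff_feasible[OF n \<Delta> V edges])
    have "minimum_sw_tvc G lam \<Delta> (set (result_list s))"
      unfolding minimum_sw_tvc_def sw using ts by blast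
    then show "\<exists>t s. exec (compile 40 (encoded_instance.main_prog k)) (initial_state xs) t s \<and>
       t \<le> c * (lifetime G lam * \<Delta> * (card (fst G) + card (snd G)) * card (fst G) ^ (k * (\<Delta> + 1))) \<and>
       distinct (result_list s) \<and> minimum_sw_tvc G lam \<Delta> (set (result_list s))"
      using ts(1-3) unfolding c_def m n_def[symmetric] T_def[symmetric] by blast
  qed
qed

end
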